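(* There is a 2-adjunction $$\mathsf{RaPar}\dashv\mathsf{Total}:\mathfrak{SplitRangeCat}\longrightarrow\mathfrak{StableFact},$$ i.e. the 2-functor $\mathsf{RaPar}:\mathfrak{StableFact}\to\mathfrak{SplitRangeCat}$ is left 2-adjoint to the 2-functor $\mathsf{Total}:\mathfrak{SplitRangeCat}\to\mathfrak{StableFact}$.
   Context: The 2-category $\mathfrak{StableFact}$ (very large): objects are triples $(\mathcal C,\mathcal P,\mathcal S)$ where $\mathcal C$ is a category equipped with an orthogonal factorization system $(\mathcal P,\mathcal S)$ such that $\mathcal C$ has pullbacks along $\mathcal S$-morphisms and $\mathcal P$ is stable under them; 1-cells $F:(\mathcal C,\mathcal P,\mathcal S)\to(\mathcal D,\mathcal Q,\mathcal T)$ are functors $F:\mathcal C\to\mathcal D$ with $F(\mathcal P)\subseteq\mathcal Q$ and $F(\mathcal S)\subseteq\mathcal T$ which preserve pullbacks along $\mathcal S$-morphisms; 2-cells are natural transformations whose naturality squares involving $\mathcal S$-morphisms are pullback squares. Restriction and range categories: a restriction structure on a category assigns to each $f:A\to B$ a morphism $\bar f:A\to A$ such that (R1) $f\cdot\bar f=f$; (R2) $\bar f\cdot\bar g=\bar g\cdot\bar f$ if $\mathrm{dom}f=\mathrm{dom}g$; (R3) $\overline{g\cdot\bar f}=\bar g\cdot\bar f$ if $\mathrm{dom}f=\mathrm{dom}g$; (R4) $\bar g\cdot f=f\cdot\overline{g\cdot f}$ if $\mathrm{cod}f=\mathrm{dom}g$. It is split if every $e$ with $\bar e=e$ splits ($e=m\cdot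 r$, $r\cdot m=1$ for some $m,r$). A range structure on a restriction category assigns to each $f:A\to B$ a morphism $\widehat f:B\to B$ such that (RR1) $\overline{\widehat f}=\widehat f$; (RR2) $\widehat f\cdot f=f$; (RR3) $\widehat{\bar g\cdot f}=\bar g\cdot\widehat f$ if $\mathrm{cod}f=\mathrm{dom}g$; (RR4) $\widehat{g\cdot\widehat f}=\widehat{g\cdot f}$ if $\mathrm{cod}f=\mathrm{dom}g$. A split range category is a split restriction category with a range structure. A morphism $f$ is total if $\bar f=1$; $i$ is a restricted isomorphism if there is a (necessarily unique) $i^-$ with $i^-\cdot i=\bar i$, $i\cdot i^-=\overline{i^-}$. $\mathfrak{SplitRangeCat}$ (very large) is the 2-category of split range categories, functors preserving restriction and range operators, and natural transformations with total components. The 2-functor $\mathsf{Total}$ sends $\mathcal X$ to $(\mathsf{Total}(\mathcal X),\mathsf{RaSur}(\mathcal X),\mathsf{ReIso}(\mathcal X))$, where $\mathsf{Total}(\mathcal X)$ is the subcategory of total morphisms (all objects), $\mathsf{RaSur}(\mathcal X)=\{f\mid\bar f=1,\ \widehat f=1\}$, and $\mathsf{ReIso}(\mathcal X)$ is the class of total restricted isomorphisms; on 1-cells it restricts functors to total morphisms, and it keeps 2-cells. The 2-functor $\mathsf{RaPar}$: for $(\mathcal C,\mathcal P,\mathcal S)$ in $\mathfrak{StableFact}$, an $\mathcal S$-span $(s,f):A\to B$ is a pair $s:D\to A$ in $\mathcal S$, $f:D\to B$ in $\mathcal C$; a morphism $x:(s,f)\to(\tilde s,\tilde f)$ is a $\mathcal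 C$-morphism with $\tilde s\cdot x=s$, $\tilde f\cdot x=f$; isomorphic spans are identified; they form the category $\mathsf{Span}(\mathcal C,\mathcal S)$ (with the objects of $\mathcal C$) under $(t,g)\cdot(s,f)=(s\cdot t',g\cdot f')$, where $f\cdot t'=t\cdot f'$ is a pullback square. An $\mathcal S$-cospan $\langle f,s\rangle:A\to B$ is a pair $f:A\to D$ in $\mathcal C$, $s:B\to D$ in $\mathcal S$; a morphism $v:\langle f,s\rangle\to\langle g,t\rangle$ is a $\mathcal C$-morphism with $v\cdot f=g$, $v\cdot s=t$; with pullback squares $f\cdot s'=s\cdot f'$ and $g\cdot t'=t\cdot g'$, its conjugate $v^\star$ is the unique morphism with $t'\cdot v^\star=s'$, $g'\cdot v^\star=f'$. $\mathcal S^\star$ is the class of all existing pullbacks in $\mathcal C$ of conjugates $v^\star$ of $\mathcal S$-cospan morphisms $v$ with $v\in\mathcal S$ (here $\mathcal S^\star\subseteq\mathcal S$). $\mathcal S^\circ$ is the least pullback-stable class $\mathcal U$ with $\mathcal S^\star\subseteq\mathcal U\subseteq\mathcal S$ such that for all $p,q\in\mathcal P$, $x\in\mathcal S$, $y\in\mathcal U$, $x\cdot q=p\cdot y$ implies $x\in\mathcal U$. $\sim_{\mathrm z^\circ}$ is the least equivalence relation on $\mathcal S$-spans with $(s,f)\sim_{\mathrm z^\circ}(\tilde s,\tilde f)$ whenever there is a morphism $x:(s,f)\to(\tilde s,\tilde f)$ with $x\in\mathcal S^\circ$ (a congruence). $\mathsf{RaPar}(\mathcal C,\mathcal S)$ (short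 for $\mathsf{RaPar}(\mathcal C,\mathcal P,\mathcal S)$) is the quotient of $\mathsf{Span}(\mathcal C,\mathcal S)$ by $\sim_{\mathrm z^\circ}$, with morphisms $[s,f]_{\mathrm z^\circ}$; it is a split range category with $\overline{[s,f]_{\mathrm z^\circ}}=[s,s]_{\mathrm z^\circ}$ and $\widehat{[s,f]_{\mathrm z^\circ}}=[s_f,s_f]_{\mathrm z^\circ}$, where $f=s_f\cdot p_f$ is a $(\mathcal P,\mathcal S)$-factorization. On 1-cells, $\mathsf{RaPar}(F)[s,f]_{\mathrm z^\circ}=[Fs,Ff]_{\mathrm z^\circ}$; a 2-cell $\alpha:F\Rightarrow G$ is sent to the natural transformation with components $[1_{FA},\alpha_A]_{\mathrm z^\circ}$. *)

theory Defs
  imports Main "HOL-Library.FuncSet"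
begin

section \<open>Categories, functors, natural transformations\<close>

text \<open>
  All structure maps are required to be extensional (equal to \<^term>\<open>undefined\<close> off their carriers),
  so that equality in HOL of categories, functors and natural transformations is the intended
  equality and the strict 2-categorical equations below can be stated as equations.
\<close>

record ('o, 'm) cat =
  Ob :: "'o set"
  Arr :: "'m set"
  Dom :: "'m \<Rightarrow> 'o"
  Cod :: "'m \<Rightarrow> 'o"
  Idn :: "'o \<Rightarrow> 'm"
  Comp :: "'m \<Rightarrow> 'm \<Rightarrow> 'm"  (infixr "\<cdot>\<index>" 70)

definition hom :: "('o, 'm, 'z) cat_scheme \<Rightarrow> 'o \<Rightarrow> 'o \<Rightarrow> 'm set" where
  "hom C a b = {f \<in> Arr C. Dom C f = a \<and> Cod C f = b}"

definition seq :: "('o, 'm, 'z) cat_scheme \<Rightarrow> 'm \<Rightarrow> 'm \<Rightarrow> bool" where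
  "seq C g f \<longleftrightarrow> g \<in> Arr C \<and> f \<in> Arr C \<and> Dom C g = Cod C f"

locale category =
  fixes C :: "('o, 'm, 'z) cat_scheme" (structure)
  assumes Dom_type: "Dom C \<in> Arr C \<rightarrow>\<^sub>E Ob C"
    and Cod_type: "Cod C \<in> Arr C \<rightarrow>\<^sub>E Ob C"
    and Idn_ext: "Idn C \<in> extensional (Ob C)"
    and Idn_hom: "a \<in> Ob C \<Longrightarrow> Idn C a \<in> hom C a a"
    and Comp_ext: "\<not> seq C g f \<Longrightarrow> g \<cdot> f = undefined"
    and Comp_hom: "seq C g f \<Longrightarrow> g \<cdot> f \<in> hom C (Dom C f) (Cod C g)"
    and Comp_Idn_right: "f \<in> Arr C \<Longrightarrow> f \<cdot> Idn C (Dom C f) = f"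
    and Comp_Idn_left: "f \<in> Arr C \<Longrightarrow> Idn C (Cod C f) \<cdot> f = f"
    and Comp_assoc: "seq C h g \<Longrightarrow> seq C g f \<Longrightarrow> (h \<cdot> g) \<cdot> f = h \<cdot> (g \<cdot> f)"

record ('o, 'm, 'p, 'n) func =
  FO :: "'o \<Rightarrow> 'p"
  FM :: "'m \<Rightarrow> 'n"

definition is_func ::
  "('o, 'm, 'z) cat_scheme \<Rightarrow> ('p, 'n, 'w) cat_scheme \<Rightarrow> ('o, 'm, 'p, 'n) func \<Rightarrow> bool" where
  "is_func C D F \<longleftrightarrow>
     FO F \<in> Ob C \<rightarrow>\<^sub>E Ob D \<and> FM F \<in> Arr C \<rightarrow>\<^sub>E Arr D \<and>
     (\<forall>f\<in>Arr C. Dom D (FM F f) = FO F (Dom C f) \<and> Cod D (FM F f) = FO F (Cod C f)) \<and>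
     (\<forall>a\<in>Ob C. FM F (Idn C a) = Idn D (FO F a)) \<and>
     (\<forall>g f. seq C g f \<longrightarrow> FM F (g \<cdot>\<^bsub>C\<^esub> f) = FM F g \<cdot>\<^bsub>D\<^esub> FM F f)"

definition func_id :: "('o, 'm, 'z) cat_scheme \<Rightarrow> ('o, 'm, 'o, 'm) func" where
  "func_id C = \<lparr>FO = (\<lambda>a\<in>Ob C. a), FM = (\<lambda>f\<in>Arr C. f)\<rparr>"

definition func_comp ::
  "('o, 'm, 'z) cat_scheme \<Rightarrow> ('p, 'n, 'q, 'l) func \<Rightarrow> ('o, 'm, 'p, 'n) func \<Rightarrow> ('o, 'm, 'q, 'l) func"
  where
  "func_comp C G F = \<lparr>FO = compose (Ob C) (FO G) (FO F), FM = compose (Arr C) (FM G) (FM F)\<rparr>"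

record ('o, 'm, 'p, 'n) ntrans =
  Src :: "('o, 'm, 'p, 'n) func"
  Tgt :: "('o, 'm, 'p, 'n) func"
  Cmp :: "'o \<Rightarrow> 'n"

definition is_ntrans ::
  "('o, 'm, 'z) cat_scheme \<Rightarrow> ('p, 'n, 'w) cat_scheme \<Rightarrow> ('o, 'm, 'p, 'n) ntrans \<Rightarrow> bool" where
  "is_ntrans C D \<alpha> \<longleftrightarrow>
     is_func C D (Src \<alpha>) \<and> is_func C D (Tgt \<alpha>) \<and> Cmp \<alpha> \<in> extensional (Ob C) \<and>
     (\<forall>a\<in>Ob C. Cmp \<alpha> a \<in> hom D (FO (Src \<alpha>) a) (FO (Tgt \<alpha>) a)) \<and>
     (\<forall>f\<in>Arr C. FM (Tgt \<alpha>) f \<cdot>\<^bsub>D\<^esub> Cmp \<alpha> (Dom C f) = Cmp \<alpha> (Cod C f) \<cdot>\<^bsub>D\<^esub> FM (Src \<alpha>) f)"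

text \<open>
  The category with a given set of functors from \<open>C\<close> to \<open>D\<close> as objects and a given set of natural
  transformations as morphisms, under vertical composition.
\<close>

definition ntrans_cat ::
  "('o, 'm, 'z) cat_scheme \<Rightarrow> ('p, 'n, 'w) cat_scheme \<Rightarrow>
   ('o, 'm, 'p, 'n) func set \<Rightarrow> ('o, 'm, 'p, 'n) ntrans set \<Rightarrow>
   (('o, 'm, 'p, 'n) func, ('o, 'm, 'p, 'n) ntrans) cat" where
  "ntrans_cat C D FF NN =
    \<lparr>Ob = FF, Arr = NN,
     Dom = (\<lambda>\<alpha>\<in>NN. Src \<alpha>), Cod = (\<lambda>\<alpha>\<in>NN. Tgt \<alpha>),
     Idn = (\<lambda>F\<in>FF. \<lparr>Src = F, Tgt = F, Cmp = (\<lambda>a\<in>Ob C. Idn D (FO F a))\<rparr>),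
     Comp = (\<lambda>\<beta> \<alpha>. if \<beta> \<in> NN \<and> \<alpha> \<in> NN \<and> Src \<beta> = Tgt \<alpha>
       then \<lparr>Src = Src \<alpha>, Tgt = Tgt \<beta>, Cmp = (\<lambda>a\<in>Ob C. Cmp \<beta> a \<cdot>\<^bsub>D\<^esub> Cmp \<alpha> a)\<rparr>
       else undefined)\<rparr>"

text \<open>Horizontal composition of \<open>\<alpha> : F \<Rightarrow> G : A \<rightarrow> B\<close> and \<open>\<beta> : H \<Rightarrow> K : B \<rightarrow> C\<close>.\<close>

definition ntrans_hcomp ::
  "('o, 'm, 'z) cat_scheme \<Rightarrow> ('q, 'l, 'w) cat_scheme \<Rightarrow>
   ('p, 'n, 'q, 'l) ntrans \<Rightarrow> ('o, 'm, 'p, 'n) ntrans \<Rightarrow> ('o, 'm, 'q, 'l) ntrans" where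
  "ntrans_hcomp A C \<beta> \<alpha> =
    \<lparr>Src = func_comp A (Src \<beta>) (Src \<alpha>), Tgt = func_comp A (Tgt \<beta>) (Tgt \<alpha>),
     Cmp = (\<lambda>a\<in>Ob A. Cmp \<beta> (FO (Tgt \<alpha>) a) \<cdot>\<^bsub>C\<^esub> FM (Src \<beta>) (Cmp \<alpha> a))\<rparr>"


section \<open>Strict 2-categories, 2-functors, 2-adjunctions\<close>

text \<open>
  A strict 2-category as a category enriched in categories: \<open>Hom2 T A B\<close> is the category of 1-cells
  and 2-cells from \<open>A\<close> to \<open>B\<close>, \<open>Comp1\<close> and \<open>Comp2\<close> are the object and morphism parts of the
  composition functors.
\<close>

record ('a, 'f, 't) twocat =
  Ob2 :: "'a set"
  Hom2 :: "'a \<Rightarrow> 'a \<Rightarrow> ('f, 't) cat"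
  Id1 :: "'a \<Rightarrow> 'f"
  Comp1 :: "'a \<Rightarrow> 'a \<Rightarrow> 'a \<Rightarrow> 'f \<Rightarrow> 'f \<Rightarrow> 'f"
  Comp2 :: "'a \<Rightarrow> 'a \<Rightarrow> 'a \<Rightarrow> 't \<Rightarrow> 't \<Rightarrow> 't"

abbreviation Cell1 :: "('a, 'f, 't) twocat \<Rightarrow> 'a \<Rightarrow> 'a \<Rightarrow> 'f set" where
  "Cell1 T A B \<equiv> Ob (Hom2 T A B)"

abbreviation Cell2 :: "('a, 'f, 't) twocat \<Rightarrow> 'a \<Rightarrow> 'a \<Rightarrow> 't set" where
  "Cell2 T A B \<equiv> Arr (Hom2 T A B)"

abbreviation Id2 :: "('a, 'f, 't) twocat \<Rightarrow> 'a \<Rightarrow> 'a \<Rightarrow> 'f \<Rightarrow> 't" where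
  "Id2 T A B f \<equiv> Idn (Hom2 T A B) f"

locale two_category =
  fixes T :: "('a, 'f, 't) twocat"
  assumes Hom2_category: "\<lbrakk>A \<in> Ob2 T; B \<in> Ob2 T\<rbrakk> \<Longrightarrow> category (Hom2 T A B)"
    and Id1_cell: "A \<in> Ob2 T \<Longrightarrow> Id1 T A \<in> Cell1 T A A"
    and Comp1_cell:
      "\<lbrakk>A \<in> Ob2 T; B \<in> Ob2 T; C \<in> Ob2 T; g \<in> Cell1 T B C; f \<in> Cell1 T A B\<rbrakk>
       \<Longrightarrow> Comp1 T A B C g f \<in> Cell1 T A C"
    and Comp2_cell:
      "\<lbrakk>A \<in> Ob2 T; B \<in> Ob2 T; C \<in> Ob2 T; \<beta> \<in> Cell2 T B C; \<alpha> \<in> Cell2 T A B\<rbrakk>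
       \<Longrightarrow> Comp2 T A B C \<beta> \<alpha> \<in> hom (Hom2 T A C)
             (Comp1 T A B C (Dom (Hom2 T B C) \<beta>) (Dom (Hom2 T A B) \<alpha>))
             (Comp1 T A B C (Cod (Hom2 T B C) \<beta>) (Cod (Hom2 T A B) \<alpha>))"
    and Comp2_Id2:
      "\<lbrakk>A \<in> Ob2 T; B \<in> Ob2 T; C \<in> Ob2 T; g \<in> Cell1 T B C; f \<in> Cell1 T A B\<rbrakk>
       \<Longrightarrow> Comp2 T A B C (Id2 T B C g) (Id2 T A B f) = Id2 T A C (Comp1 T A B C g f)"
    and interchange:
      "\<lbrakk>A \<in> Ob2 T; B \<in> Ob2 T; C \<in> Ob2 T; seq (Hom2 T B C) \<beta>' \<beta>; seq (Hom2 T A B) \<alpha>' \<alpha>\<rbrakk>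
       \<Longrightarrow> Comp2 T A B C (\<beta>' \<cdot>\<^bsub>Hom2 T B C\<^esub> \<beta>) (\<alpha>' \<cdot>\<^bsub>Hom2 T A B\<^esub> \<alpha>)
           = Comp2 T A B C \<beta>' \<alpha>' \<cdot>\<^bsub>Hom2 T A C\<^esub> Comp2 T A B C \<beta> \<alpha>"
    and Comp1_unit_right:
      "\<lbrakk>A \<in> Ob2 T; B \<in> Ob2 T; f \<in> Cell1 T A B\<rbrakk> \<Longrightarrow> Comp1 T A A B f (Id1 T A) = f"
    and Comp1_unit_left:
      "\<lbrakk>A \<in> Ob2 T; B \<in> Ob2 T; f \<in> Cell1 T A B\<rbrakk> \<Longrightarrow> Comp1 T A B B (Id1 T B) f = f"
    and Comp2_unit_right:
      "\<lbrakk>A \<in> Ob2 T; B \<in> Ob2 T; \<alpha> \<in> Cell2 T A B\<rbrakk>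
       \<Longrightarrow> Comp2 T A A B \<alpha> (Id2 T A A (Id1 T A)) = \<alpha>"
    and Comp2_unit_left:
      "\<lbrakk>A \<in> Ob2 T; B \<in> Ob2 T; \<alpha> \<in> Cell2 T A B\<rbrakk>
       \<Longrightarrow> Comp2 T A B B (Id2 T B B (Id1 T B)) \<alpha> = \<alpha>"
    and Comp1_assoc:
      "\<lbrakk>A \<in> Ob2 T; B \<in> Ob2 T; C \<in> Ob2 T; D \<in> Ob2 T;
        h \<in> Cell1 T C D; g \<in> Cell1 T B C; f \<in> Cell1 T A B\<rbrakk>
       \<Longrightarrow> Comp1 T A B D (Comp1 T B C D h g) f = Comp1 T A C D h (Comp1 T A B C g f)"
    and Comp2_assoc:
      "\<lbrakk>A \<in> Ob2 T; B \<in> Ob2 T; C \<in> Ob2 T; D \<in> Ob2 T;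
        \<gamma> \<in> Cell2 T C D; \<beta> \<in> Cell2 T B C; \<alpha> \<in> Cell2 T A B\<rbrakk>
       \<Longrightarrow> Comp2 T A B D (Comp2 T B C D \<gamma> \<beta>) \<alpha> = Comp2 T A C D \<gamma> (Comp2 T A B C \<beta> \<alpha>)"

record ('a, 'f, 't, 'b, 'g, 'u) twofunc =
  F0 :: "'a \<Rightarrow> 'b"
  FH :: "'a \<Rightarrow> 'a \<Rightarrow> ('f, 't, 'g, 'u) func"

abbreviation F1 :: "('a, 'f, 't, 'b, 'g, 'u) twofunc \<Rightarrow> 'a \<Rightarrow> 'a \<Rightarrow> 'f \<Rightarrow> 'g" where
  "F1 F A B \<equiv> FO (FH F A B)"

abbreviation F2 :: "('a, 'f, 't, 'b, 'g, 'u) twofunc \<Rightarrow> 'a \<Rightarrow> 'a \<Rightarrow> 't \<Rightarrow> 'u" where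
  "F2 F A B \<equiv> FM (FH F A B)"

locale two_functor =
  S: two_category S + T: two_category T
  for S :: "('a, 'f, 't) twocat" and T :: "('b, 'g, 'u) twocat" +
  fixes F :: "('a, 'f, 't, 'b, 'g, 'u) twofunc"
  assumes F0_type: "A \<in> Ob2 S \<Longrightarrow> F0 F A \<in> Ob2 T"
    and FH_func:
      "\<lbrakk>A \<in> Ob2 S; B \<in> Ob2 S\<rbrakk> \<Longrightarrow> is_func (Hom2 S A B) (Hom2 T (F0 F A) (F0 F B)) (FH F A B)"
    and F1_Id1: "A \<in> Ob2 S \<Longrightarrow> F1 F A A (Id1 S A) = Id1 T (F0 F A)"
    and F1_Comp1:
      "\<lbrakk>A \<in> Ob2 S; B \<in> Ob2 S; C \<in> Ob2 S; g \<in> Cell1 S B C; f \<in> Cell1 S A B\<rbrakk>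
       \<Longrightarrow> F1 F A C (Comp1 S A B C g f)
           = Comp1 T (F0 F A) (F0 F B) (F0 F C) (F1 F B C g) (F1 F A B f)"
    and F2_Comp2:
      "\<lbrakk>A \<in> Ob2 S; B \<in> Ob2 S; C \<in> Ob2 S; \<beta> \<in> Cell2 S B C; \<alpha> \<in> Cell2 S A B\<rbrakk>
       \<Longrightarrow> F2 F A C (Comp2 S A B C \<beta> \<alpha>)
           = Comp2 T (F0 F A) (F0 F B) (F0 F C) (F2 F B C \<beta>) (F2 F A B \<alpha>)"

definition twofunc_id :: "('a, 'f, 't) twocat \<Rightarrow> ('a, 'f, 't, 'a, 'f, 't) twofunc" where
  "twofunc_id T = \<lparr>F0 = (\<lambda>A. A), FH = (\<lambda>A B. func_id (Hom2 T A B))\<rparr>"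

definition twofunc_comp ::
  "('a, 'f, 't) twocat \<Rightarrow> ('b, 'g, 'u, 'c, 'h, 'v) twofunc \<Rightarrow> ('a, 'f, 't, 'b, 'g, 'u) twofunc \<Rightarrow>
   ('a, 'f, 't, 'c, 'h, 'v) twofunc" where
  "twofunc_comp T G F =
    \<lparr>F0 = (\<lambda>A. F0 G (F0 F A)),
     FH = (\<lambda>A B. func_comp (Hom2 T A B) (FH G (F0 F A) (F0 F B)) (FH F A B))\<rparr>"

text \<open>Strict (2-)natural transformations, natural with respect to 1-cells and 2-cells.\<close>

definition two_natural ::
  "('a, 'f, 't) twocat \<Rightarrow> ('b, 'g, 'u) twocat \<Rightarrow>
   ('a, 'f, 't, 'b, 'g, 'u) twofunc \<Rightarrow> ('a, 'f, 't, 'b, 'g, 'u) twofunc \<Rightarrow> ('a \<Rightarrow> 'g) \<Rightarrow> bool" where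
  "two_natural S T F G \<theta> \<longleftrightarrow>
     (\<forall>A\<in>Ob2 S. \<theta> A \<in> Cell1 T (F0 F A) (F0 G A)) \<and>
     (\<forall>A\<in>Ob2 S. \<forall>B\<in>Ob2 S. \<forall>f\<in>Cell1 S A B.
        Comp1 T (F0 F A) (F0 F B) (F0 G B) (\<theta> B) (F1 F A B f)
        = Comp1 T (F0 F A) (F0 G A) (F0 G B) (F1 G A B f) (\<theta> A)) \<and>
     (\<forall>A\<in>Ob2 S. \<forall>B\<in>Ob2 S. \<forall>\<alpha>\<in>Cell2 S A B.
        Comp2 T (F0 F A) (F0 F B) (F0 G B) (Id2 T (F0 F B) (F0 G B) (\<theta> B)) (F2 F A B \<alpha>)
        = Comp2 T (F0 F A) (F0 G A) (F0 G B) (F2 G A B \<alpha>) (Id2 T (F0 F A) (F0 G A) (\<theta> A)))"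

text \<open>\<open>L : S \<rightarrow> T\<close> is left 2-adjoint to \<open>R : T \<rightarrow> S\<close>, by 2-natural unit and counit.\<close>

definition left_2adjoint ::
  "('a, 'f, 't) twocat \<Rightarrow> ('b, 'g, 'u) twocat \<Rightarrow>
   ('a, 'f, 't, 'b, 'g, 'u) twofunc \<Rightarrow> ('b, 'g, 'u, 'a, 'f, 't) twofunc \<Rightarrow> bool" where
  "left_2adjoint S T L R \<longleftrightarrow>
     two_functor S T L \<and> two_functor T S R \<and>
     (\<exists>\<eta> \<epsilon>.
        two_natural S S (twofunc_id S) (twofunc_comp S R L) \<eta> \<and>
        two_natural T T (twofunc_comp T L R) (twofunc_id T) \<epsilon> \<and>
        (\<forall>A\<in>Ob2 S. Comp1 T (F0 L A) (F0 L (F0 R (F0 L A))) (F0 L A)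
             (\<epsilon> (F0 L A)) (F1 L A (F0 R (F0 L A)) (\<eta> A)) = Id1 T (F0 L A)) \<and>
        (\<forall>X\<in>Ob2 T. Comp1 S (F0 R X) (F0 R (F0 L (F0 R X))) (F0 R X)
             (F1 R (F0 L (F0 R X)) X (\<epsilon> X)) (\<eta> (F0 R X)) = Id1 S (F0 R X)))"


section \<open>Stable factorization systems\<close>

definition iso :: "('o, 'm, 'z) cat_scheme \<Rightarrow> 'm \<Rightarrow> bool" where
  "iso C f \<longleftrightarrow> f \<in> Arr C \<and>
     (\<exists>g \<in> hom C (Cod C f) (Dom C f).
        g \<cdot>\<^bsub>C\<^esub> f = Idn C (Dom C f) \<and> f \<cdot>\<^bsub>C\<^esub> g = Idn C (Cod C f))"

definition commutes :: "('o, 'm, 'z) cat_scheme \<Rightarrow> 'm \<Rightarrow> 'm \<Rightarrow> 'm \<Rightarrow> 'm \<Rightarrow> bool" where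
  "commutes C f p g q \<longleftrightarrow> seq C f p \<and> seq C g q \<and> f \<cdot>\<^bsub>C\<^esub> p = g \<cdot>\<^bsub>C\<^esub> q"

text \<open>\<open>pullback C f p g q\<close>: the square \<open>f \<cdot> p = g \<cdot> q\<close> is a pullback of \<open>f\<close> and \<open>g\<close>.\<close>

definition pullback :: "('o, 'm, 'z) cat_scheme \<Rightarrow> 'm \<Rightarrow> 'm \<Rightarrow> 'm \<Rightarrow> 'm \<Rightarrow> bool" where
  "pullback C f p g q \<longleftrightarrow> commutes C f p g q \<and>
     (\<forall>x y. commutes C f x g y \<longrightarrow>
        (\<exists>!u. u \<in> hom C (Dom C x) (Dom C p) \<and> p \<cdot>\<^bsub>C\<^esub> u = x \<and> q \<cdot>\<^bsub>C\<^esub> u = y))"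

locale orthogonal_factorization_system = category C
  for C :: "('o, 'm, 'z) cat_scheme" (structure) +
  fixes P S :: "'m set"
  assumes P_Arr: "P \<subseteq> Arr C" and S_Arr: "S \<subseteq> Arr C"
    and P_iso: "iso C f \<Longrightarrow> f \<in> P" and S_iso: "iso C f \<Longrightarrow> f \<in> S"
    and P_Comp: "\<lbrakk>g \<in> P; f \<in> P; seq C g f\<rbrakk> \<Longrightarrow> g \<cdot> f \<in> P"
    and S_Comp: "\<lbrakk>g \<in> S; f \<in> S; seq C g f\<rbrakk> \<Longrightarrow> g \<cdot> f \<in> S"
    and factorization: "f \<in> Arr C \<Longrightarrow> \<exists>s\<in>S. \<exists>p\<in>P. seq C s p \<and> f = s \<cdot> p"
    and orthogonality: "\<lbrakk>p \<in> P; s \<in> S; commutes C s f g p\<rbrakk>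
      \<Longrightarrow> \<exists>!d. d \<in> hom C (Cod C p) (Dom C s) \<and> d \<cdot> p = f \<and> s \<cdot> d = g"

record ('o, 'm) factcat = "('o, 'm) cat" +
  PCls :: "'m set"
  SCls :: "'m set"

locale stable_fact = orthogonal_factorization_system C "PCls C" "SCls C"
  for C :: "('o, 'm) factcat" (structure) +
  assumes S_pullbacks: "\<lbrakk>s \<in> SCls C; f \<in> Arr C; Cod C f = Cod C s\<rbrakk>
      \<Longrightarrow> \<exists>s' f'. pullback C f s' s f'"
    and P_stable: "\<lbrakk>s \<in> SCls C; p \<in> PCls C; pullback C p s' s p'\<rbrakk> \<Longrightarrow> p' \<in> PCls C"

definition SF_func ::
  "('o, 'm) factcat \<Rightarrow> ('p, 'n) factcat \<Rightarrow> ('o, 'm, 'p, 'n) func \<Rightarrow> bool" where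
  "SF_func C D F \<longleftrightarrow> is_func C D F \<and> FM F ` PCls C \<subseteq> PCls D \<and> FM F ` SCls C \<subseteq> SCls D \<and>
     (\<forall>s\<in>SCls C. \<forall>f s' f'. pullback C f s' s f' \<longrightarrow>
        pullback D (FM F f) (FM F s') (FM F s) (FM F f'))"

definition SF_ntrans ::
  "('o, 'm) factcat \<Rightarrow> ('p, 'n) factcat \<Rightarrow> ('o, 'm, 'p, 'n) ntrans \<Rightarrow> bool" where
  "SF_ntrans C D \<alpha> \<longleftrightarrow> is_ntrans C D \<alpha> \<and> SF_func C D (Src \<alpha>) \<and> SF_func C D (Tgt \<alpha>) \<and>
     (\<forall>s\<in>SCls C. pullback D (FM (Tgt \<alpha>) s) (Cmp \<alpha> (Dom C s)) (Cmp \<alpha> (Cod C s)) (FM (Src \<alpha>) s))"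

definition StableFact ::
  "(('o, 'm) factcat, ('o, 'm, 'o, 'm) func, ('o, 'm, 'o, 'm) ntrans) twocat" where
  "StableFact =
    \<lparr>Ob2 = {C. stable_fact C},
     Hom2 = (\<lambda>C D. ntrans_cat C D {F. SF_func C D F} {\<alpha>. SF_ntrans C D \<alpha>}),
     Id1 = func_id,
     Comp1 = (\<lambda>A B C. func_comp A),
     Comp2 = (\<lambda>A B C. ntrans_hcomp A C)\<rparr>"


section \<open>Split range categories\<close>

record ('o, 'm) rangecat = "('o, 'm) cat" +
  Rst :: "'m \<Rightarrow> 'm"
  Rng :: "'m \<Rightarrow> 'm"

locale restriction_category = category X
  for X :: "('o, 'm) rangecat" (structure) +
  assumes Rst_ext: "Rst X \<in> extensional (Arr X)"
    and Rst_hom: "f \<in> Arr X \<Longrightarrow> Rst X f \<in> hom X (Dom X f) (Dom X f)"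
    and R1: "f \<in> Arr X \<Longrightarrow> f \<cdot> Rst X f = f"
    and R2: "\<lbrakk>f \<in> Arr X; g \<in> Arr X; Dom X f = Dom X g\<rbrakk>
      \<Longrightarrow> Rst X f \<cdot> Rst X g = Rst X g \<cdot> Rst X f"
    and R3: "\<lbrakk>f \<in> Arr X; g \<in> Arr X; Dom X f = Dom X g\<rbrakk>
      \<Longrightarrow> Rst X (g \<cdot> Rst X f) = Rst X g \<cdot> Rst X f"
    and R4: "seq X g f \<Longrightarrow> Rst X g \<cdot> f = f \<cdot> Rst X (g \<cdot> f)"

locale split_range_category = restriction_category X
  for X :: "('o, 'm) rangecat" (structure) +
  assumes split: "\<lbrakk>e \<in> Arr X; Rst X e = e\<rbrakk>
      \<Longrightarrow> \<exists>m r. seq X m r \<and> e = m \<cdot> r \<and> seq X r m \<and> r \<cdot> m = Idn X (Dom X m)"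
    and Rng_ext: "Rng X \<in> extensional (Arr X)"
    and Rng_hom: "f \<in> Arr X \<Longrightarrow> Rng X f \<in> hom X (Cod X f) (Cod X f)"
    and RR1: "f \<in> Arr X \<Longrightarrow> Rst X (Rng X f) = Rng X f"
    and RR2: "f \<in> Arr X \<Longrightarrow> Rng X f \<cdot> f = f"
    and RR3: "seq X g f \<Longrightarrow> Rng X (Rst X g \<cdot> f) = Rst X g \<cdot> Rng X f"
    and RR4: "seq X g f \<Longrightarrow> Rng X (g \<cdot> Rng X f) = Rng X (g \<cdot> f)"

definition total :: "('o, 'm) rangecat \<Rightarrow> 'm \<Rightarrow> bool" where
  "total X f \<longleftrightarrow> f \<in> Arr X \<and> Rst X f = Idn X (Dom X f)"

definition restricted_iso :: "('o, 'm) rangecat \<Rightarrow> 'm \<Rightarrow> bool" where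
  "restricted_iso X i \<longleftrightarrow> i \<in> Arr X \<and>
     (\<exists>j \<in> hom X (Cod X i) (Dom X i). j \<cdot>\<^bsub>X\<^esub> i = Rst X i \<and> i \<cdot>\<^bsub>X\<^esub> j = Rst X j)"

definition SR_func ::
  "('o, 'm) rangecat \<Rightarrow> ('p, 'n) rangecat \<Rightarrow> ('o, 'm, 'p, 'n) func \<Rightarrow> bool" where
  "SR_func X Y F \<longleftrightarrow> is_func X Y F \<and>
     (\<forall>f\<in>Arr X. FM F (Rst X f) = Rst Y (FM F f) \<and> FM F (Rng X f) = Rng Y (FM F f))"

definition SR_ntrans ::
  "('o, 'm) rangecat \<Rightarrow> ('p, 'n) rangecat \<Rightarrow> ('o, 'm, 'p, 'n) ntrans \<Rightarrow> bool" where
  "SR_ntrans X Y \<alpha> \<longleftrightarrow> is_ntrans X Y \<alpha> \<and> SR_func X Y (Src \<alpha>) \<and> SR_func X Y (Tgt \<alpha>) \<and>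
     (\<forall>a\<in>Ob X. total Y (Cmp \<alpha> a))"

definition SplitRangeCat ::
  "(('o, 'm) rangecat, ('o, 'm, 'o, 'm) func, ('o, 'm, 'o, 'm) ntrans) twocat" where
  "SplitRangeCat =
    \<lparr>Ob2 = {X. split_range_category X},
     Hom2 = (\<lambda>X Y. ntrans_cat X Y {F. SR_func X Y F} {\<alpha>. SR_ntrans X Y \<alpha>}),
     Id1 = func_id,
     Comp1 = (\<lambda>X Y Z. func_comp X),
     Comp2 = (\<lambda>X Y Z. ntrans_hcomp X Z)\<rparr>"


section \<open>The 2-functor Total\<close>

definition Tot :: "('o, 'm) rangecat \<Rightarrow> ('o, 'm) factcat" where
  "Tot X =
    \<lparr>Ob = Ob X, Arr = {f. total X f},
     Dom = restrict (Dom X) {f. total X f}, Cod = restrict (Cod X) {f. total X f},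
     Idn = Idn X,
     Comp = (\<lambda>g f. if total X g \<and> total X f then g \<cdot>\<^bsub>X\<^esub> f else undefined),
     PCls = {f. total X f \<and> Rng X f = Idn X (Cod X f)},
     SCls = {f. total X f \<and> restricted_iso X f}\<rparr>"

definition Tot_func ::
  "('o, 'm) rangecat \<Rightarrow> ('o, 'm, 'p, 'n) func \<Rightarrow> ('o, 'm, 'p, 'n) func" where
  "Tot_func X F = \<lparr>FO = FO F, FM = restrict (FM F) {f. total X f}\<rparr>"

definition Tot_ntrans ::
  "('o, 'm) rangecat \<Rightarrow> ('o, 'm, 'p, 'n) ntrans \<Rightarrow> ('o, 'm, 'p, 'n) ntrans" where
  "Tot_ntrans X \<alpha> = \<lparr>Src = Tot_func X (Src \<alpha>), Tgt = Tot_func X (Tgt \<alpha>), Cmp = Cmp \<alpha>\<rparr>"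

definition Total ::
  "(('o, 'm) rangecat, ('o, 'm, 'o, 'm) func, ('o, 'm, 'o, 'm) ntrans,
    ('o, 'm) factcat, ('o, 'm, 'o, 'm) func, ('o, 'm, 'o, 'm) ntrans) twofunc" where
  "Total =
    \<lparr>F0 = Tot,
     FH = (\<lambda>X Y. \<lparr>FO = restrict (Tot_func X) (Cell1 SplitRangeCat X Y),
                  FM = restrict (Tot_ntrans X) (Cell2 SplitRangeCat X Y)\<rparr>)\<rparr>"


section \<open>The 2-functor RaPar\<close>

definition spans :: "('o, 'm) factcat \<Rightarrow> ('m \<times> 'm) set" where
  "spans C = {(s, f). s \<in> SCls C \<and> f \<in> Arr C \<and> Dom C s = Dom C f}"

definition span_mor :: "('o, 'm) factcat \<Rightarrow> 'm \<times> 'm \<Rightarrow> 'm \<times> 'm \<Rightarrow> 'm \<Rightarrow> bool" where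
  "span_mor C = (\<lambda>(s, f) (s', f') x.
     (s, f) \<in> spans C \<and> (s', f') \<in> spans C \<and> x \<in> hom C (Dom C s) (Dom C s') \<and>
     s' \<cdot>\<^bsub>C\<^esub> x = s \<and> f' \<cdot>\<^bsub>C\<^esub> x = f)"

definition cospans :: "('o, 'm) factcat \<Rightarrow> ('m \<times> 'm) set" where
  "cospans C = {(f, s). f \<in> Arr C \<and> s \<in> SCls C \<and> Cod C f = Cod C s}"

definition cospan_mor :: "('o, 'm) factcat \<Rightarrow> 'm \<times> 'm \<Rightarrow> 'm \<times> 'm \<Rightarrow> 'm \<Rightarrow> bool" where
  "cospan_mor C = (\<lambda>(f, s) (g, t) v.
     (f, s) \<in> cospans C \<and> (g, t) \<in> cospans C \<and> v \<in> hom C (Cod C s) (Cod C t) \<and>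
     v \<cdot>\<^bsub>C\<^esub> f = g \<and> v \<cdot>\<^bsub>C\<^esub> s = t)"

text \<open>
  \<open>conjugate C (f, s) (g, t) v w\<close>: \<open>w\<close> is the conjugate of the cospan morphism \<open>v\<close> with respect to
  some choice of the two pullbacks.
\<close>

definition conjugate :: "('o, 'm) factcat \<Rightarrow> 'm \<times> 'm \<Rightarrow> 'm \<times> 'm \<Rightarrow> 'm \<Rightarrow> 'm \<Rightarrow> bool" where
  "conjugate C = (\<lambda>(f, s) (g, t) v w. cospan_mor C (f, s) (g, t) v \<and>
     (\<exists>s' f' t' g'. pullback C f s' s f' \<and> pullback C g t' t g' \<and>
        w \<in> hom C (Dom C s') (Dom C t') \<and> t' \<cdot>\<^bsub>C\<^esub> w = s' \<and> g' \<cdot>\<^bsub>C\<^esub> w = f'))"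

definition S_star :: "('o, 'm) factcat \<Rightarrow> 'm set" where
  "S_star C = {x. \<exists>c d v w h k. v \<in> SCls C \<and> conjugate C c d v w \<and> pullback C h x w k}"

definition pullback_stable :: "('o, 'm, 'z) cat_scheme \<Rightarrow> 'm set \<Rightarrow> bool" where
  "pullback_stable C U \<longleftrightarrow> (\<forall>u\<in>U. \<forall>f u' f'. pullback C f u' u f' \<longrightarrow> u' \<in> U)"

text \<open>
  The defining conditions are preserved by intersections and satisfied by \<^term>\<open>SCls C\<close>, so the
  intersection is the least such class.
\<close>

definition S_circ :: "('o, 'm) factcat \<Rightarrow> 'm set" where
  "S_circ C = \<Inter>{U. S_star C \<subseteq> U \<and> U \<subseteq> SCls C \<and> pullback_stable C U \<and>
     (\<forall>p\<in>PCls C. \<forall>q\<in>PCls C. \<forall>x\<in>SCls C. \<forall>y\<in>U. commutes C x q p y \<longrightarrow> x \<in> U)}"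

text \<open>
  Isomorphic spans are identified from the outset, so span isomorphisms are among the generators.
\<close>

definition zgen :: "('o, 'm) factcat \<Rightarrow> (('m \<times> 'm) \<times> ('m \<times> 'm)) set" where
  "zgen C = {(a, b). \<exists>x. span_mor C a b x \<and> (iso C x \<or> x \<in> S_circ C)}"

definition zrel :: "('o, 'm) factcat \<Rightarrow> (('m \<times> 'm) \<times> ('m \<times> 'm)) set" where
  "zrel C = \<Inter>{E. equiv (spans C) E \<and> zgen C \<subseteq> E}"

text \<open>
  The morphisms of \<open>RaPar\<close> are equivalence classes of pairs of morphisms. For \<open>RaPar\<close> to land among
  the categories whose morphisms come from the same universe \<open>'m\<close>, this universe has to contain a
  copy of every quotient of a set of pairs of its elements. This is what a quotient coding
  provides: it represents sets of pairs by elements of \<open>'m\<close> such that disjoint nonempty sets,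
  in particular distinct classes of an equivalence relation, are represented by distinct elements.
  (An injective coding of all sets of pairs cannot exist.) Every infinite type has a quotient coding.
\<close>

definition quotient_coding :: "(('m \<times> 'm) set \<Rightarrow> 'm) \<Rightarrow> bool" where
  "quotient_coding code \<longleftrightarrow>
     (\<forall>K L. K \<noteq> {} \<longrightarrow> L \<noteq> {} \<longrightarrow> K \<inter> L = {} \<longrightarrow> code K \<noteq> code L)"

lemma quotient_coding_exists:
  assumes "infinite (UNIV :: 'm set)"
  shows "\<exists>code :: ('m \<times> 'm) set \<Rightarrow> 'm. quotient_coding code"
proof -
  obtain e :: "'m \<times> 'm \<Rightarrow> 'm" where "bij_betw e (UNIV \<times> UNIV) UNIV"
    using card_of_Times_same_infinite[OF assms] card_of_ordIso by blast
  then have e: "inj e"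
    by (simp add: bij_betw_def)
  have "quotient_coding (\<lambda>K. e (SOME p. p \<in> K))"
    unfolding quotient_coding_def
  proof (intro allI impI notI)
    fix K L :: "('m \<times> 'm) set"
    assume "K \<noteq> {}" "L \<noteq> {}" "K \<inter> L = {}" "e (SOME p. p \<in> K) = e (SOME p. p \<in> L)"
    then show False
      using e by (metis disjoint_iff injD some_in_eq)
  qed
  then show ?thesis
    by blast
qed

context
  fixes code :: "('m \<times> 'm) set \<Rightarrow> 'm"
begin

text \<open>The (coded) class of the span \<open>(s, f)\<close>.\<close>

definition zcls :: "('o, 'm) factcat \<Rightarrow> 'm \<Rightarrow> 'm \<Rightarrow> 'm" where
  "zcls C s f = code (zrel C `` {(s, f)})"

definition RP_Arr :: "('o, 'm) factcat \<Rightarrow> 'm set" where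
  "RP_Arr C = {zcls C s f | s f. (s, f) \<in> spans C}"

definition RP :: "('o, 'm) factcat \<Rightarrow> ('o, 'm) rangecat" where
  "RP C =
    \<lparr>Ob = Ob C, Arr = RP_Arr C,
     Dom = (\<lambda>k\<in>RP_Arr C. THE a. \<exists>s f. (s, f) \<in> spans C \<and> k = zcls C s f \<and> a = Cod C s),
     Cod = (\<lambda>k\<in>RP_Arr C. THE b. \<exists>s f. (s, f) \<in> spans C \<and> k = zcls C s f \<and> b = Cod C f),
     Idn = (\<lambda>a\<in>Ob C. zcls C (Idn C a) (Idn C a)),
     Comp = (\<lambda>l k.
       if \<exists>s f t g. (s, f) \<in> spans C \<and> (t, g) \<in> spans C \<and>
            k = zcls C s f \<and> l = zcls C t g \<and> Cod C f = Cod C t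
       then THE n. \<exists>s f t g t' f'. (s, f) \<in> spans C \<and> (t, g) \<in> spans C \<and>
            k = zcls C s f \<and> l = zcls C t g \<and> pullback C f t' t f' \<and>
            n = zcls C (s \<cdot>\<^bsub>C\<^esub> t') (g \<cdot>\<^bsub>C\<^esub> f')
       else undefined),
     Rst = (\<lambda>k\<in>RP_Arr C. THE n. \<exists>s f. (s, f) \<in> spans C \<and> k = zcls C s f \<and> n = zcls C s s),
     Rng = (\<lambda>k\<in>RP_Arr C. THE n. \<exists>s f m p. (s, f) \<in> spans C \<and> k = zcls C s f \<and>
            m \<in> SCls C \<and> p \<in> PCls C \<and> seq C m p \<and> f = m \<cdot>\<^bsub>C\<^esub> p \<and> n = zcls C m m)\<rparr>"

definition RP_func ::
  "('o, 'm) factcat \<Rightarrow> ('p, 'm) factcat \<Rightarrow> ('o, 'm, 'p, 'm) func \<Rightarrow> ('o, 'm, 'p, 'm) func" where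
  "RP_func C D F =
    \<lparr>FO = FO F,
     FM = (\<lambda>k\<in>RP_Arr C. THE n. \<exists>s f. (s, f) \<in> spans C \<and> k = zcls C s f \<and>
            n = zcls D (FM F s) (FM F f))\<rparr>"

definition RP_ntrans ::
  "('o, 'm) factcat \<Rightarrow> ('p, 'm) factcat \<Rightarrow> ('o, 'm, 'p, 'm) ntrans \<Rightarrow> ('o, 'm, 'p, 'm) ntrans" where
  "RP_ntrans C D \<alpha> =
    \<lparr>Src = RP_func C D (Src \<alpha>), Tgt = RP_func C D (Tgt \<alpha>),
     Cmp = (\<lambda>a\<in>Ob C. zcls D (Idn D (FO (Src \<alpha>) a)) (Cmp \<alpha> a))\<rparr>"

definition RaPar ::
  "(('o, 'm) factcat, ('o, 'm, 'o, 'm) func, ('o, 'm, 'o, 'm) ntrans,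
    ('o, 'm) rangecat, ('o, 'm, 'o, 'm) func, ('o, 'm, 'o, 'm) ntrans) twofunc" where
  "RaPar =
    \<lparr>F0 = RP,
     FH = (\<lambda>C D. \<lparr>FO = restrict (RP_func C D) (Cell1 StableFact C D),
                  FM = restrict (RP_ntrans C D) (Cell2 StableFact C D)\<rparr>)\<rparr>"

end

end

theory Submission
  imports Defs
begin

text \<open>
  The unit sends a morphism \<open>f\<close> to the graph \<open>[1, f]\<close>, the counit sends \<open>[s, f]\<close> to \<open>f \<cdot> s\<^sup>-\<close>, where
  \<open>s\<^sup>-\<close> is the partial inverse of the total restricted isomorphism \<open>s\<close>; since \<open>[s, f] = [1, f] \<cdot> [s, 1]\<close>
  and \<open>[s, 1]\<close> is the partial inverse of \<open>[1, s]\<close>, the triangle identities are immediate.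

  The point of \<open>\<S>\<^sup>\<circ>\<close> is the identity \<open>[v \<cdot> s, b] \<cdot> [a, v \<cdot> f] = [s, b] \<cdot> [a, f]\<close> for \<open>v \<in> \<S>\<close>: the two
  composites are formed from pullbacks that differ by the conjugate of \<open>v\<close>. It makes the quotient of
  the span category a split range category. Conversely, in \<open>Tot X\<close> all \<open>\<S>\<close>-morphisms are monic, so
  conjugates of \<open>\<S>\<close>-morphisms are invertible and \<open>\<S>\<^sup>\<circ>\<close> consists of isomorphisms; hence the counit is
  well defined on classes. Functors of stable factorization systems preserve \<open>\<S>\<^sup>\<circ>\<close> by its minimality.
\<close>

section \<open>Pullbacks and isomorphisms\<close>

text \<open>The obstacle is that S-morphisms need not be monic. For spans on the nose,
  \<open>[s, 1] \<cdot> [1, s]\<close> is formed from the kernel pair of \<open>s\<close>, so it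
  need not be an identity, and the restriction laws can fail. The diagonal into that kernel pair is
  the conjugate of \<open>v = s\<close> for the cospan of two identities, and identifying spans
  along such comparisons repairs the laws. The other closure conditions on \<open>S_circ\<close> let
  the operations descend to classes: pullback stability serves composition, the condition on squares
  with two sides in P serves the range. Operations on classes are given by \<open>THE\<close>; all
  are evaluated by one principle, that a function of spans invariant under precomposition with
  members of \<open>S_circ\<close> is constant on classes. On the side of range categories, a total
  restricted isomorphism is always handled together with its partial inverse. Pullbacks along it are
  then detected by a single equation between restriction idempotents, which reduces their
  preservation to equational reasoning.\<close>

context category
begin

lemma Dom_Ob [simp]: "f \<in> Arr C \<Longrightarrow> Dom C f \<in> Ob C"
  using Dom_type by auto

lemma Cod_Ob [simp]: "f \<in> Arr C \<Longrightarrow> Cod C f \<in> Ob C"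
  using Cod_type by auto

lemma Idn_Arr [simp]: "a \<in> Ob C \<Longrightarrow> Idn C a \<in> Arr C"
  and Dom_Idn [simp]: "a \<in> Ob C \<Longrightarrow> Dom C (Idn C a) = a"
  and Cod_Idn [simp]: "a \<in> Ob C \<Longrightarrow> Cod C (Idn C a) = a"
  using Idn_hom by (auto simp: hom_def)

lemma Comp_Arr [simp]: "\<lbrakk>g \<in> Arr C; f \<in> Arr C; Dom C g = Cod C f\<rbrakk> \<Longrightarrow> g \<cdot> f \<in> Arr C"
  and Dom_Comp [simp]: "\<lbrakk>g \<in> Arr C; f \<in> Arr C; Dom C g = Cod C f\<rbrakk> \<Longrightarrow> Dom C (g \<cdot> f) = Dom C f"
  and Cod_Comp [simp]: "\<lbrakk>g \<in> Arr C; f \<in> Arr C; Dom C g = Cod C f\<rbrakk> \<Longrightarrow> Cod C (g \<cdot> f) = Cod C g"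
  using Comp_hom by (auto simp: hom_def seq_def)

lemma Comp_Idn_R [simp]: "\<lbrakk>f \<in> Arr C; Dom C f = a\<rbrakk> \<Longrightarrow> f \<cdot> Idn C a = f"
  and Comp_Idn_L [simp]: "\<lbrakk>f \<in> Arr C; Cod C f = a\<rbrakk> \<Longrightarrow> Idn C a \<cdot> f = f"
  using Comp_Idn_right Comp_Idn_left by auto

lemma Comp_assoc' [simp]:
  "\<lbrakk>h \<in> Arr C; g \<in> Arr C; f \<in> Arr C; Dom C h = Cod C g; Dom C g = Cod C f\<rbrakk>
   \<Longrightarrow> (h \<cdot> g) \<cdot> f = h \<cdot> (g \<cdot> f)"
  using Comp_assoc by (auto simp: seq_def)

text \<open>Composites are normalised to the right by \<open>Comp_assoc'\<close>, so a known
  equation between two-fold composites no longer matches inside a longer one. This lemma and the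
  next two supply the version with a tail \<open>x\<close>.\<close>

lemma Comp_extend:
  assumes "g \<cdot> f = k \<cdot> h" "g \<in> Arr C" "f \<in> Arr C" "k \<in> Arr C" "h \<in> Arr C" "x \<in> Arr C"
    "Dom C g = Cod C f" "Dom C k = Cod C h" "Dom C f = Cod C x"
  shows "g \<cdot> (f \<cdot> x) = k \<cdot> (h \<cdot> x)"
proof -
  have "Dom C h = Cod C x"
    using assms by (metis Dom_Comp)
  then have "g \<cdot> (f \<cdot> x) = (g \<cdot> f) \<cdot> x" "k \<cdot> (h \<cdot> x) = (k \<cdot> h) \<cdot> x"
    using assms(2-) Comp_assoc' by metis+
  then show ?thesis
    using assms(1) by simp
qed

lemma Comp_extend1:
  assumes "g \<cdot> f = k" "g \<in> Arr C" "f \<in> Arr C" "x \<in> Arr C" "Dom C g = Cod C f" "Dom C f = Cod C x"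
  shows "g \<cdot> (f \<cdot> x) = k \<cdot> x"
  using assms Comp_assoc' by metis

lemma Comp_cancel_L:
  assumes "g \<cdot> f = Idn C a" "g \<in> Arr C" "f \<in> Arr C" "x \<in> Arr C" "Dom C g = Cod C f" "Dom C f = Cod C x"
    "Cod C x = a"
  shows "g \<cdot> (f \<cdot> x) = x"
  using Comp_extend1[OF assms(1-6)] assms by simp

lemma pullbackI:
  assumes "f \<in> Arr C" "p \<in> Arr C" "g \<in> Arr C" "q \<in> Arr C"
    "Dom C f = Cod C p" "Dom C g = Cod C q" "f \<cdot> p = g \<cdot> q"
    and ex: "\<And>x y. \<lbrakk>x \<in> Arr C; y \<in> Arr C; Cod C x = Dom C f; Cod C y = Dom C g; Dom C y = Dom C x;
        f \<cdot> x = g \<cdot> y\<rbrakk>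
      \<Longrightarrow> \<exists>u. u \<in> Arr C \<and> Dom C u = Dom C x \<and> Cod C u = Dom C p \<and> p \<cdot> u = x \<and> q \<cdot> u = y"
    and uniq: "\<And>u v. \<lbrakk>u \<in> Arr C; v \<in> Arr C; Cod C u = Dom C p; Cod C v = Dom C p; Dom C v = Dom C u;
        p \<cdot> u = p \<cdot> v; q \<cdot> u = q \<cdot> v\<rbrakk> \<Longrightarrow> u = v"
  shows "pullback C f p g q"
  unfolding pullback_def
proof (intro conjI allI impI)
  show "commutes C f p g q"
    using assms by (simp add: commutes_def seq_def)
  fix x y
  assume xy: "commutes C f x g y"
  then have *: "x \<in> Arr C" "y \<in> Arr C" "Cod C x = Dom C f" "Cod C y = Dom C g" "f \<cdot> x = g \<cdot> y"
    by (auto simp: commutes_def seq_def)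
  then have "Dom C y = Dom C x"
    using assms by (metis Dom_Comp)
  with * obtain u where "u \<in> Arr C" "Dom C u = Dom C x" "Cod C u = Dom C p" "p \<cdot> u = x" "q \<cdot> u = y"
    using ex by metis
  then show "\<exists>!u. u \<in> hom C (Dom C x) (Dom C p) \<and> p \<cdot> u = x \<and> q \<cdot> u = y"
    by (intro ex1I[of _ u]) (auto simp: hom_def intro!: uniq)
qed

text \<open>\<open>commutes\<close> records only that each side is composable; the equal domains and
  codomains are read off from the equality of the composites, using that \<open>Dom\<close> and
  \<open>Cod\<close> are functions.\<close>

lemma pullbackD:
  assumes "pullback C f p g q"
  shows "f \<in> Arr C" "p \<in> Arr C" "g \<in> Arr C" "q \<in> Arr C" "Dom C f = Cod C p" "Dom C g = Cod C q"
    "Dom C q = Dom C p" "Cod C g = Cod C f" "f \<cdot> p = g \<cdot> q"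
proof -
  show *: "f \<in> Arr C" "p \<in> Arr C" "g \<in> Arr C" "q \<in> Arr C" "Dom C f = Cod C p" "Dom C g = Cod C q"
    "f \<cdot> p = g \<cdot> q"
    using assms by (auto simp: pullback_def commutes_def seq_def)
  show "Dom C q = Dom C p" "Cod C g = Cod C f"
    using * by (metis Dom_Comp) (use * in \<open>metis Cod_Comp\<close>)
qed

lemma pullback_ex:
  assumes "pullback C f p g q" "x \<in> Arr C" "y \<in> Arr C" "Cod C x = Dom C f" "Cod C y = Dom C g"
    "f \<cdot> x = g \<cdot> y"
  obtains u where "u \<in> Arr C" "Dom C u = Dom C x" "Cod C u = Dom C p" "p \<cdot> u = x" "q \<cdot> u = y"
proof -
  have "commutes C f x g y"
    using assms pullbackD[OF assms(1)] by (auto simp: commutes_def seq_def)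
  then show ?thesis
    using assms(1) that unfolding pullback_def hom_def by blast
qed

lemma pullback_uniq:
  assumes "pullback C f p g q" "u \<in> Arr C" "v \<in> Arr C" "Cod C u = Dom C p" "Cod C v = Dom C p"
    "p \<cdot> u = p \<cdot> v" "q \<cdot> u = q \<cdot> v"
  shows "u = v"
proof -
  note D = pullbackD[OF assms(1)]
  have dom: "Dom C u = Dom C v"
    using assms D by (metis Dom_Comp)
  have "commutes C f (p \<cdot> u) g (q \<cdot> u)"
    using assms D Comp_extend[of f p g q u] by (auto simp: commutes_def seq_def)
  then have "\<exists>!w. w \<in> hom C (Dom C (p \<cdot> u)) (Dom C p) \<and> p \<cdot> w = p \<cdot> u \<and> q \<cdot> w = q \<cdot> u"
    using assms(1) unfolding pullback_def by blast
  moreover have "u \<in> hom C (Dom C (p \<cdot> u)) (Dom C p)" "v \<in> hom C (Dom C (p \<cdot> u)) (Dom C p)"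
    using assms D dom by (auto simp: hom_def)
  ultimately show ?thesis
    using assms(6,7) by metis
qed

lemma pullback_sym: "pullback C f p g q \<Longrightarrow> pullback C g q f p"
proof -
  assume pb: "pullback C f p g q"
  note D = pullbackD[OF pb]
  show ?thesis
  proof (rule pullbackI)
    fix x y
    assume "x \<in> Arr C" "y \<in> Arr C" "Cod C x = Dom C g" "Cod C y = Dom C f" "Dom C y = Dom C x"
      "g \<cdot> x = f \<cdot> y"
    then show "\<exists>u. u \<in> Arr C \<and> Dom C u = Dom C x \<and> Cod C u = Dom C q \<and> q \<cdot> u = x \<and> p \<cdot> u = y"
      using pullback_ex[OF pb, of y x] D(7) by metis
  next
    fix u v
    assume "u \<in> Arr C" "v \<in> Arr C" "Cod C u = Dom C q" "Cod C v = Dom C q" "q \<cdot> u = q \<cdot> v" "p \<cdot> u = p \<cdot> v"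
    then show "u = v"
      using pullback_uniq[OF pb, of u v] D(7) by metis
  qed (use D in auto)
qed

lemma pullback_paste:
  assumes 1: "pullback C f t' t f'" and 2: "pullback C x u t' x'"
  shows "pullback C (f \<cdot> x) u t (f' \<cdot> x')"
proof -
  note D = pullbackD[OF 1] pullbackD[OF 2]
  have eq: "f \<cdot> (x \<cdot> u) = t \<cdot> (f' \<cdot> x')"
    using D Comp_extend[of f t' t f' x'] by auto
  show ?thesis
  proof (rule pullbackI)
    fix a b
    assume ab: "a \<in> Arr C" "b \<in> Arr C" "Cod C a = Dom C (f \<cdot> x)" "Cod C b = Dom C t" "Dom C b = Dom C a"
      "(f \<cdot> x) \<cdot> a = t \<cdot> b"
    obtain w where w: "w \<in> Arr C" "Dom C w = Dom C a" "Cod C w = Dom C t'" "t' \<cdot> w = x \<cdot> a" "f' \<cdot> w = b"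
      using pullback_ex[OF 1, of "x \<cdot> a" b] ab D by auto
    obtain z where z: "z \<in> Arr C" "Dom C z = Dom C a" "Cod C z = Dom C u" "u \<cdot> z = a" "x' \<cdot> z = w"
      using pullback_ex[OF 2, of a w] ab D w by auto
    show "\<exists>z. z \<in> Arr C \<and> Dom C z = Dom C a \<and> Cod C z = Dom C u \<and> u \<cdot> z = a \<and> (f' \<cdot> x') \<cdot> z = b"
      using z w D by (intro exI[of _ z]) auto
  next
    fix v w
    assume vw: "v \<in> Arr C" "w \<in> Arr C" "Cod C v = Dom C u" "Cod C w = Dom C u" "u \<cdot> v = u \<cdot> w"
      "(f' \<cdot> x') \<cdot> v = (f' \<cdot> x') \<cdot> w" "Dom C w = Dom C v"
    have "x' \<cdot> v = x' \<cdot> w"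
    proof (rule pullback_uniq[OF 1])
      have "x \<cdot> (u \<cdot> v) = x \<cdot> (u \<cdot> w)" using vw by simp
      then show "t' \<cdot> (x' \<cdot> v) = t' \<cdot> (x' \<cdot> w)"
        using Comp_extend[of x u t' x' v] Comp_extend[of x u t' x' w] D vw by simp
    qed (use D vw in auto)
    then show "v = w"
      using pullback_uniq[OF 2] vw D by auto
  qed (use D eq in auto)
qed

lemma pullback_paste_vert:
  assumes "pullback C f t' t f'" "pullback C f' y' y f''"
  shows "pullback C f (t' \<cdot> y') (t \<cdot> y) f''"
  using pullback_paste[OF assms(1)[THEN pullback_sym] assms(2)[THEN pullback_sym]]
  by (rule pullback_sym)

lemma isoI:
  assumes "f \<in> Arr C" "g \<in> Arr C" "Dom C g = Cod C f" "Cod C g = Dom C f"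
    "g \<cdot> f = Idn C (Dom C f)" "f \<cdot> g = Idn C (Cod C f)"
  shows "iso C f"
  using assms by (auto simp: iso_def hom_def)

lemma isoE:
  assumes "iso C f"
  obtains g where "f \<in> Arr C" "g \<in> Arr C" "Dom C g = Cod C f" "Cod C g = Dom C f"
    "g \<cdot> f = Idn C (Dom C f)" "f \<cdot> g = Idn C (Cod C f)" "iso C g"
  using assms by (auto simp: iso_def hom_def)

lemma iso_Idn [simp]: "a \<in> Ob C \<Longrightarrow> iso C (Idn C a)"
  by (rule isoI[of _ "Idn C a"]) auto

text \<open>With \<open>g'\<close> inverse to \<open>g\<close>, the pair of the identity and
  \<open>g' \<cdot> f\<close> is a cone. The induced \<open>u\<close> is a section of
  \<open>p\<close>, and joint monicity of the legs makes it a two-sided inverse.\<close>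

lemma iso_pullback:
  assumes pb: "pullback C f p g q" and g: "iso C g"
  shows "iso C p"
proof -
  note D = pullbackD[OF pb]
  obtain g' where g: "g' \<in> Arr C" "Dom C g' = Cod C g" "Cod C g' = Dom C g"
    "g' \<cdot> g = Idn C (Dom C g)" "g \<cdot> g' = Idn C (Cod C g)"
    using g isoE by metis
  have e: "g \<cdot> (g' \<cdot> f) = f"
    using Comp_cancel_L[OF g(5)] D g by auto
  obtain u where u: "u \<in> Arr C" "Dom C u = Dom C f" "Cod C u = Dom C p" "p \<cdot> u = Idn C (Dom C f)"
    "q \<cdot> u = g' \<cdot> f"
    using pullback_ex[OF pb, of "Idn C (Dom C f)" "g' \<cdot> f"] D g e by auto
  have "u \<cdot> p = Idn C (Dom C p)"
  proof (rule pullback_uniq[OF pb])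
    show "p \<cdot> (u \<cdot> p) = p \<cdot> Idn C (Dom C p)"
      using Comp_cancel_L[OF u(4)] D u by auto
    have "q \<cdot> (u \<cdot> p) = (g' \<cdot> f) \<cdot> p"
      using D u by (auto simp: Comp_extend1[OF u(5)])
    also have "\<dots> = g' \<cdot> (g \<cdot> q)"
      using D g by auto
    also have "\<dots> = q"
      using Comp_cancel_L[OF g(4)] D g by auto
    finally show "q \<cdot> (u \<cdot> p) = q \<cdot> Idn C (Dom C p)"
      using D by auto
  qed (use D u in auto)
  then show ?thesis
    using D u by (intro isoI[of _ u]) auto
qed

lemma pullback_trivial: "f \<in> Arr C \<Longrightarrow> pullback C f (Idn C (Dom C f)) (Idn C (Cod C f)) f"
  by (rule pullbackI) auto

lemma pullback_iso_Comp:
  assumes pb: "pullback C f p g q" and u: "iso C u" "Cod C u = Dom C p"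
  shows "pullback C f (p \<cdot> u) g (q \<cdot> u)"
proof -
  note D = pullbackD[OF pb]
  obtain v where v: "u \<in> Arr C" "v \<in> Arr C" "Dom C v = Dom C p" "Cod C v = Dom C u"
    "v \<cdot> u = Idn C (Dom C u)" "u \<cdot> v = Idn C (Dom C p)"
    using u isoE by metis
  show ?thesis
  proof (rule pullbackI)
    show "f \<cdot> p \<cdot> u = g \<cdot> q \<cdot> u"
      using Comp_extend[of f p g q u] D u v by auto
    fix x y
    assume "x \<in> Arr C" "y \<in> Arr C" "Cod C x = Dom C f" "Cod C y = Dom C g" "Dom C y = Dom C x"
      "f \<cdot> x = g \<cdot> y"
    then obtain z where z: "z \<in> Arr C" "Dom C z = Dom C x" "Cod C z = Dom C p" "p \<cdot> z = x" "q \<cdot> z = y"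
      using pullback_ex[OF pb, of x y] D by metis
    have "u \<cdot> (v \<cdot> z) = z"
      using Comp_cancel_L[OF v(6)] v z u by auto
    then show "\<exists>z. z \<in> Arr C \<and> Dom C z = Dom C x \<and> Cod C z = Dom C (p \<cdot> u) \<and> (p \<cdot> u) \<cdot> z = x \<and> (q \<cdot> u) \<cdot> z = y"
      using D z v u by (intro exI[of _ "v \<cdot> z"]) auto
  next
    fix a b
    assume ab: "a \<in> Arr C" "b \<in> Arr C" "Cod C a = Dom C (p \<cdot> u)" "Cod C b = Dom C (p \<cdot> u)"
      "(p \<cdot> u) \<cdot> a = (p \<cdot> u) \<cdot> b" "(q \<cdot> u) \<cdot> a = (q \<cdot> u) \<cdot> b" "Dom C b = Dom C a"
    have "u \<cdot> a = u \<cdot> b"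
      by (rule pullback_uniq[OF pb]) (use ab D v u in auto)
    then have "v \<cdot> (u \<cdot> a) = v \<cdot> (u \<cdot> b)" by simp
    moreover have "v \<cdot> (u \<cdot> a) = a" "v \<cdot> (u \<cdot> b) = b"
      using ab D v u by (auto intro!: Comp_cancel_L[OF v(5)])
    ultimately show "a = b" by simp
  qed (use D v u in auto)
qed

lemma pullback_compare:
  assumes 1: "pullback C f p g q" and 2: "pullback C f p' g q'"
  obtains u where "iso C u" "u \<in> Arr C" "Dom C u = Dom C p'" "Cod C u = Dom C p" "p \<cdot> u = p'" "q \<cdot> u = q'"
proof -
  note D = pullbackD[OF 1] pullbackD[OF 2]
  obtain u where u: "u \<in> Arr C" "Dom C u = Dom C p'" "Cod C u = Dom C p" "p \<cdot> u = p'" "q \<cdot> u = q'"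
    using pullback_ex[OF 1, of p' q'] D by metis
  obtain v where v: "v \<in> Arr C" "Dom C v = Dom C p" "Cod C v = Dom C p'" "p' \<cdot> v = p" "q' \<cdot> v = q"
    using pullback_ex[OF 2, of p q] D by metis
  have "u \<cdot> v = Idn C (Dom C p)"
    by (rule pullback_uniq[OF 1]) (use D u v in \<open>auto simp: Comp_extend1[OF u(4)] Comp_extend1[OF u(5)]\<close>)
  moreover have "v \<cdot> u = Idn C (Dom C p')"
    by (rule pullback_uniq[OF 2]) (use D u v in \<open>auto simp: Comp_extend1[OF v(4)] Comp_extend1[OF v(5)]\<close>)
  ultimately have "iso C u"
    using u v by (intro isoI[of _ v]) auto
  then show ?thesis
    using that u by blast
qed

text \<open>Postcomposing a cospan with a monic creates no new cones. This is what makes conjugates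
  invertible when S consists of monics.\<close>

lemma pullback_monic_Comp:
  assumes pb: "pullback C f p g q" and v: "v \<in> Arr C" "Dom C v = Cod C f"
    and monic: "\<And>x y. \<lbrakk>x \<in> Arr C; y \<in> Arr C; Cod C x = Dom C v; Cod C y = Dom C v; v \<cdot> x = v \<cdot> y\<rbrakk> \<Longrightarrow> x = y"
  shows "pullback C (v \<cdot> f) p (v \<cdot> g) q"
proof -
  note D = pullbackD[OF pb]
  show ?thesis
  proof (rule pullbackI)
    fix x y
    assume xy: "x \<in> Arr C" "y \<in> Arr C" "Cod C x = Dom C (v \<cdot> f)" "Cod C y = Dom C (v \<cdot> g)" "Dom C y = Dom C x"
      "(v \<cdot> f) \<cdot> x = (v \<cdot> g) \<cdot> y"
    have "f \<cdot> x = g \<cdot> y"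
      by (rule monic) (use xy D v in auto)
    then show "\<exists>u. u \<in> Arr C \<and> Dom C u = Dom C x \<and> Cod C u = Dom C p \<and> p \<cdot> u = x \<and> q \<cdot> u = y"
      using pullback_ex[OF pb, of x y] xy D v by (metis Dom_Comp)
  next
    fix a b
    assume "a \<in> Arr C" "b \<in> Arr C" "Cod C a = Dom C p" "Cod C b = Dom C p" "p \<cdot> a = p \<cdot> b" "q \<cdot> a = q \<cdot> b"
    then show "a = b"
      using pullback_uniq[OF pb] by blast
  qed (use D v in auto)
qed

end

section \<open>Orthogonal factorization systems\<close>

context orthogonal_factorization_system
begin

lemma P_in_Arr [simp]: "p \<in> P \<Longrightarrow> p \<in> Arr C" and S_in_Arr [simp]: "s \<in> S \<Longrightarrow> s \<in> Arr C"
  using P_Arr S_Arr by auto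

lemma lift_ex:
  assumes "p \<in> P" "s \<in> S" "f \<in> Arr C" "g \<in> Arr C" "Dom C s = Cod C f" "Dom C g = Cod C p" "s \<cdot> f = g \<cdot> p"
  obtains d where "d \<in> Arr C" "Dom C d = Cod C p" "Cod C d = Dom C s" "d \<cdot> p = f" "s \<cdot> d = g"
proof -
  have "commutes C s f g p"
    using assms by (auto simp: commutes_def seq_def)
  then show ?thesis
    using orthogonality[OF assms(1,2)] that unfolding hom_def by blast
qed

lemma lift_uniq:
  assumes "p \<in> P" "s \<in> S" "d \<in> Arr C" "e \<in> Arr C"
    "Dom C d = Cod C p" "Cod C d = Dom C s" "Dom C e = Cod C p" "Cod C e = Dom C s"
    "d \<cdot> p = e \<cdot> p" "s \<cdot> d = s \<cdot> e"
  shows "d = e"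
proof -
  have "commutes C s (d \<cdot> p) (s \<cdot> d) p"
    using assms by (auto simp: commutes_def seq_def)
  from orthogonality[OF assms(1,2) this] show ?thesis
    using assms by (auto simp: hom_def)
qed

text \<open>Factor \<open>f = n \<cdot> p\<close>. Lifting \<open>p\<close> against
  \<open>s \<cdot> f\<close>, with an identity on top, gives a retraction \<open>d\<close> of
  \<open>p\<close>. Both \<open>p \<cdot> d\<close> and the identity lift \<open>p\<close> against
  \<open>s \<cdot> n\<close>, so they agree, \<open>p\<close> is invertible and \<open>f\<close>
  lies in S.\<close>

lemma S_cancel:
  assumes s: "s \<in> S" and sf: "s \<cdot> f \<in> S" and f: "f \<in> Arr C" "Dom C s = Cod C f"
  shows "f \<in> S"
proof -
  obtain n p where np: "n \<in> S" "p \<in> P" "Dom C n = Cod C p" "f = n \<cdot> p"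
    using factorization[OF f(1)] by (auto simp: seq_def)
  have sn: "s \<cdot> n \<in> S"
    using s np f by (intro S_Comp) (auto simp: seq_def)
  obtain d where d: "d \<in> Arr C" "Dom C d = Cod C p" "Cod C d = Dom C p" "d \<cdot> p = Idn C (Dom C p)"
    "s \<cdot> (n \<cdot> (p \<cdot> d)) = s \<cdot> n"
    using lift_ex[OF np(2) sf, of "Idn C (Dom C p)" "s \<cdot> n"] s np f by auto
  have "p \<cdot> d = Idn C (Cod C p)"
    by (rule lift_uniq[OF np(2) sn]) (use s np f d in auto)
  then have "iso C p"
    using np d by (intro isoI[of _ d]) auto
  then show ?thesis
    using np S_Comp S_iso by (auto simp: seq_def)
qed

text \<open>Dual to \<open>S_cancel\<close>: the S-part \<open>s\<close> of \<open>g\<close> gets a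
  section by lifting \<open>g \<cdot> p\<close> against \<open>s\<close>, and uniqueness of lifts
  against \<open>q \<cdot> p\<close> turns the section into an inverse.\<close>

lemma P_cancel:
  assumes p: "p \<in> P" and gp: "g \<cdot> p \<in> P" and g: "g \<in> Arr C" "Dom C g = Cod C p"
  shows "g \<in> P"
proof -
  obtain s q where sq: "s \<in> S" "q \<in> P" "Dom C s = Cod C q" "g = s \<cdot> q"
    using factorization[OF g(1)] by (auto simp: seq_def)
  have qp: "q \<cdot> p \<in> P"
    using p sq g by (intro P_Comp) (auto simp: seq_def)
  have D: "Dom C q = Cod C p" "Cod C g = Cod C s"
    using sq g by auto
  then have gp': "s \<cdot> (q \<cdot> p) \<in> P"
    using gp sq p by simp
  obtain d where d: "d \<in> Arr C" "Dom C d = Cod C s" "Cod C d = Dom C s" "d \<cdot> (s \<cdot> (q \<cdot> p)) = q \<cdot> p"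
    "s \<cdot> d = Idn C (Cod C s)"
    using lift_ex[OF gp' sq(1), of "q \<cdot> p" "Idn C (Cod C s)"] p sq(1-3) D by auto
  have sds: "s \<cdot> (d \<cdot> s) = s"
    using Comp_cancel_L[OF d(5)] d sq by auto
  have "d \<cdot> s = Idn C (Dom C s)"
    by (rule lift_uniq[OF qp sq(1)]) (use p sq(1-3) D d sds in auto)
  then have "iso C s"
    using sq d by (intro isoI[of _ d]) auto
  then show ?thesis
    using sq P_Comp P_iso by (auto simp: seq_def)
qed

lemma P_S_iso: "f \<in> P \<Longrightarrow> f \<in> S \<Longrightarrow> iso C f"
proof -
  assume f: "f \<in> P" "f \<in> S"
  obtain d where "d \<in> Arr C" "Dom C d = Cod C f" "Cod C d = Dom C f" "d \<cdot> f = Idn C (Dom C f)"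
    "f \<cdot> d = Idn C (Cod C f)"
    using lift_ex[OF f, of "Idn C (Dom C f)" "Idn C (Cod C f)"] f by auto
  then show "iso C f"
    using f by (intro isoI[of _ d]) auto
qed

text \<open>The diagonal between two factorizations lies in S by \<open>S_cancel\<close> and in P by
  \<open>P_cancel\<close>, hence is invertible.\<close>

lemma factorization_unique:
  assumes "s \<in> S" "p \<in> P" "Dom C s = Cod C p" "s' \<in> S" "p' \<in> P" "Dom C s' = Cod C p'" "s \<cdot> p = s' \<cdot> p'"
  obtains u where "iso C u" "u \<in> Arr C" "Dom C u = Dom C s" "Cod C u = Dom C s'" "u \<cdot> p = p'" "s' \<cdot> u = s"
proof -
  obtain d where d: "d \<in> Arr C" "Dom C d = Cod C p" "Cod C d = Dom C s'" "d \<cdot> p = p'" "s' \<cdot> d = s"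
    using lift_ex[of p s' p' s] assms by auto
  have "d \<in> S"
    using S_cancel[of s' d] d assms(1,4) by simp
  moreover have "d \<in> P"
    using P_cancel[of p d] d assms(2,5) by simp
  ultimately have "iso C d"
    by (rule P_S_iso[rotated])
  then show ?thesis
    using that d assms(3) by metis
qed

text \<open>Factor \<open>s' = n \<cdot> p\<close>. Orthogonality extends \<open>f'\<close> along
  \<open>p\<close> to a morphism \<open>d\<close>, so \<open>n\<close> and \<open>d\<close> form a
  cone. The morphism \<open>u\<close> it induces is inverse to \<open>p\<close>: one composite by
  joint monicity of the pullback legs, the other by uniqueness of lifts.\<close>

lemma S_pullback:
  assumes pb: "pullback C f s' s f'" and s: "s \<in> S"
  shows "s' \<in> S"
proof -
  note D = pullbackD[OF pb]
  obtain n p where np: "n \<in> S" "p \<in> P" "Dom C n = Cod C p" "s' = n \<cdot> p"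
    using factorization[OF D(2)] by (auto simp: seq_def)
  note D' = D(1,3-7)[unfolded np(4)]
  obtain d where d: "d \<in> Arr C" "Dom C d = Cod C p" "Cod C d = Dom C s" "d \<cdot> p = f'" "s \<cdot> d = f \<cdot> n"
    using lift_ex[OF np(2) s, of f' "f \<cdot> n"] D np by auto
  then obtain u where u: "u \<in> Arr C" "Dom C u = Dom C n" "Cod C u = Dom C p" "n \<cdot> (p \<cdot> u) = n" "f' \<cdot> u = d"
    using pullback_ex[OF pb, of n d] D np by auto
  have e: "u \<cdot> p = Idn C (Dom C p)"
  proof (rule pullback_uniq[OF pb])
    show "s' \<cdot> (u \<cdot> p) = s' \<cdot> Idn C (Dom C p)"
      using np u Comp_extend1[of n "p \<cdot> u" n p] by auto
    show "f' \<cdot> (u \<cdot> p) = f' \<cdot> Idn C (Dom C p)"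
      using Comp_extend1[OF u(5)] np u d(4) D by simp
  qed (use np u D in auto)
  have "p \<cdot> u = Idn C (Cod C p)"
    by (rule lift_uniq[OF np(2,1)]) (use np u D e in auto)
  with e have "iso C p"
    using np u by (intro isoI[of _ u]) auto
  then show ?thesis
    using np S_Comp S_iso by (auto simp: seq_def)
qed

end

section \<open>Two-categories of functors\<close>

locale cat_functor = C: category C + D: category D
  for C :: "('o, 'm, 'z) cat_scheme" and D :: "('p, 'n, 'w) cat_scheme" +
  fixes F :: "('o, 'm, 'p, 'n) func"
  assumes is_func: "is_func C D F"
begin

lemma FO_Ob [simp]: "a \<in> Ob C \<Longrightarrow> FO F a \<in> Ob D"
  and FM_Arr [simp]: "f \<in> Arr C \<Longrightarrow> FM F f \<in> Arr D"
  and Dom_FM [simp]: "f \<in> Arr C \<Longrightarrow> Dom D (FM F f) = FO F (Dom C f)"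
  and Cod_FM [simp]: "f \<in> Arr C \<Longrightarrow> Cod D (FM F f) = FO F (Cod C f)"
  and FM_Idn [simp]: "a \<in> Ob C \<Longrightarrow> FM F (Idn C a) = Idn D (FO F a)"
  and FM_Comp [simp]: "\<lbrakk>g \<in> Arr C; f \<in> Arr C; Dom C g = Cod C f\<rbrakk>
    \<Longrightarrow> FM F (g \<cdot>\<^bsub>C\<^esub> f) = FM F g \<cdot>\<^bsub>D\<^esub> FM F f"
  and FO_undefined: "a \<notin> Ob C \<Longrightarrow> FO F a = undefined"
  using is_func by (auto simp: is_func_def seq_def PiE_def extensional_def)

lemma FM_eq:
  assumes "g \<cdot>\<^bsub>C\<^esub> f = k \<cdot>\<^bsub>C\<^esub> h" "g \<in> Arr C" "f \<in> Arr C" "k \<in> Arr C" "h \<in> Arr C"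
    "Dom C g = Cod C f" "Dom C k = Cod C h"
  shows "FM F g \<cdot>\<^bsub>D\<^esub> FM F f = FM F k \<cdot>\<^bsub>D\<^esub> FM F h"
  using assms by (metis FM_Comp)

lemma FM_eq1:
  assumes "g \<cdot>\<^bsub>C\<^esub> f = k" "g \<in> Arr C" "f \<in> Arr C" "Dom C g = Cod C f"
  shows "FM F g \<cdot>\<^bsub>D\<^esub> FM F f = FM F k"
  using assms by (metis FM_Comp)

end

lemma func_eqI:
  assumes "is_func C D F" "is_func C D G"
    "\<And>a. a \<in> Ob C \<Longrightarrow> FO F a = FO G a" "\<And>f. f \<in> Arr C \<Longrightarrow> FM F f = FM G f"
  shows "F = G"
proof -
  have "FO F = FO G" "FM F = FM G"
    using assms PiE_ext unfolding is_func_def by blast+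
  then show ?thesis by simp
qed

lemma is_func_id: "category C \<Longrightarrow> is_func C C (func_id C)"
proof -
  assume "category C"
  then interpret category C .
  show ?thesis
    by (auto simp: is_func_def func_id_def seq_def)
qed

lemma is_func_comp:
  assumes "category A" "category B" "category C" "is_func A B F" "is_func B C G"
  shows "is_func A C (func_comp A G F)"
proof -
  interpret F: cat_functor A B F
    using assms by (simp add: cat_functor_def cat_functor_axioms_def)
  interpret G: cat_functor B C G
    using assms by (simp add: cat_functor_def cat_functor_axioms_def)
  show ?thesis
    by (auto simp: is_func_def func_comp_def compose_def seq_def)
qed

section \<open>Natural transformations and their compositions\<close>

locale nat_trans = S: cat_functor C D "Src \<alpha>" + T: cat_functor C D "Tgt \<alpha>"
  for C :: "('o, 'm, 'z) cat_scheme" and D :: "('p, 'n, 'w) cat_scheme" and \<alpha> +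
  assumes is_ntrans: "is_ntrans C D \<alpha>"
begin

lemma Cmp_Arr [simp]: "a \<in> Ob C \<Longrightarrow> Cmp \<alpha> a \<in> Arr D"
  and Dom_Cmp [simp]: "a \<in> Ob C \<Longrightarrow> Dom D (Cmp \<alpha> a) = FO (Src \<alpha>) a"
  and Cod_Cmp [simp]: "a \<in> Ob C \<Longrightarrow> Cod D (Cmp \<alpha> a) = FO (Tgt \<alpha>) a"
  and Cmp_undefined: "a \<notin> Ob C \<Longrightarrow> Cmp \<alpha> a = undefined"
  using is_ntrans by (auto simp: is_ntrans_def hom_def extensional_def)

lemma naturality: "f \<in> Arr C \<Longrightarrow> Dom C f = a \<Longrightarrow> Cod C f = b
    \<Longrightarrow> FM (Tgt \<alpha>) f \<cdot>\<^bsub>D\<^esub> Cmp \<alpha> a = Cmp \<alpha> b \<cdot>\<^bsub>D\<^esub> FM (Src \<alpha>) f"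
  using is_ntrans by (auto simp: is_ntrans_def)

lemma naturality_extend: "\<lbrakk>f \<in> Arr C; Dom C f = a; Cod C f = b; x \<in> Arr D; Cod D x = FO (Src \<alpha>) a\<rbrakk>
    \<Longrightarrow> FM (Tgt \<alpha>) f \<cdot>\<^bsub>D\<^esub> (Cmp \<alpha> a \<cdot>\<^bsub>D\<^esub> x) = Cmp \<alpha> b \<cdot>\<^bsub>D\<^esub> (FM (Src \<alpha>) f \<cdot>\<^bsub>D\<^esub> x)"
  by (rule S.D.Comp_extend) (auto simp: naturality)

end

lemma nat_transI: "category C \<Longrightarrow> category D \<Longrightarrow> is_ntrans C D \<alpha> \<Longrightarrow> nat_trans C D \<alpha>"
  by (simp add: nat_trans_def nat_trans_axioms_def cat_functor_def cat_functor_axioms_def is_ntrans_def)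

lemma ntrans_eqI:
  fixes \<alpha> \<beta> :: "('o, 'm, 'p, 'n) ntrans"
  assumes "Src \<alpha> = Src \<beta>" "Tgt \<alpha> = Tgt \<beta>" "Cmp \<alpha> \<in> extensional (Ob C)" "Cmp \<beta> \<in> extensional (Ob C)"
    "\<And>a. a \<in> Ob C \<Longrightarrow> Cmp \<alpha> a = Cmp \<beta> a"
  shows "\<alpha> = \<beta>"
  using assms extensionalityI[OF assms(3,4,5)] by (intro ntrans.equality) auto

definition ntrans_id :: "('o, 'm, 'z) cat_scheme \<Rightarrow> ('p, 'n, 'w) cat_scheme \<Rightarrow> ('o, 'm, 'p, 'n) func
    \<Rightarrow> ('o, 'm, 'p, 'n) ntrans" where
  "ntrans_id C D F = \<lparr>Src = F, Tgt = F, Cmp = (\<lambda>a\<in>Ob C. Idn D (FO F a))\<rparr>"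

definition ntrans_vcomp :: "('o, 'm, 'z) cat_scheme \<Rightarrow> ('p, 'n, 'w) cat_scheme \<Rightarrow> ('o, 'm, 'p, 'n) ntrans
    \<Rightarrow> ('o, 'm, 'p, 'n) ntrans \<Rightarrow> ('o, 'm, 'p, 'n) ntrans" where
  "ntrans_vcomp C D \<beta> \<alpha> =
    \<lparr>Src = Src \<alpha>, Tgt = Tgt \<beta>, Cmp = (\<lambda>a\<in>Ob C. Cmp \<beta> a \<cdot>\<^bsub>D\<^esub> Cmp \<alpha> a)\<rparr>"

lemma ntrans_id_simps [simp]:
  "Src (ntrans_id C D F) = F" "Tgt (ntrans_id C D F) = F"
  "Cmp (ntrans_id C D F) = (\<lambda>a\<in>Ob C. Idn D (FO F a))"
  by (auto simp: ntrans_id_def)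

lemma ntrans_vcomp_simps [simp]:
  "Src (ntrans_vcomp C D \<beta> \<alpha>) = Src \<alpha>" "Tgt (ntrans_vcomp C D \<beta> \<alpha>) = Tgt \<beta>"
  "Cmp (ntrans_vcomp C D \<beta> \<alpha>) = (\<lambda>a\<in>Ob C. Cmp \<beta> a \<cdot>\<^bsub>D\<^esub> Cmp \<alpha> a)"
  by (auto simp: ntrans_vcomp_def)

lemma ntrans_hcomp_simps [simp]:
  "Src (ntrans_hcomp A C \<beta> \<alpha>) = func_comp A (Src \<beta>) (Src \<alpha>)"
  "Tgt (ntrans_hcomp A C \<beta> \<alpha>) = func_comp A (Tgt \<beta>) (Tgt \<alpha>)"
  "Cmp (ntrans_hcomp A C \<beta> \<alpha>) = (\<lambda>a\<in>Ob A. Cmp \<beta> (FO (Tgt \<alpha>) a) \<cdot>\<^bsub>C\<^esub> FM (Src \<beta>) (Cmp \<alpha> a))"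
  by (auto simp: ntrans_hcomp_def)

lemma func_comp_simps [simp]:
  "a \<in> Ob A \<Longrightarrow> FO (func_comp A G F) a = FO G (FO F a)"
  "f \<in> Arr A \<Longrightarrow> FM (func_comp A G F) f = FM G (FM F f)"
  by (auto simp: func_comp_def compose_def)

lemma func_id_simps [simp]:
  "a \<in> Ob A \<Longrightarrow> FO (func_id A) a = a"
  "f \<in> Arr A \<Longrightarrow> FM (func_id A) f = f"
  by (auto simp: func_id_def)

lemma ntrans_cat_simps [simp]:
  "Ob (ntrans_cat C D FF NN) = FF" "Arr (ntrans_cat C D FF NN) = NN"
  "\<alpha> \<in> NN \<Longrightarrow> Dom (ntrans_cat C D FF NN) \<alpha> = Src \<alpha>"
  "\<alpha> \<in> NN \<Longrightarrow> Cod (ntrans_cat C D FF NN) \<alpha> = Tgt \<alpha>"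
  "F \<in> FF \<Longrightarrow> Idn (ntrans_cat C D FF NN) F = ntrans_id C D F"
  "\<lbrakk>\<beta> \<in> NN; \<alpha> \<in> NN; Src \<beta> = Tgt \<alpha>\<rbrakk> \<Longrightarrow> Comp (ntrans_cat C D FF NN) \<beta> \<alpha> = ntrans_vcomp C D \<beta> \<alpha>"
  by (auto simp: ntrans_cat_def ntrans_id_def ntrans_vcomp_def)

lemma is_ntrans_id:
  assumes "category C" "category D" "is_func C D F"
  shows "is_ntrans C D (ntrans_id C D F)"
proof -
  interpret F: cat_functor C D F
    using assms by (simp add: cat_functor_def cat_functor_axioms_def)
  show ?thesis
    using assms by (auto simp: is_ntrans_def hom_def)
qed

lemma is_ntrans_vcomp:
  assumes "category C" "category D" "is_ntrans C D \<alpha>" "is_ntrans C D \<beta>" "Src \<beta> = Tgt \<alpha>"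
  shows "is_ntrans C D (ntrans_vcomp C D \<beta> \<alpha>)"
proof -
  interpret a: nat_trans C D \<alpha>
    using assms by (intro nat_transI)
  interpret b: nat_trans C D \<beta>
    using assms by (intro nat_transI)
  show ?thesis
    using a.S.is_func b.T.is_func by (auto simp: is_ntrans_def hom_def assms(5) a.naturality b.naturality_extend)
qed

lemma is_ntrans_hcomp:
  assumes "category A" "category B" "category C" "is_ntrans A B \<alpha>" "is_ntrans B C \<beta>"
  shows "is_ntrans A C (ntrans_hcomp A C \<beta> \<alpha>)"
proof -
  interpret a: nat_trans A B \<alpha>
    using assms by (intro nat_transI)
  interpret b: nat_trans B C \<beta>
    using assms by (intro nat_transI)
  show ?thesis
    unfolding is_ntrans_def
  proof (intro conjI ballI)
    show "is_func A C (Src (ntrans_hcomp A C \<beta> \<alpha>))" "is_func A C (Tgt (ntrans_hcomp A C \<beta> \<alpha>))"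
      using assms a.S.is_func a.T.is_func b.S.is_func b.T.is_func by (auto intro: is_func_comp)
    fix f assume f: "f \<in> Arr A"
    have "FM (Src \<beta>) (FM (Tgt \<alpha>) f) \<cdot>\<^bsub>C\<^esub> FM (Src \<beta>) (Cmp \<alpha> (Dom A f))
      = FM (Src \<beta>) (Cmp \<alpha> (Cod A f)) \<cdot>\<^bsub>C\<^esub> FM (Src \<beta>) (FM (Src \<alpha>) f)"
      by (rule b.S.FM_eq) (use f in \<open>auto simp: a.naturality\<close>)
    then show "FM (Tgt (ntrans_hcomp A C \<beta> \<alpha>)) f \<cdot>\<^bsub>C\<^esub> Cmp (ntrans_hcomp A C \<beta> \<alpha>) (Dom A f) =
         Cmp (ntrans_hcomp A C \<beta> \<alpha>) (Cod A f) \<cdot>\<^bsub>C\<^esub> FM (Src (ntrans_hcomp A C \<beta> \<alpha>)) f"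
      using f by (simp add: b.naturality_extend)
  qed (auto simp: hom_def)
qed

lemma func_comp_id_right: "is_func A B F \<Longrightarrow> func_comp A F (func_id A) = F"
  unfolding is_func_def func_comp_def func_id_def compose_def
  by (intro func.equality) (auto simp: fun_eq_iff PiE_def extensional_def)

lemma func_comp_id_left: "is_func A B F \<Longrightarrow> func_comp A (func_id B) F = F"
  unfolding is_func_def func_comp_def func_id_def compose_def
  by (intro func.equality) (auto simp: fun_eq_iff PiE_def extensional_def)

lemma func_comp_assoc: "is_func A B F \<Longrightarrow> func_comp A (func_comp B H G) F = func_comp A H (func_comp A G F)"
  unfolding is_func_def func_comp_def compose_def
  by (intro func.equality) (auto simp: fun_eq_iff PiE_def extensional_def)

section \<open>2-categories and 2-functors built from natural transformations\<close>

definition functor_twocat ::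
  "('o, 'm, 'z) cat_scheme set \<Rightarrow>
   (('o, 'm, 'z) cat_scheme \<Rightarrow> ('o, 'm, 'z) cat_scheme \<Rightarrow> ('o, 'm, 'o, 'm) func set) \<Rightarrow>
   (('o, 'm, 'z) cat_scheme \<Rightarrow> ('o, 'm, 'z) cat_scheme \<Rightarrow> ('o, 'm, 'o, 'm) ntrans set) \<Rightarrow>
   (('o, 'm, 'z) cat_scheme, ('o, 'm, 'o, 'm) func, ('o, 'm, 'o, 'm) ntrans) twocat" where
  "functor_twocat K FF NN =
    \<lparr>Ob2 = K, Hom2 = (\<lambda>A B. ntrans_cat A B (FF A B) (NN A B)), Id1 = func_id,
     Comp1 = (\<lambda>A B C. func_comp A), Comp2 = (\<lambda>A B C. ntrans_hcomp A C)\<rparr>"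

lemma functor_twocat_simps [simp]:
  "Ob2 (functor_twocat K FF NN) = K"
  "Hom2 (functor_twocat K FF NN) A B = ntrans_cat A B (FF A B) (NN A B)"
  "Id1 (functor_twocat K FF NN) = func_id"
  "Comp1 (functor_twocat K FF NN) A B C = func_comp A"
  "Comp2 (functor_twocat K FF NN) A B C = ntrans_hcomp A C"
  by (simp_all add: functor_twocat_def)

text \<open>Both 2-categories of the adjunction arise by choosing objects, functors and
  transformations among all of them. The 2-categorical equations are inherited, so closure of the
  chosen cells under identities and compositions is all that remains to be checked in each
  case.\<close>

lemma two_category_ntrans:
  fixes K :: "('o, 'm, 'z) cat_scheme set"
  assumes cat: "\<And>A. A \<in> K \<Longrightarrow> category A"
    and FF: "\<And>A B F. F \<in> FF A B \<Longrightarrow> is_func A B F"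
    and NN: "\<And>A B \<alpha>. \<alpha> \<in> NN A B \<Longrightarrow> is_ntrans A B \<alpha> \<and> Src \<alpha> \<in> FF A B \<and> Tgt \<alpha> \<in> FF A B"
    and id: "\<And>A. A \<in> K \<Longrightarrow> func_id A \<in> FF A A"
    and comp: "\<And>A B C F G. \<lbrakk>A \<in> K; B \<in> K; C \<in> K; F \<in> FF A B; G \<in> FF B C\<rbrakk> \<Longrightarrow> func_comp A G F \<in> FF A C"
    and nid: "\<And>A B F. \<lbrakk>A \<in> K; B \<in> K; F \<in> FF A B\<rbrakk> \<Longrightarrow> ntrans_id A B F \<in> NN A B"
    and vcomp: "\<And>A B \<alpha> \<beta>. \<lbrakk>A \<in> K; B \<in> K; \<alpha> \<in> NN A B; \<beta> \<in> NN A B; Src \<beta> = Tgt \<alpha>\<rbrakk>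
      \<Longrightarrow> ntrans_vcomp A B \<beta> \<alpha> \<in> NN A B"
    and hcomp: "\<And>A B C \<alpha> \<beta>. \<lbrakk>A \<in> K; B \<in> K; C \<in> K; \<alpha> \<in> NN A B; \<beta> \<in> NN B C\<rbrakk>
      \<Longrightarrow> ntrans_hcomp A C \<beta> \<alpha> \<in> NN A C"
  shows "two_category (functor_twocat K FF NN)"
proof -
  have fnct: "cat_functor A B F" if "A \<in> K" "B \<in> K" "F \<in> FF A B" for A B F
    using that cat FF by (simp add: cat_functor_def cat_functor_axioms_def)
  have nt: "nat_trans A B \<alpha>" if "A \<in> K" "B \<in> K" "\<alpha> \<in> NN A B" for A B \<alpha>
    using that cat NN nat_transI by metis
  have ext: "Cmp \<alpha> \<in> extensional (Ob A)" if "\<alpha> \<in> NN A B" for A B \<alpha>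
    using NN[OF that] by (simp add: is_ntrans_def)
  have homcat: "category (ntrans_cat A B (FF A B) (NN A B))" if AB: "A \<in> K" "B \<in> K" for A B
  proof -
    let ?H = "ntrans_cat A B (FF A B) (NN A B)"
    show ?thesis
    proof
      show "Dom ?H \<in> Arr ?H \<rightarrow>\<^sub>E Ob ?H" "Cod ?H \<in> Arr ?H \<rightarrow>\<^sub>E Ob ?H" "Idn ?H \<in> extensional (Ob ?H)"
        using NN by (auto simp: ntrans_cat_def)
      show "Idn ?H F \<in> hom ?H F F" if "F \<in> Ob ?H" for F
        using that nid AB by (simp add: hom_def)
      show "Comp ?H \<beta> \<alpha> = undefined" if "\<not> seq ?H \<beta> \<alpha>" for \<beta> \<alpha>
        using that by (auto simp: seq_def ntrans_cat_def)
      show "Comp ?H \<beta> \<alpha> \<in> hom ?H (Dom ?H \<alpha>) (Cod ?H \<beta>)" if "seq ?H \<beta> \<alpha>" for \<beta> \<alpha>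
        using that vcomp[OF AB] by (auto simp: seq_def hom_def)
      show "Comp ?H \<alpha> (Idn ?H (Dom ?H \<alpha>)) = \<alpha>" if "\<alpha> \<in> Arr ?H" for \<alpha>
      proof -
        interpret nat_trans A B \<alpha> using nt AB that by simp
        show ?thesis
          using that AB NN[of \<alpha>] nid ext by (auto intro!: ntrans_eqI[of _ _ A])
      qed
      show "Comp ?H (Idn ?H (Cod ?H \<alpha>)) \<alpha> = \<alpha>" if "\<alpha> \<in> Arr ?H" for \<alpha>
      proof -
        interpret nat_trans A B \<alpha> using nt AB that by simp
        show ?thesis
          using that AB NN[of \<alpha>] nid ext by (auto intro!: ntrans_eqI[of _ _ A])
      qed
      show "Comp ?H (Comp ?H \<gamma> \<beta>) \<alpha> = Comp ?H \<gamma> (Comp ?H \<beta> \<alpha>)" if "seq ?H \<gamma> \<beta>" "seq ?H \<beta> \<alpha>" for \<alpha> \<beta> \<gamma>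
      proof -
        have in_NN: "\<alpha> \<in> NN A B" "\<beta> \<in> NN A B" "\<gamma> \<in> NN A B" and e: "Src \<beta> = Tgt \<alpha>" "Src \<gamma> = Tgt \<beta>"
          using that by (auto simp: seq_def)
        interpret a: nat_trans A B \<alpha> using nt AB in_NN by simp
        interpret b: nat_trans A B \<beta> using nt AB in_NN by simp
        interpret c: nat_trans A B \<gamma> using nt AB in_NN by simp
        show ?thesis
          using in_NN e AB vcomp by (auto intro!: ntrans_eqI[of _ _ A])
      qed
    qed
  qed
  show ?thesis
    unfolding functor_twocat_def
  proof (rule two_category.intro, goal_cases)
    case (1 A B)
    then show ?case using homcat by simp
  next
    case (2 A)
    then show ?case using id by simp
  next
    case (3 A B C g f)
    then show ?case using comp by simp
  next
    case (4 A B C \<beta> \<alpha>)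
    then show ?case using hcomp by (auto simp: hom_def)
  next
    case (5 A B C g f)
    interpret f: cat_functor A B f using fnct 5 by simp
    interpret g: cat_functor B C g using fnct 5 by simp
    show ?case
      using 5 comp by (auto intro!: ntrans_eqI[of _ _ A])
  next
    case (6 A B C \<beta>' \<beta> \<alpha>' \<alpha>)
    have in_NN: "\<alpha> \<in> NN A B" "\<alpha>' \<in> NN A B" "\<beta> \<in> NN B C" "\<beta>' \<in> NN B C"
      and e: "Src \<alpha>' = Tgt \<alpha>" "Src \<beta>' = Tgt \<beta>" and AB: "A \<in> K" "B \<in> K" "C \<in> K"
      using 6 by (auto simp: seq_def)
    interpret a: nat_trans A B \<alpha> using nt AB in_NN by simp
    interpret a': nat_trans A B \<alpha>' using nt AB in_NN by simp
    interpret b: nat_trans B C \<beta> using nt AB in_NN by simp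
    interpret b': nat_trans B C \<beta>' using nt AB in_NN by simp
    have *: "ntrans_hcomp A C \<beta>' \<alpha>' \<in> NN A C" "ntrans_hcomp A C \<beta> \<alpha> \<in> NN A C"
      using hcomp AB in_NN by auto
    have "ntrans_hcomp A C (ntrans_vcomp B C \<beta>' \<beta>) (ntrans_vcomp A B \<alpha>' \<alpha>)
      = ntrans_vcomp A C (ntrans_hcomp A C \<beta>' \<alpha>') (ntrans_hcomp A C \<beta> \<alpha>)"
    proof (intro ntrans_eqI[of _ _ A])
      fix a assume a: "a \<in> Ob A"
      \<comment> \<open>The one non-formal point of the interchange law: naturality of
        \<open>\<beta>\<close> at the component of \<open>\<alpha>'\<close> moves that component
        past \<open>\<beta>\<close>.\<close>
      have "Cmp \<beta> (FO (Tgt \<alpha>') a) \<cdot>\<^bsub>C\<^esub> FM (Src \<beta>) (Cmp \<alpha>' a) \<cdot>\<^bsub>C\<^esub> FM (Src \<beta>) (Cmp \<alpha> a) =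
         FM (Tgt \<beta>) (Cmp \<alpha>' a) \<cdot>\<^bsub>C\<^esub> Cmp \<beta> (FO (Tgt \<alpha>) a) \<cdot>\<^bsub>C\<^esub> FM (Src \<beta>) (Cmp \<alpha> a)"
        using a e a'.Dom_Cmp[OF a] by (simp add: b.naturality_extend)
      then show "Cmp (ntrans_hcomp A C (ntrans_vcomp B C \<beta>' \<beta>) (ntrans_vcomp A B \<alpha>' \<alpha>)) a =
         Cmp (ntrans_vcomp A C (ntrans_hcomp A C \<beta>' \<alpha>') (ntrans_hcomp A C \<beta> \<alpha>)) a"
        using a e a'.Dom_Cmp[OF a] b'.Dom_Cmp[of "FO (Tgt \<alpha>') a"] by simp
    qed (use e in auto)
    then show ?case
      using 6 in_NN e * by simp
  next
    case (7 A B f)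
    then have "is_func A B f"
      using FF by simp
    then have "func_comp A f (func_id A) = f"
      by (rule func_comp_id_right)
    then show ?case by simp
  next
    case (8 A B f)
    then show ?case using FF by (simp add: func_comp_id_left)
  next
    case (9 A B \<alpha>)
    then have in_NN: "\<alpha> \<in> NN A B" "Src \<alpha> \<in> FF A B" "Tgt \<alpha> \<in> FF A B" "func_id A \<in> FF A A"
      using NN id by auto
    interpret a: nat_trans A B \<alpha> using nt 9 in_NN by simp
    show ?case
      using 9 in_NN ext[of \<alpha> A B] func_comp_id_right[OF a.S.is_func] func_comp_id_right[OF a.T.is_func]
      by (auto intro!: ntrans_eqI[of _ _ A])
  next
    case (10 A B \<alpha>)
    then have in_NN: "\<alpha> \<in> NN A B" "Src \<alpha> \<in> FF A B" "Tgt \<alpha> \<in> FF A B" "func_id B \<in> FF B B"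
      using NN id by auto
    interpret a: nat_trans A B \<alpha> using nt 10 in_NN by simp
    show ?case
      using 10 in_NN FF ext[of \<alpha> A B] by (auto intro!: ntrans_eqI[of _ _ A] simp: func_comp_id_left)
  next
    case (11 A B C D h g f)
    then show ?case using FF by (simp add: func_comp_assoc)
  next
    case (12 A B C D \<gamma> \<beta> \<alpha>)
    then have in_NN: "\<alpha> \<in> NN A B" "Src \<alpha> \<in> FF A B" "Tgt \<alpha> \<in> FF A B" "\<beta> \<in> NN B C" "\<gamma> \<in> NN C D"
      using NN by auto
    interpret a: nat_trans A B \<alpha> using nt 12 in_NN by simp
    interpret b: nat_trans B C \<beta> using nt 12 in_NN by simp
    interpret c: nat_trans C D \<gamma> using nt 12 in_NN by simp
    show ?case
      using in_NN FF by (auto intro!: ntrans_eqI[of _ _ A] simp: func_comp_assoc)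
  qed
qed

text \<open>\<open>nid\<close> and \<open>vcomp\<close> express functoriality on hom-categories,
  while \<open>id\<close>, \<open>comp\<close> and \<open>hcomp\<close> express strict compatibility
  with the 2-categorical composition. The maps are restricted to the cells because functors are
  required to be extensional; \<open>Total\<close> and \<open>RaPar\<close> both have this
  form.\<close>

lemma two_functor_ntrans:
  fixes K :: "('o, 'm, 'z) cat_scheme set" and K' :: "('p, 'n, 'w) cat_scheme set"
    and FF NN FF' NN'
  defines "T \<equiv> functor_twocat K FF NN" and "T' \<equiv> functor_twocat K' FF' NN'"
  assumes T: "two_category T" and T': "two_category T'"
    and F0: "\<And>A. A \<in> K \<Longrightarrow> Lo A \<in> K'"
    and FF: "\<And>A B F. \<lbrakk>A \<in> K; B \<in> K; F \<in> FF A B\<rbrakk> \<Longrightarrow> Lf A B F \<in> FF' (Lo A) (Lo B)"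
    and NN: "\<And>A B \<alpha>. \<lbrakk>A \<in> K; B \<in> K; \<alpha> \<in> NN A B\<rbrakk> \<Longrightarrow> Lt A B \<alpha> \<in> NN' (Lo A) (Lo B)"
    and Src: "\<And>A B \<alpha>. Src (Lt A B \<alpha>) = Lf A B (Src \<alpha>)"
    and Tgt: "\<And>A B \<alpha>. Tgt (Lt A B \<alpha>) = Lf A B (Tgt \<alpha>)"
    and nid: "\<And>A B F. \<lbrakk>A \<in> K; B \<in> K; F \<in> FF A B\<rbrakk>
      \<Longrightarrow> Lt A B (ntrans_id A B F) = ntrans_id (Lo A) (Lo B) (Lf A B F)"
    and vcomp: "\<And>A B \<alpha> \<beta>. \<lbrakk>A \<in> K; B \<in> K; \<alpha> \<in> NN A B; \<beta> \<in> NN A B; Src \<beta> = Tgt \<alpha>\<rbrakk>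
      \<Longrightarrow> Lt A B (ntrans_vcomp A B \<beta> \<alpha>) = ntrans_vcomp (Lo A) (Lo B) (Lt A B \<beta>) (Lt A B \<alpha>)"
    and id: "\<And>A. A \<in> K \<Longrightarrow> Lf A A (func_id A) = func_id (Lo A)"
    and comp: "\<And>A B C F G. \<lbrakk>A \<in> K; B \<in> K; C \<in> K; F \<in> FF A B; G \<in> FF B C\<rbrakk>
      \<Longrightarrow> Lf A C (func_comp A G F) = func_comp (Lo A) (Lf B C G) (Lf A B F)"
    and hcomp: "\<And>A B C \<alpha> \<beta>. \<lbrakk>A \<in> K; B \<in> K; C \<in> K; \<alpha> \<in> NN A B; \<beta> \<in> NN B C\<rbrakk>
      \<Longrightarrow> Lt A C (ntrans_hcomp A C \<beta> \<alpha>) = ntrans_hcomp (Lo A) (Lo C) (Lt B C \<beta>) (Lt A B \<alpha>)"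
  shows "two_functor T T' \<lparr>F0 = Lo, FH = (\<lambda>A B. \<lparr>FO = restrict (Lf A B) (FF A B), FM = restrict (Lt A B) (NN A B)\<rparr>)\<rparr>"
    (is "two_functor T T' ?F")
proof -
  interpret T: two_category T by fact
  interpret T': two_category T' by fact
  show ?thesis
  proof
    fix A B assume "A \<in> Ob2 T" "B \<in> Ob2 T"
    then have AB: "A \<in> K" "B \<in> K"
      by (simp_all add: T_def functor_twocat_def)
    interpret H: category "ntrans_cat A B (FF A B) (NN A B)"
      using T.Hom2_category[of A B] AB by (simp add: T_def functor_twocat_def)
    \<comment> \<open>Closure of the chosen cells is recovered from the hom-category of
      \<open>T\<close>: its domain and codomain maps, identities and composition are exactly these
      operations.\<close>
    have NNF: "Src \<alpha> \<in> FF A B" "Tgt \<alpha> \<in> FF A B" if "\<alpha> \<in> NN A B" for \<alpha>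
      using H.Dom_Ob[of \<alpha>] H.Cod_Ob[of \<alpha>] that by simp_all
    have nidN: "ntrans_id A B F \<in> NN A B" if "F \<in> FF A B" for F
      using H.Idn_Arr[of F] that by simp
    have vcN: "ntrans_vcomp A B \<beta> \<alpha> \<in> NN A B" if "\<alpha> \<in> NN A B" "\<beta> \<in> NN A B" "Src \<beta> = Tgt \<alpha>" for \<alpha> \<beta>
      using H.Comp_Arr[of \<beta> \<alpha>] that by simp
    show "is_func (Hom2 T A B) (Hom2 T' (F0 ?F A) (F0 ?F B)) (FH ?F A B)"
      using AB FF NN NNF nidN vcN nid vcomp Src Tgt by (auto simp: is_func_def seq_def T_def T'_def functor_twocat_def)
  next
    fix A assume "A \<in> Ob2 T"
    then show "F1 ?F A A (Id1 T A) = Id1 T' (F0 ?F A)"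
      using T.Id1_cell[of A] id by (simp add: T_def T'_def functor_twocat_def)
  next
    fix A B C g f
    assume "A \<in> Ob2 T" "B \<in> Ob2 T" "C \<in> Ob2 T" "g \<in> Cell1 T B C" "f \<in> Cell1 T A B"
    then show "F1 ?F A C (Comp1 T A B C g f) = Comp1 T' (F0 ?F A) (F0 ?F B) (F0 ?F C) (F1 ?F B C g) (F1 ?F A B f)"
      using T.Comp1_cell[of A B C g f] comp by (simp add: T_def T'_def functor_twocat_def)
  next
    fix A B C \<beta> \<alpha>
    assume "A \<in> Ob2 T" "B \<in> Ob2 T" "C \<in> Ob2 T" "\<beta> \<in> Cell2 T B C" "\<alpha> \<in> Cell2 T A B"
    then show "F2 ?F A C (Comp2 T A B C \<beta> \<alpha>) = Comp2 T' (F0 ?F A) (F0 ?F B) (F0 ?F C) (F2 ?F B C \<beta>) (F2 ?F A B \<alpha>)"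
      using T.Comp2_cell[of A B C \<beta> \<alpha>] hcomp by (simp add: T_def T'_def functor_twocat_def hom_def)
  qed (use F0 in \<open>simp add: T_def T'_def functor_twocat_def\<close>)
qed

section \<open>The 2-category of stable factorization systems\<close>

lemma SF_func_is_func: "SF_func C D F \<Longrightarrow> is_func C D F"
  by (simp add: SF_func_def)

locale sf_functor = C: stable_fact C + D: stable_fact D + cat_functor C D F
  for C :: "('o, 'm) factcat" and D :: "('p, 'n) factcat" and F +
  assumes SF_func: "SF_func C D F"
begin

lemma FM_PCls [simp]: "p \<in> PCls C \<Longrightarrow> FM F p \<in> PCls D"
  and FM_SCls [simp]: "s \<in> SCls C \<Longrightarrow> FM F s \<in> SCls D"
  and FM_pullback: "s \<in> SCls C \<Longrightarrow> pullback C f s' s f'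
    \<Longrightarrow> pullback D (FM F f) (FM F s') (FM F s) (FM F f')"
  using SF_func by (auto simp: SF_func_def)

end

lemma sf_functorI:
  assumes "stable_fact C" "stable_fact D" "SF_func C D F"
  shows "sf_functor C D F"
proof -
  interpret C: stable_fact C by fact
  interpret D: stable_fact D by fact
  show ?thesis
    by standard (use assms(3) SF_func_is_func in auto)
qed

lemma stable_fact_category: "stable_fact C \<Longrightarrow> category C"
  by (simp add: stable_fact_def orthogonal_factorization_system_def)

lemma SF_func_comp:
  assumes "stable_fact A" "stable_fact B" "stable_fact C" "SF_func A B F" "SF_func B C G"
  shows "SF_func A C (func_comp A G F)"
proof -
  interpret F: sf_functor A B F using assms by (intro sf_functorI)
  interpret G: sf_functor B C G using assms by (intro sf_functorI)
  have "is_func A C (func_comp A G F)"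
    using F.is_func G.is_func is_func_comp F.C.category_axioms F.D.category_axioms G.D.category_axioms by blast
  moreover have "pullback C (FM (func_comp A G F) f) (FM (func_comp A G F) s') (FM (func_comp A G F) s)
      (FM (func_comp A G F) f')" if "s \<in> SCls A" "pullback A f s' s f'" for f s' s f'
    using F.C.pullbackD[OF that(2)] G.FM_pullback[OF _ F.FM_pullback[OF that]] that(1) by simp
  ultimately show ?thesis
    by (auto simp: SF_func_def)
qed

lemma StableFact_eq:
  "StableFact = functor_twocat {C. stable_fact C} (\<lambda>C D. {F. SF_func C D F}) (\<lambda>C D. {\<alpha>. SF_ntrans C D \<alpha>})"
  by (simp add: StableFact_def functor_twocat_def)

lemma two_category_StableFact: "two_category StableFact"
  unfolding StableFact_eq
proof (rule two_category_ntrans; (unfold mem_Collect_eq)?)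
  fix A :: "('a, 'b) factcat"
  assume "stable_fact A"
  then interpret stable_fact A .
  show "SF_func A A (func_id A)"
    using is_func_id[OF category_axioms] pullbackD by (auto simp: SF_func_def dest: pullbackD)
next
  fix A B :: "('a, 'b) factcat" and F
  assume *: "stable_fact A" "stable_fact B" "SF_func A B F"
  then interpret F: sf_functor A B F by (intro sf_functorI)
  have "pullback B (FM F s) (Idn B (FO F (Dom A s))) (Idn B (FO F (Cod A s))) (FM F s)"
    if "s \<in> SCls A" for s
    using F.D.pullback_trivial[of "FM F s"] that by simp
  then show "SF_ntrans A B (ntrans_id A B F)"
    using * is_ntrans_id[of A B F] F.C.category_axioms F.D.category_axioms F.is_func
    by (auto simp: SF_ntrans_def)
next
  fix A B :: "('a, 'b) factcat" and \<alpha> \<beta>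
  assume *: "stable_fact A" "stable_fact B" "SF_ntrans A B \<alpha>" "SF_ntrans A B \<beta>" "Src \<beta> = Tgt \<alpha>"
  interpret A: stable_fact A by fact
  interpret B: stable_fact B by fact
  have "pullback B (FM (Tgt \<beta>) s) (Cmp \<beta> (Dom A s) \<cdot>\<^bsub>B\<^esub> Cmp \<alpha> (Dom A s))
    (Cmp \<beta> (Cod A s) \<cdot>\<^bsub>B\<^esub> Cmp \<alpha> (Cod A s)) (FM (Src \<alpha>) s)" if "s \<in> SCls A" for s
  proof (rule B.pullback_paste_vert)
    show "pullback B (FM (Tgt \<beta>) s) (Cmp \<beta> (Dom A s)) (Cmp \<beta> (Cod A s)) (FM (Tgt \<alpha>) s)"
      "pullback B (FM (Tgt \<alpha>) s) (Cmp \<alpha> (Dom A s)) (Cmp \<alpha> (Cod A s)) (FM (Src \<alpha>) s)"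
      using * that unfolding SF_ntrans_def by metis+
  qed
  then show "SF_ntrans A B (ntrans_vcomp A B \<beta> \<alpha>)"
    using * is_ntrans_vcomp[of A B \<alpha> \<beta>] A.category_axioms B.category_axioms
    by (auto simp: SF_ntrans_def)
next
  fix A B C :: "('a, 'b) factcat" and \<alpha> \<beta>
  assume *: "stable_fact A" "stable_fact B" "stable_fact C" "SF_ntrans A B \<alpha>" "SF_ntrans B C \<beta>"
  then have SF: "SF_func A B (Src \<alpha>)" "SF_func A B (Tgt \<alpha>)" "SF_func B C (Src \<beta>)" "SF_func B C (Tgt \<beta>)"
    by (auto simp: SF_ntrans_def)
  interpret Ta: sf_functor A B "Tgt \<alpha>" using * SF by (intro sf_functorI)
  interpret Sb: sf_functor B C "Src \<beta>" using * SF by (intro sf_functorI)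
  have "pullback C (FM (Tgt \<beta>) (FM (Tgt \<alpha>) s))
    (Cmp \<beta> (FO (Tgt \<alpha>) (Dom A s)) \<cdot>\<^bsub>C\<^esub> FM (Src \<beta>) (Cmp \<alpha> (Dom A s)))
    (Cmp \<beta> (FO (Tgt \<alpha>) (Cod A s)) \<cdot>\<^bsub>C\<^esub> FM (Src \<beta>) (Cmp \<alpha> (Cod A s))) (FM (Src \<beta>) (FM (Src \<alpha>) s))"
    if s: "s \<in> SCls A" for s
  proof (rule Sb.D.pullback_paste_vert)
    have "pullback C (FM (Tgt \<beta>) (FM (Tgt \<alpha>) s)) (Cmp \<beta> (Dom B (FM (Tgt \<alpha>) s)))
      (Cmp \<beta> (Cod B (FM (Tgt \<alpha>) s))) (FM (Src \<beta>) (FM (Tgt \<alpha>) s))"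
      using * Ta.FM_SCls[OF s] unfolding SF_ntrans_def by blast
    then show "pullback C (FM (Tgt \<beta>) (FM (Tgt \<alpha>) s)) (Cmp \<beta> (FO (Tgt \<alpha>) (Dom A s)))
      (Cmp \<beta> (FO (Tgt \<alpha>) (Cod A s))) (FM (Src \<beta>) (FM (Tgt \<alpha>) s))"
      using s by simp
    have "pullback B (FM (Tgt \<alpha>) s) (Cmp \<alpha> (Dom A s)) (Cmp \<alpha> (Cod A s)) (FM (Src \<alpha>) s)"
      using * s unfolding SF_ntrans_def by blast
    \<comment> \<open>A 1-cell preserves pullbacks whose S-morphism stands in third position,
      whereas here it stands in first position. The square is therefore flipped, mapped and flipped
      back.\<close>
    then show "pullback C (FM (Src \<beta>) (FM (Tgt \<alpha>) s)) (FM (Src \<beta>) (Cmp \<alpha> (Dom A s)))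
      (FM (Src \<beta>) (Cmp \<alpha> (Cod A s))) (FM (Src \<beta>) (FM (Src \<alpha>) s))"
      using Sb.FM_pullback s Ta.FM_SCls Ta.D.pullback_sym Sb.D.pullback_sym by blast
  qed
  then show "SF_ntrans A C (ntrans_hcomp A C \<beta> \<alpha>)"
    using * SF_func_comp[OF *(1-3) SF(1,3)] SF_func_comp[OF *(1-3) SF(2,4)]
      is_ntrans_hcomp[of A B C \<alpha> \<beta>] stable_fact_category by (auto simp: SF_ntrans_def)
qed (auto simp: SF_ntrans_def intro: stable_fact_category SF_func_is_func SF_func_comp)

section \<open>Split range categories\<close>

text \<open>Total restricted isomorphisms together with their inverse: for total \<open>s\<close>
  the condition that \<open>j \<cdot> s\<close> is the restriction of \<open>s\<close> becomes
  \<open>j \<cdot> s = 1\<close>, and conversely this equation forces \<open>s\<close> to be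
  total.\<close>

definition partial_inverse :: "('o, 'm) rangecat \<Rightarrow> 'm \<Rightarrow> 'm \<Rightarrow> bool" where
  "partial_inverse X s j \<longleftrightarrow> s \<in> Arr X \<and> j \<in> Arr X \<and> Dom X j = Cod X s \<and> Cod X j = Dom X s \<and>
     j \<cdot>\<^bsub>X\<^esub> s = Idn X (Dom X s) \<and> s \<cdot>\<^bsub>X\<^esub> j = Rst X j"

section \<open>Restriction idempotents, total morphisms and partial inverses\<close>

context restriction_category
begin

lemma Rst_Arr [simp]: "f \<in> Arr X \<Longrightarrow> Rst X f \<in> Arr X"
  and Dom_Rst [simp]: "f \<in> Arr X \<Longrightarrow> Dom X (Rst X f) = Dom X f"
  and Cod_Rst [simp]: "f \<in> Arr X \<Longrightarrow> Cod X (Rst X f) = Dom X f"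
  using Rst_hom by (auto simp: hom_def)

lemma Rst_Idn [simp]: "a \<in> Ob X \<Longrightarrow> Rst X (Idn X a) = Idn X a"
  using R1[of "Idn X a"] by simp

lemma Rst_Rst [simp]: "f \<in> Arr X \<Longrightarrow> Rst X (Rst X f) = Rst X f"
  using R3[of f "Idn X (Dom X f)"] by simp

lemma Rst_Comp_absorb: "\<lbrakk>g \<in> Arr X; f \<in> Arr X; Dom X g = Cod X f\<rbrakk>
    \<Longrightarrow> Rst X (g \<cdot> f) \<cdot> Rst X f = Rst X (g \<cdot> f)"
  using R3[of f "g \<cdot> f"] by (simp add: R1)

lemma total_Arr: "total X f \<Longrightarrow> f \<in> Arr X"
  by (simp add: total_def)

text \<open>The restriction of \<open>g \<cdot> f\<close> always lies below that of
  \<open>f\<close>. For total \<open>g\<close>, R4 reads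
  \<open>f = f \<cdot> Rst X (g \<cdot> f)\<close>, which gives the opposite inequality.\<close>

lemma Rst_total_Comp: 
  assumes "total X g" "f \<in> Arr X" "Dom X g = Cod X f"
  shows "Rst X (g \<cdot> f) = Rst X f"
proof -
  have g: "g \<in> Arr X" "Rst X g = Idn X (Dom X g)"
    using assms by (auto simp: total_def)
  have "f = f \<cdot> Rst X (g \<cdot> f)"
    using R4[of g f] g assms by (simp add: seq_def)
  then have "Rst X f = Rst X f \<cdot> Rst X (g \<cdot> f)"
    using R3[of "g \<cdot> f" f] g assms by simp
  also have "\<dots> = Rst X (g \<cdot> f)"
    using R2[of f "g \<cdot> f"] Rst_Comp_absorb[of g f] g assms by simp
  finally show ?thesis ..
qed

lemma total_Idn [simp]: "a \<in> Ob X \<Longrightarrow> total X (Idn X a)"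
  by (simp add: total_def)

lemma total_Comp [simp]: "\<lbrakk>total X g; total X f; Dom X g = Cod X f\<rbrakk> \<Longrightarrow> total X (g \<cdot> f)"
  using Rst_total_Comp[of g f] by (auto simp: total_def)

lemma total_cancel:
  assumes "total X (g \<cdot> f)" "g \<in> Arr X" "f \<in> Arr X" "Dom X g = Cod X f"
  shows "total X f"
  using Rst_Comp_absorb[of g f] assms by (auto simp: total_def)

lemma partial_inverseD:
  assumes "partial_inverse X s j"
  shows "s \<in> Arr X" "j \<in> Arr X" "Dom X j = Cod X s" "Cod X j = Dom X s"
    "j \<cdot> s = Idn X (Dom X s)" "s \<cdot> j = Rst X j" "total X s"
  using assms total_cancel[of j s] by (auto simp: partial_inverse_def)

lemma total_iso: "iso X f \<Longrightarrow> total X f"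
  using isoE[of f] total_cancel[of _ f] total_Idn Dom_Ob by metis

text \<open>Each inverse is a restriction of the other, \<open>k \<cdot> Rst X j = j\<close> and
  \<open>j \<cdot> Rst X k = k\<close>; commuting the two idempotents yields equality.\<close>

lemma partial_inverse_unique:
  assumes "partial_inverse X s j" "partial_inverse X s k"
  shows "j = k"
proof -
  note D = partial_inverseD[OF assms(1)] partial_inverseD[OF assms(2)]
  have kj: "k \<cdot> Rst X j = j" and jk: "j \<cdot> Rst X k = k"
    using D Comp_cancel_L[OF D(5)] Comp_cancel_L[OF D(12)] by (metis+)
  have "j = j \<cdot> (Rst X k \<cdot> Rst X j)"
    using kj jk D Comp_extend1[OF jk, of "Rst X j"] by simp
  also have "\<dots> = (j \<cdot> Rst X j) \<cdot> Rst X k"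
    using R2[of j k] D by simp
  also have "\<dots> = k"
    using R1 D jk by simp
  finally show ?thesis .
qed

text \<open>The equation that needs an argument is the one for
  \<open>(s \<cdot> t) \<cdot> (k \<cdot> j)\<close>: the inner part \<open>t \<cdot> k\<close> is a
  restriction idempotent, and R4 moves it to the right of \<open>j\<close>, where
  \<open>s \<cdot> j\<close> is absorbed.\<close>

lemma partial_inverse_Comp:
  assumes "partial_inverse X s j" "partial_inverse X t k" "Dom X s = Cod X t"
  shows "partial_inverse X (s \<cdot> t) (k \<cdot> j)"
proof -
  note D = partial_inverseD[OF assms(1)] partial_inverseD[OF assms(2)] assms(3)
  have "k \<cdot> (j \<cdot> (s \<cdot> t)) = Idn X (Dom X t)"
    using Comp_cancel_L[OF D(5)] D by simp
  moreover have "s \<cdot> (t \<cdot> (k \<cdot> j)) = Rst X (k \<cdot> j)"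
  proof -
    have "t \<cdot> (k \<cdot> j) = Rst X k \<cdot> j"
      using D by (intro Comp_extend1) auto
    also have "\<dots> = j \<cdot> Rst X (k \<cdot> j)"
      using D by (intro R4) (auto simp: seq_def)
    finally have "s \<cdot> (t \<cdot> (k \<cdot> j)) = s \<cdot> (j \<cdot> Rst X (k \<cdot> j))"
      by simp
    also have "\<dots> = Rst X j \<cdot> Rst X (k \<cdot> j)"
      using D by (intro Comp_extend1) auto
    also have "\<dots> = Rst X (k \<cdot> j)"
      using R2[of j "k \<cdot> j"] Rst_Comp_absorb[of k j] D by simp
    finally show ?thesis .
  qed
  ultimately show ?thesis
    using D by (simp add: partial_inverse_def)
qed

lemma partial_inverse_iso:
  assumes "f \<in> Arr X" "g \<in> Arr X" "Dom X g = Cod X f" "Cod X g = Dom X f"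
    "g \<cdot> f = Idn X (Dom X f)" "f \<cdot> g = Idn X (Cod X f)"
  shows "partial_inverse X f g"
  using assms total_cancel[of f g] by (simp add: partial_inverse_def total_def)

end

section \<open>Ranges and splittings of restriction idempotents\<close>

context split_range_category
begin

lemma Rng_Arr [simp]: "f \<in> Arr X \<Longrightarrow> Rng X f \<in> Arr X"
  and Dom_Rng [simp]: "f \<in> Arr X \<Longrightarrow> Dom X (Rng X f) = Cod X f"
  and Cod_Rng [simp]: "f \<in> Arr X \<Longrightarrow> Cod X (Rng X f) = Cod X f"
  using Rng_hom by (auto simp: hom_def)

lemma Rng_Comp_full:
  assumes "g \<in> Arr X" "f \<in> Arr X" "Dom X g = Cod X f" "Rng X f = Idn X (Cod X f)"
  shows "Rng X (g \<cdot> f) = Rng X g"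
  using RR4[of g f] assms by (simp add: seq_def)

text \<open>RR2 says that \<open>Rng X r\<close> fixes \<open>r\<close>; precomposing with the
  section \<open>m\<close> leaves only \<open>Rng X r\<close> on one side and an identity on the
  other.\<close>

lemma Rng_retraction:
  assumes "r \<in> Arr X" "m \<in> Arr X" "Dom X r = Cod X m" "r \<cdot> m = Idn X (Cod X r)"
  shows "Rng X r = Idn X (Cod X r)"
proof -
  have "Rng X r = Rng X r \<cdot> (r \<cdot> m)"
    using assms by simp
  also have "\<dots> = r \<cdot> m"
    using RR2[of r] Comp_extend1[of "Rng X r" r r m] assms by simp
  finally show ?thesis using assms by simp
qed

lemma Rng_Idn [simp]: "a \<in> Ob X \<Longrightarrow> Rng X (Idn X a) = Idn X a"
  using RR2[of "Idn X a"] by simp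

lemma Rng_Rst: "g \<in> Arr X \<Longrightarrow> Rng X (Rst X g) = Rst X g"
  using RR3[of g "Idn X (Dom X g)"] by (simp add: seq_def)

text \<open>As a retraction, \<open>j\<close> has full range, so \<open>m\<close> has the same range
  as \<open>m \<cdot> j\<close>, which is a restriction idempotent and hence its own range.\<close>

lemma Rng_partial_inverse:
  assumes "partial_inverse X m j"
  shows "Rng X m = m \<cdot> j" "Rng X j = Idn X (Cod X j)"
proof -
  note D = partial_inverseD[OF assms]
  show j: "Rng X j = Idn X (Cod X j)"
    using D by (intro Rng_retraction) auto
  show "Rng X m = m \<cdot> j"
    using Rng_Comp_full[of m j] Rng_Rst[of j] D j by simp
qed

text \<open>Any splitting works: \<open>m\<close> is total because it has a retraction, and then
  \<open>r\<close> has the same restriction as \<open>m \<cdot> r = e\<close>.\<close>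

lemma split_partial_inverse:
  assumes "e \<in> Arr X" "Rst X e = e"
  obtains m r where "partial_inverse X m r" "m \<cdot> r = e" "Cod X m = Dom X e"
proof -
  obtain m r where mr: "m \<in> Arr X" "r \<in> Arr X" "Dom X m = Cod X r" "Dom X r = Cod X m" "e = m \<cdot> r"
    "r \<cdot> m = Idn X (Dom X m)"
    using split[OF assms] by (auto simp: seq_def)
  then have "total X m"
    using total_cancel[of r m] by simp
  then have "m \<cdot> r = Rst X r"
    using Rst_total_Comp[of m r] mr assms(2) by simp
  then have "partial_inverse X m r"
    using mr by (simp add: partial_inverse_def)
  then show ?thesis
    using that mr by simp
qed

text \<open>The image of \<open>f\<close> is obtained by splitting the idempotent
  \<open>Rng X f\<close> as \<open>m \<cdot> j\<close>; the P-part is \<open>j \<cdot> f\<close>.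
  RR4 replaces \<open>f\<close> by its range when the range of \<open>j \<cdot> f\<close> is
  computed, and \<open>j \<cdot> (m \<cdot> j) = j\<close> has full range.\<close>

lemma total_factorization:
  assumes "total X f"
  obtains m j p where "partial_inverse X m j" "total X p" "Rng X p = Idn X (Cod X p)"
    "Dom X m = Cod X p" "f = m \<cdot> p"
proof -
  have f: "f \<in> Arr X"
    using assms by (rule total_Arr)
  then obtain m j where mj: "partial_inverse X m j" "m \<cdot> j = Rng X f" "Cod X m = Cod X f"
    using split_partial_inverse[of "Rng X f"] RR1 by auto
  note D = partial_inverseD[OF mj(1)] f mj(2,3)
  have fac: "m \<cdot> (j \<cdot> f) = f"
    using Comp_extend1[OF mj(2), of f] RR2[of f] D by simp
  have "total X (j \<cdot> f)"
    using total_cancel[of m "j \<cdot> f"] assms fac D by simp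
  moreover have "Rng X (j \<cdot> f) = Idn X (Dom X m)"
  proof -
    have "Rng X (j \<cdot> f) = Rng X (j \<cdot> (m \<cdot> j))"
      using RR4[of j f] D by (simp add: seq_def)
    also have "j \<cdot> (m \<cdot> j) = j"
      using R1[of j] D by simp
    finally show ?thesis
      using Rng_partial_inverse(2)[OF mj(1)] D by simp
  qed
  ultimately show ?thesis
    using D by (intro that[OF mj(1) _ _ _ fac[symmetric]]) auto
qed

section \<open>The stable factorization system of total maps\<close>

lemma Tot_simps [simp]:
  "Ob (Tot X) = Ob X" "f \<in> Arr (Tot X) \<longleftrightarrow> total X f"
  "total X f \<Longrightarrow> Dom (Tot X) f = Dom X f" "total X f \<Longrightarrow> Cod (Tot X) f = Cod X f"
  "Idn (Tot X) = Idn X"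
  "\<lbrakk>total X g; total X f\<rbrakk> \<Longrightarrow> Comp (Tot X) g f = g \<cdot> f"
  by (auto simp: Tot_def)

lemma PCls_Tot: "p \<in> PCls (Tot X) \<longleftrightarrow> total X p \<and> Rng X p = Idn X (Cod X p)"
  by (simp add: Tot_def)

lemma SCls_Tot: "s \<in> SCls (Tot X) \<longleftrightarrow> (\<exists>j. partial_inverse X s j)"
proof
  assume "s \<in> SCls (Tot X)"
  then show "\<exists>j. partial_inverse X s j"
    by (auto simp: Tot_def restricted_iso_def total_def hom_def partial_inverse_def)
next
  assume "\<exists>j. partial_inverse X s j"
  then obtain j where j: "partial_inverse X s j" ..
  note D = partial_inverseD[OF j]
  show "s \<in> SCls (Tot X)"
    using D by (auto simp: Tot_def restricted_iso_def hom_def total_def)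
qed

lemma category_Tot: "category (Tot X)"
proof
  show "Comp (Tot X) g f = undefined" if "\<not> seq (Tot X) g f" for g f
  proof (cases "total X g \<and> total X f")
    case True
    then have "\<not> seq X g f"
      using that by (auto simp: seq_def)
    then show ?thesis
      using True Comp_ext by simp
  qed (auto simp: Tot_def)
qed (auto simp: Tot_def hom_def seq_def total_Arr Idn_ext)

lemma iso_TotD:
  assumes "iso (Tot X) f"
  obtains g where "partial_inverse X f g" "Rng X f = Idn X (Cod X f)" "iso X f"
proof -
  interpret T: category "Tot X" by (rule category_Tot)
  obtain g where g: "total X f" "total X g" "Dom X g = Cod X f" "Cod X g = Dom X f"
    "g \<cdot> f = Idn X (Dom X f)" "f \<cdot> g = Idn X (Cod X f)"
    using T.isoE[OF assms] by auto
  note fg = total_Arr[OF g(1)] total_Arr[OF g(2)] g(3-)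
  then show ?thesis
    using that[of g] partial_inverse_iso[of f g] Rng_retraction[of f g] isoI[of f g] by simp
qed

text \<open>This shows that \<open>j \<cdot> g\<close> is the diagonal required for orthogonality.
  Since \<open>g \<cdot> p\<close> factors through \<open>s\<close>, it is fixed by
  \<open>Rst X j\<close>; RR3 transfers this to its range, which is the range of \<open>g\<close>
  because \<open>p\<close> has full range; RR2 transfers it back to \<open>g\<close>.\<close>

lemma partial_inverse_extend:
  assumes j: "partial_inverse X s j" and p: "total X p" "Rng X p = Idn X (Cod X p)"
    and g: "total X g" "Dom X g = Cod X p" and f: "f \<in> Arr X" "Dom X s = Cod X f" and e: "s \<cdot> f = g \<cdot> p"
  shows "s \<cdot> (j \<cdot> g) = g"
proof -
  note D = partial_inverseD[OF j] total_Arr[OF p(1)] total_Arr[OF g(1)] p g f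
  have "Cod X (s \<cdot> f) = Cod X (g \<cdot> p)"
    using e by simp
  then have c: "Cod X g = Cod X s"
    using D by simp
  have "s \<cdot> (j \<cdot> (g \<cdot> p)) = s \<cdot> (j \<cdot> (s \<cdot> f))"
    using e by simp
  also have "\<dots> = s \<cdot> f"
    using Comp_cancel_L[OF D(5)] D by simp
  finally have "Rst X j \<cdot> (g \<cdot> p) = g \<cdot> p"
    using Comp_extend1[OF D(6), of "g \<cdot> p"] D c e by simp
  then have "Rst X j \<cdot> Rng X (g \<cdot> p) = Rng X (g \<cdot> p)"
    using RR3[of j "g \<cdot> p"] D c by (simp add: seq_def)
  then have *: "Rst X j \<cdot> Rng X g = Rng X g"
    using Rng_Comp_full[of g p] D by simp
  have "s \<cdot> (j \<cdot> g) = Rst X j \<cdot> (Rng X g \<cdot> g)"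
    using Comp_extend1[OF D(6), of g] RR2[of g] D c by simp
  also have "\<dots> = Rng X g \<cdot> g"
    using Comp_extend1[OF *, of g] D c by simp
  finally show ?thesis
    using RR2[of g] D by simp
qed

lemma orthogonal_factorization_system_Tot:
  "orthogonal_factorization_system (Tot X) (PCls (Tot X)) (SCls (Tot X))"
proof -
  interpret T: category "Tot X" by (rule category_Tot)
  show ?thesis
  proof
    show "PCls (Tot X) \<subseteq> Arr (Tot X)" "SCls (Tot X) \<subseteq> Arr (Tot X)"
      by (auto simp: PCls_Tot SCls_Tot dest: partial_inverseD)
    show "f \<in> PCls (Tot X)" "f \<in> SCls (Tot X)" if "iso (Tot X) f" for f
      using that by (auto simp: PCls_Tot SCls_Tot dest: total_iso elim!: iso_TotD)
    show "Comp (Tot X) g f \<in> PCls (Tot X)" if "g \<in> PCls (Tot X)" "f \<in> PCls (Tot X)" "seq (Tot X) g f" for g f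
    proof -
      have *: "total X g" "total X f" "Dom X g = Cod X f" "Rng X f = Idn X (Cod X f)" "Rng X g = Idn X (Cod X g)"
        using that by (auto simp: PCls_Tot seq_def)
      then show ?thesis
        using Rng_Comp_full[of g f] total_Arr by (simp add: PCls_Tot)
    qed
    show "Comp (Tot X) g f \<in> SCls (Tot X)" if gf: "g \<in> SCls (Tot X)" "f \<in> SCls (Tot X)" "seq (Tot X) g f" for g f
    proof -
      obtain j k where jk: "partial_inverse X g j" "partial_inverse X f k"
        using gf by (auto simp: SCls_Tot)
      then show ?thesis
        using partial_inverse_Comp[OF jk] gf(3) partial_inverseD(7)[OF jk(1)] partial_inverseD(7)[OF jk(2)]
        by (auto simp: SCls_Tot seq_def)
    qed
    show "\<exists>s\<in>SCls (Tot X). \<exists>p\<in>PCls (Tot X). seq (Tot X) s p \<and> f = Comp (Tot X) s p" if "f \<in> Arr (Tot X)" for f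
    proof -
      have "total X f"
        using that by simp
      then obtain m j p where mjp: "partial_inverse X m j" "total X p" "Rng X p = Idn X (Cod X p)"
        "Dom X m = Cod X p" "f = m \<cdot> p"
        using total_factorization by metis
      then have "m \<in> SCls (Tot X)" "p \<in> PCls (Tot X)" "seq (Tot X) m p \<and> f = Comp (Tot X) m p"
        using partial_inverseD(7)[OF mjp(1)] by (auto simp: SCls_Tot PCls_Tot seq_def)
      then show ?thesis
        by blast
    qed
    show "\<exists>!d. d \<in> hom (Tot X) (Cod (Tot X) p) (Dom (Tot X) s) \<and> Comp (Tot X) d p = f \<and> Comp (Tot X) s d = g"
      if p: "p \<in> PCls (Tot X)" and s: "s \<in> SCls (Tot X)" and c: "commutes (Tot X) s f g p" for p s f g
    proof -
      obtain j where j: "partial_inverse X s j"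
        using s by (auto simp: SCls_Tot)
      note D = partial_inverseD[OF j]
      have P: "total X p" "Rng X p = Idn X (Cod X p)" "total X f" "total X g" "Dom X s = Cod X f"
        "Dom X g = Cod X p" "s \<cdot> f = g \<cdot> p"
        using p c D by (auto simp: PCls_Tot commutes_def seq_def)
      note A = P(1,3,4)[THEN total_Arr]
      have cod: "Cod X g = Cod X s"
        using Cod_Comp[of s f] Cod_Comp[of g p] A P D by simp
      have sjg: "s \<cdot> (j \<cdot> g) = g"
        using partial_inverse_extend[OF j P(1,2,4,6) A(2) P(5,7)] .
      then have t: "total X (j \<cdot> g)"
        using total_cancel[of s "j \<cdot> g"] P A D cod by simp
      have "j \<cdot> (g \<cdot> p) = j \<cdot> (s \<cdot> f)"
        using P by simp
      also have "\<dots> = f"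
        by (rule Comp_cancel_L[OF D(5)]) (use P(1-6) A D in auto)
      finally have jgp: "j \<cdot> (g \<cdot> p) = f" .
      show ?thesis
      proof (rule ex1I[of _ "j \<cdot> g"])
        show "j \<cdot> g \<in> hom (Tot X) (Cod (Tot X) p) (Dom (Tot X) s) \<and> Comp (Tot X) (j \<cdot> g) p = f \<and>
          Comp (Tot X) s (j \<cdot> g) = g"
          using t sjg jgp P A D cod by (simp add: hom_def)
        fix d
        assume "d \<in> hom (Tot X) (Cod (Tot X) p) (Dom (Tot X) s) \<and> Comp (Tot X) d p = f \<and> Comp (Tot X) s d = g"
        then have d: "total X d" "Cod X d = Dom X s" "s \<cdot> d = g"
          using D by (auto simp: hom_def)
        then show "d = j \<cdot> g"
          using Comp_cancel_L[OF D(5), of d] D total_Arr[OF d(1)] by simp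
      qed
    qed
  qed
qed

text \<open>Pulling \<open>s\<close> back along \<open>f\<close> means splitting the domain of
  definition of \<open>j \<cdot> f\<close>, the preimage of the subobject \<open>s\<close>. The
  mediating morphism of a cone is obtained by applying \<open>k\<close> to its first leg. All
  hypotheses are equational, so functors between split range categories transport them.\<close>

lemma pullback_TotI:
  assumes j: "partial_inverse X s j" and k: "partial_inverse X s' k" and f: "total X f" "total X f'"
    and ty: "Cod X f = Cod X s" "Cod X s' = Dom X f" "Dom X f' = Dom X s'" "Cod X f' = Dom X s"
    and eq: "f \<cdot> s' = s \<cdot> f'" and dom: "s' \<cdot> k = Rst X (j \<cdot> f)"
  shows "pullback (Tot X) f s' s f'"
proof -
  interpret T: category "Tot X" by (rule category_Tot)
  note D = partial_inverseD[OF j] partial_inverseD[OF k] f total_Arr[OF f(1)] total_Arr[OF f(2)] ty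
  show ?thesis
  proof (rule T.pullbackI)
    fix x y
    assume "x \<in> Arr (Tot X)" "y \<in> Arr (Tot X)" "Cod (Tot X) x = Dom (Tot X) f"
      "Cod (Tot X) y = Dom (Tot X) s" "Dom (Tot X) y = Dom (Tot X) x" "Comp (Tot X) f x = Comp (Tot X) s y"
    then have xy: "total X x" "total X y" "Cod X x = Dom X f" "Cod X y = Dom X s" "Dom X y = Dom X x"
      "f \<cdot> x = s \<cdot> y"
      using D by auto
    note A = xy(1,2)[THEN total_Arr]
    have "j \<cdot> (f \<cdot> x) = j \<cdot> (s \<cdot> y)"
      using xy by simp
    then have y: "j \<cdot> (f \<cdot> x) = y"
      using Comp_cancel_L[OF D(5)] A D xy by simp
    have "Rst X (j \<cdot> f) \<cdot> x = x \<cdot> Rst X ((j \<cdot> f) \<cdot> x)"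
      using A D xy by (intro R4) (auto simp: seq_def)
    also have "\<dots> = x"
      using xy(2) y A D xy by (simp add: total_def)
    finally have x: "s' \<cdot> (k \<cdot> x) = x"
      using Comp_extend1[OF dom, of x] D A xy by simp
    have u: "total X (k \<cdot> x)"
      using total_cancel[of s' "k \<cdot> x"] x D A xy by simp
    have "s \<cdot> (f' \<cdot> (k \<cdot> x)) = f \<cdot> (s' \<cdot> (k \<cdot> x))"
      by (rule Comp_extend[OF eq[symmetric]]) (use D A xy in auto)
    also have "\<dots> = s \<cdot> y"
      using x xy by simp
    finally have "j \<cdot> (s \<cdot> (f' \<cdot> (k \<cdot> x))) = j \<cdot> (s \<cdot> y)"
      by simp
    then have "f' \<cdot> (k \<cdot> x) = y"
      using Comp_cancel_L[OF D(5)] D A xy by simp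
    then show "\<exists>u. u \<in> Arr (Tot X) \<and> Dom (Tot X) u = Dom (Tot X) x \<and> Cod (Tot X) u = Dom (Tot X) s' \<and>
      Comp (Tot X) s' u = x \<and> Comp (Tot X) f' u = y"
      using u x D A xy by (intro exI[of _ "k \<cdot> x"]) auto
  next
    fix u v
    assume uv: "u \<in> Arr (Tot X)" "v \<in> Arr (Tot X)" "Cod (Tot X) u = Dom (Tot X) s'"
      "Cod (Tot X) v = Dom (Tot X) s'" "Comp (Tot X) s' u = Comp (Tot X) s' v"
    then have "s' \<cdot> u = s' \<cdot> v"
      using D by simp
    moreover have "k \<cdot> (s' \<cdot> u) = u" "k \<cdot> (s' \<cdot> v) = v"
      using Comp_cancel_L[OF D(12)] uv(1-4) D by (simp_all add: total_Arr)
    ultimately show "u = v"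
      by metis
  qed (use D eq in auto)
qed

lemma pullback_Tot_ex:
  assumes j: "partial_inverse X s j" and f: "total X f" "Cod X f = Cod X s"
  obtains m r where "partial_inverse X m r" "m \<cdot> r = Rst X (j \<cdot> f)" "Cod X m = Dom X f"
    "pullback (Tot X) f m s (j \<cdot> (f \<cdot> m))"
proof -
  note D = partial_inverseD[OF j] f total_Arr[OF f(1)]
  obtain m r where mr: "partial_inverse X m r" "m \<cdot> r = Rst X (j \<cdot> f)" "Cod X m = Dom X f"
    using split_partial_inverse[of "Rst X (j \<cdot> f)"] D by auto
  note E = partial_inverseD[OF mr(1)]
  \<comment> \<open>R4 turns the domain of \<open>j \<cdot> f\<close> into the statement that
    \<open>f \<cdot> m\<close> is fixed by \<open>Rst X j\<close>, that is, factors through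
    \<open>s\<close>.\<close>
  have "Rst X j \<cdot> f = f \<cdot> (m \<cdot> r)"
    using R4[of j f] mr D by (simp add: seq_def)
  then have "(Rst X j \<cdot> f) \<cdot> m = (f \<cdot> (m \<cdot> r)) \<cdot> m"
    by simp
  then have *: "Rst X j \<cdot> (f \<cdot> m) = f \<cdot> m"
    using D E(1-5) mr(3) by simp
  have eq: "f \<cdot> m = s \<cdot> (j \<cdot> (f \<cdot> m))"
    using Comp_extend1[OF D(6), of "f \<cdot> m"] * D E mr(3) by simp
  have "total X (s \<cdot> (j \<cdot> (f \<cdot> m)))"
    unfolding eq[symmetric] using D E mr(3) by simp
  then have "total X (j \<cdot> (f \<cdot> m))"
    using total_cancel[of s "j \<cdot> (f \<cdot> m)"] D E mr(3) by simp
  then have "pullback (Tot X) f m s (j \<cdot> (f \<cdot> m))"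
    using D E mr eq by (intro pullback_TotI[OF j mr(1)]) auto
  then show ?thesis
    using that mr by blast
qed

text \<open>The converse of \<open>pullback_TotI\<close>. The equation holds for the pullback
  constructed by splitting, and the comparison isomorphism \<open>u\<close> carries it to an
  arbitrary one, whose partial inverse becomes \<open>v \<cdot> r\<close>.\<close>

lemma pullback_TotD:
  assumes pb: "pullback (Tot X) f s' s f'" and j: "partial_inverse X s j"
  obtains k where "partial_inverse X s' k" "s' \<cdot> k = Rst X (j \<cdot> f)" "total X f" "total X f'"
    "Cod X f = Cod X s" "Cod X s' = Dom X f" "Dom X f' = Dom X s'" "Cod X f' = Dom X s" "f \<cdot> s' = s \<cdot> f'"
proof -
  interpret T: category "Tot X" by (rule category_Tot)
  note S = T.pullbackD[OF pb] and D = partial_inverseD[OF j]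
  then have f: "total X f" "total X s'" "total X f'" "Cod X f = Cod X s" "Cod X s' = Dom X f" "Dom X f' = Dom X s'"
    "Cod X f' = Dom X s" "f \<cdot> s' = s \<cdot> f'"
    by auto
  obtain m r where mr: "partial_inverse X m r" "m \<cdot> r = Rst X (j \<cdot> f)" "Cod X m = Dom X f"
    "pullback (Tot X) f m s (j \<cdot> (f \<cdot> m))"
    using pullback_Tot_ex[OF j f(1,4)] .
  note E = partial_inverseD[OF mr(1)] f(1,2,3)[THEN total_Arr]
  note S' = T.pullbackD[OF mr(4)]
  obtain u where u: "iso (Tot X) u" "u \<in> Arr (Tot X)" "Dom (Tot X) u = Dom (Tot X) s'" "Cod (Tot X) u = Dom (Tot X) m"
    "Comp (Tot X) m u = s'" "Comp (Tot X) (j \<cdot> (f \<cdot> m)) u = f'"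
    using T.pullback_compare[OF mr(4) pb] .
  then have u: "total X u" "iso X u" "Dom X u = Dom X s'" "Cod X u = Dom X m"
    "m \<cdot> u = s'" "(j \<cdot> (f \<cdot> m)) \<cdot> u = f'"
    using f E S' by (auto elim: iso_TotD)
  obtain v where v: "v \<in> Arr X" "Dom X v = Cod X u" "Cod X v = Dom X u" "v \<cdot> u = Idn X (Dom X u)"
    "u \<cdot> v = Idn X (Cod X u)"
    using u(2) isoE by metis
  note uA = total_Arr[OF u(1)]
  have "partial_inverse X u v"
    using uA v by (intro partial_inverse_iso) auto
  then have pi: "partial_inverse X s' (v \<cdot> r)"
    using partial_inverse_Comp[OF mr(1)] u by metis
  have "(m \<cdot> u) \<cdot> (v \<cdot> r) = m \<cdot> (u \<cdot> (v \<cdot> r))"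
    using uA v E(1-4) u(4) by simp
  then have "s' \<cdot> (v \<cdot> r) = m \<cdot> (u \<cdot> (v \<cdot> r))"
    unfolding u(5) .
  also have "u \<cdot> (v \<cdot> r) = r"
    using Comp_cancel_L[OF v(5)] v uA E u by simp
  finally have "s' \<cdot> (v \<cdot> r) = Rst X (j \<cdot> f)"
    using mr by simp
  then show ?thesis
    using that[OF pi] f by blast
qed

text \<open>The pullback square yields \<open>j \<cdot> p = p' \<cdot> k\<close> for the partial
  inverses. As \<open>k\<close> and \<open>p\<close> have full range, comparing ranges gives the
  range of \<open>p'\<close> on one side and that of \<open>j\<close>, an identity, on the
  other.\<close>

lemma PCls_Tot_stable:
  assumes s: "s \<in> SCls (Tot X)" and p: "p \<in> PCls (Tot X)" and pb: "pullback (Tot X) p s' s p'"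
  shows "p' \<in> PCls (Tot X)"
proof -
  obtain j where j: "partial_inverse X s j"
    using s by (auto simp: SCls_Tot)
  have p: "total X p" "Rng X p = Idn X (Cod X p)"
    using p by (auto simp: PCls_Tot)
  obtain k where k: "partial_inverse X s' k" "s' \<cdot> k = Rst X (j \<cdot> p)" "total X p'"
    "Cod X p = Cod X s" "Cod X s' = Dom X p" "Dom X p' = Dom X s'" "Cod X p' = Dom X s" "p \<cdot> s' = s \<cdot> p'"
    using pullback_TotD[OF pb j] .
  note D = partial_inverseD[OF j] partial_inverseD[OF k(1)] k(3-7) p total_Arr[OF p(1)] total_Arr[OF k(3)]
  have "j \<cdot> p = (j \<cdot> p) \<cdot> (s' \<cdot> k)"
    using R1[of "j \<cdot> p"] k(2) D by simp
  also have "\<dots> = j \<cdot> ((p \<cdot> s') \<cdot> k)"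
    using D(1-5,8-12) k(3-7) p total_Arr[OF p(1)] by simp
  also have "\<dots> = j \<cdot> (s \<cdot> (p' \<cdot> k))"
    using k D by simp
  also have "\<dots> = p' \<cdot> k"
    by (rule Comp_cancel_L[OF D(5)]) (use D in auto)
  finally have eq: "j \<cdot> p = p' \<cdot> k" .
  have "Rng X (p' \<cdot> k) = Rng X p'"
    using Rng_Comp_full[of p' k] Rng_partial_inverse(2)[OF k(1)] D by simp
  moreover have "Rng X (j \<cdot> p) = Idn X (Dom X s)"
    using Rng_Comp_full[of j p] Rng_partial_inverse(2)[OF j] D by simp
  ultimately show ?thesis
    using eq k by (simp add: PCls_Tot)
qed

lemma stable_fact_Tot: "stable_fact (Tot X)"
proof -
  interpret T: orthogonal_factorization_system "Tot X" "PCls (Tot X)" "SCls (Tot X)"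
    by (rule orthogonal_factorization_system_Tot)
  show ?thesis
  proof
    fix s f
    assume *: "s \<in> SCls (Tot X)" "f \<in> Arr (Tot X)" "Cod (Tot X) f = Cod (Tot X) s"
    then obtain j where j: "partial_inverse X s j"
      by (auto simp: SCls_Tot)
    then have "total X f" "Cod X f = Cod X s"
      using * partial_inverseD(7)[OF j] by simp_all
    then show "\<exists>s' f'. pullback (Tot X) f s' s f'"
      using pullback_Tot_ex[OF j] by metis
  qed (rule PCls_Tot_stable)
qed

end

lemma SR_func_is_func: "SR_func X Y F \<Longrightarrow> is_func X Y F"
  by (simp add: SR_func_def)

locale sr_functor = X: split_range_category X + Y: split_range_category Y + cat_functor X Y F
  for X :: "('o, 'm) rangecat" and Y :: "('p, 'n) rangecat" and F +
  assumes SR_func: "SR_func X Y F"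
begin

lemma FM_Rst [simp]: "f \<in> Arr X \<Longrightarrow> FM F (Rst X f) = Rst Y (FM F f)"
  and FM_Rng [simp]: "f \<in> Arr X \<Longrightarrow> FM F (Rng X f) = Rng Y (FM F f)"
  using SR_func by (auto simp: SR_func_def)

lemma FM_total [simp]: "total X f \<Longrightarrow> total Y (FM F f)"
  using FM_Rst[of f] by (auto simp: total_def simp del: FM_Rst)

lemma FM_partial_inverse: "partial_inverse X s j \<Longrightarrow> partial_inverse Y (FM F s) (FM F j)"
  using FM_Comp[of j s] FM_Comp[of s j] by (auto simp: partial_inverse_def simp del: FM_Comp)

end

lemma sr_functorI:
  assumes "split_range_category X" "split_range_category Y" "SR_func X Y F"
  shows "sr_functor X Y F"
proof -
  interpret X: split_range_category X by fact
  interpret Y: split_range_category Y by fact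
  show ?thesis
    by standard (use assms(3) SR_func_is_func in auto)
qed

lemma split_range_category_category: "split_range_category X \<Longrightarrow> category X"
  by (simp add: split_range_category_def restriction_category_def)

lemma SR_func_id: "split_range_category X \<Longrightarrow> SR_func X X (func_id X)"
proof -
  assume "split_range_category X"
  then interpret split_range_category X .
  show ?thesis
    using is_func_id[OF category_axioms] by (auto simp: SR_func_def)
qed

lemma SR_func_comp:
  assumes "split_range_category X" "split_range_category Y" "split_range_category Z" "SR_func X Y F" "SR_func Y Z G"
  shows "SR_func X Z (func_comp X G F)"
proof -
  interpret F: sr_functor X Y F using assms by (intro sr_functorI)
  interpret G: sr_functor Y Z G using assms by (intro sr_functorI)
  have "is_func X Z (func_comp X G F)"
    using F.is_func G.is_func is_func_comp F.X.category_axioms F.Y.category_axioms G.Y.category_axioms by blast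
  then show ?thesis
    by (auto simp: SR_func_def)
qed

lemma SplitRangeCat_eq:
  "SplitRangeCat = functor_twocat {X. split_range_category X} (\<lambda>X Y. {F. SR_func X Y F}) (\<lambda>X Y. {\<alpha>. SR_ntrans X Y \<alpha>})"
  by (simp add: SplitRangeCat_def functor_twocat_def)

lemma two_category_SplitRangeCat: "two_category SplitRangeCat"
  unfolding SplitRangeCat_eq
proof (rule two_category_ntrans; (unfold mem_Collect_eq)?)
  fix X Y :: "('a, 'b) rangecat" and F
  assume *: "split_range_category X" "split_range_category Y" "SR_func X Y F"
  then interpret F: sr_functor X Y F by (intro sr_functorI)
  show "SR_ntrans X Y (ntrans_id X Y F)"
    using * is_ntrans_id[of X Y F] F.X.category_axioms F.Y.category_axioms F.is_func
    by (auto simp: SR_ntrans_def)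
next
  fix X Y :: "('a, 'b) rangecat" and \<alpha> \<beta>
  assume *: "split_range_category X" "split_range_category Y" "SR_ntrans X Y \<alpha>" "SR_ntrans X Y \<beta>" "Src \<beta> = Tgt \<alpha>"
  interpret X: split_range_category X by fact
  interpret Y: split_range_category Y by fact
  interpret a: nat_trans X Y \<alpha>
    using * X.category_axioms Y.category_axioms by (intro nat_transI) (auto simp: SR_ntrans_def)
  interpret b: nat_trans X Y \<beta>
    using * X.category_axioms Y.category_axioms by (intro nat_transI) (auto simp: SR_ntrans_def)
  show "SR_ntrans X Y (ntrans_vcomp X Y \<beta> \<alpha>)"
    using * is_ntrans_vcomp[of X Y \<alpha> \<beta>] X.category_axioms Y.category_axioms
    by (auto simp: SR_ntrans_def)
next
  fix X Y Z :: "('a, 'b) rangecat" and \<alpha> \<beta>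
  assume *: "split_range_category X" "split_range_category Y" "split_range_category Z" "SR_ntrans X Y \<alpha>" "SR_ntrans Y Z \<beta>"
  interpret X: split_range_category X by fact
  interpret Y: split_range_category Y by fact
  interpret Z: split_range_category Z by fact
  have SR: "SR_func X Y (Src \<alpha>)" "SR_func X Y (Tgt \<alpha>)" "SR_func Y Z (Src \<beta>)" "SR_func Y Z (Tgt \<beta>)"
    using * by (auto simp: SR_ntrans_def)
  interpret F: sr_functor Y Z "Src \<beta>" using * SR by (intro sr_functorI)
  interpret a: nat_trans X Y \<alpha>
    using * X.category_axioms Y.category_axioms by (intro nat_transI) (auto simp: SR_ntrans_def)
  interpret b: nat_trans Y Z \<beta>
    using * Z.category_axioms Y.category_axioms by (intro nat_transI) (auto simp: SR_ntrans_def)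
  show "SR_ntrans X Z (ntrans_hcomp X Z \<beta> \<alpha>)"
    using * is_ntrans_hcomp[of X Y Z \<alpha> \<beta>] X.category_axioms Y.category_axioms Z.category_axioms
      SR_func_comp[OF *(1-3) SR(1,3)] SR_func_comp[OF *(1-3) SR(2,4)]
    by (auto simp: SR_ntrans_def)
qed (auto simp: SR_ntrans_def intro: split_range_category_category SR_func_is_func SR_func_comp SR_func_id)

section \<open>The 2-functor of total maps\<close>

lemma FO_Tot_func [simp]: "FO (Tot_func X F) = FO F"
  and FM_Tot_func [simp]: "total X f \<Longrightarrow> FM (Tot_func X F) f = FM F f"
  by (auto simp: Tot_func_def)

lemma Tot_ntrans_simps [simp]:
  "Src (Tot_ntrans X \<alpha>) = Tot_func X (Src \<alpha>)" "Tgt (Tot_ntrans X \<alpha>) = Tot_func X (Tgt \<alpha>)"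
  "Cmp (Tot_ntrans X \<alpha>) = Cmp \<alpha>"
  by (auto simp: Tot_ntrans_def)

text \<open>By \<open>pullback_TotD\<close> and \<open>pullback_TotI\<close> a pullback along S
  amounts to partial inverses and one restriction equation, data which \<open>F\<close>
  preserves.\<close>

lemma SF_func_Tot_func:
  assumes "split_range_category X" "split_range_category Y" "SR_func X Y F"
  shows "SF_func (Tot X) (Tot Y) (Tot_func X F)"
  unfolding SF_func_def
proof (intro conjI ballI allI impI)
  interpret F: sr_functor X Y F using assms by (intro sr_functorI)
  note [simp] = F.X.Tot_simps F.Y.Tot_simps F.X.PCls_Tot F.Y.PCls_Tot F.X.total_Arr
  have ext: "FM (Tot_func X F) f = undefined" if "\<not> total X f" for f
    using that by (simp add: Tot_func_def)
  show "is_func (Tot X) (Tot Y) (Tot_func X F)"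
    by (auto simp: is_func_def seq_def PiE_def extensional_def F.FO_undefined ext)
  show "FM (Tot_func X F) ` PCls (Tot X) \<subseteq> PCls (Tot Y)"
    using F.FM_Rng by (auto simp del: F.FM_Rng simp flip: F.FM_Rng)
  show "FM (Tot_func X F) ` SCls (Tot X) \<subseteq> SCls (Tot Y)"
    using F.FM_partial_inverse F.X.partial_inverseD(7) by (fastforce simp: F.X.SCls_Tot F.Y.SCls_Tot)
  fix s f s' f'
  assume s: "s \<in> SCls (Tot X)" and pb: "pullback (Tot X) f s' s f'"
  obtain j where j: "partial_inverse X s j"
    using s by (auto simp: F.X.SCls_Tot)
  obtain k where k: "partial_inverse X s' k" "s' \<cdot>\<^bsub>X\<^esub> k = Rst X (j \<cdot>\<^bsub>X\<^esub> f)" "total X f" "total X f'"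
    "Cod X f = Cod X s" "Cod X s' = Dom X f" "Dom X f' = Dom X s'" "Cod X f' = Dom X s" "f \<cdot>\<^bsub>X\<^esub> s' = s \<cdot>\<^bsub>X\<^esub> f'"
    using F.X.pullback_TotD[OF pb j] .
  note D = F.X.partial_inverseD[OF j] F.X.partial_inverseD[OF k(1)] F.X.total_Arr[OF k(3)] F.X.total_Arr[OF k(4)]
  have "pullback (Tot Y) (FM F f) (FM F s') (FM F s) (FM F f')"
  proof (rule F.Y.pullback_TotI[OF F.FM_partial_inverse[OF j] F.FM_partial_inverse[OF k(1)]])
    show "FM F f \<cdot>\<^bsub>Y\<^esub> FM F s' = FM F s \<cdot>\<^bsub>Y\<^esub> FM F f'"
      by (rule F.FM_eq) (use k D in auto)
    have "FM F s' \<cdot>\<^bsub>Y\<^esub> FM F k = FM F (Rst X (j \<cdot>\<^bsub>X\<^esub> f))"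
      by (rule F.FM_eq1) (use k D in auto)
    then show "FM F s' \<cdot>\<^bsub>Y\<^esub> FM F k = Rst Y (FM F j \<cdot>\<^bsub>Y\<^esub> FM F f)"
      using k D by simp
  qed (use k D in auto)
  then show "pullback (Tot Y) (FM (Tot_func X F) f) (FM (Tot_func X F) s') (FM (Tot_func X F) s) (FM (Tot_func X F) f')"
    using k D by simp
qed

text \<open>The square at \<open>s\<close> is a pullback because naturality also holds at the
  partial inverse \<open>j\<close>, which need not be total. With total components it identifies the
  restriction required by \<open>pullback_TotI\<close> with that of
  \<open>FM (Src \<alpha>) j\<close>.\<close>

lemma SF_ntrans_Tot_ntrans:
  assumes "split_range_category X" "split_range_category Y" and \<alpha>: "SR_ntrans X Y \<alpha>"
  shows "SF_ntrans (Tot X) (Tot Y) (Tot_ntrans X \<alpha>)"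
  unfolding SF_ntrans_def
proof (intro conjI ballI)
  have SR: "SR_func X Y (Src \<alpha>)" "SR_func X Y (Tgt \<alpha>)"
    using \<alpha> by (auto simp: SR_ntrans_def)
  interpret F: sr_functor X Y "Src \<alpha>" using assms SR by (intro sr_functorI)
  interpret G: sr_functor X Y "Tgt \<alpha>" using assms SR by (intro sr_functorI)
  interpret a: nat_trans X Y \<alpha>
    using \<alpha> F.X.category_axioms F.Y.category_axioms by (intro nat_transI) (auto simp: SR_ntrans_def)
  have tot: "total Y (Cmp \<alpha> a)" if "a \<in> Ob X" for a
    using \<alpha> that by (simp add: SR_ntrans_def)
  note [simp] = F.X.Tot_simps F.Y.Tot_simps F.X.total_Arr
  show SF: "SF_func (Tot X) (Tot Y) (Src (Tot_ntrans X \<alpha>))" "SF_func (Tot X) (Tot Y) (Tgt (Tot_ntrans X \<alpha>))"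
    using SF_func_Tot_func[OF assms(1,2)] SR by auto
  show "is_ntrans (Tot X) (Tot Y) (Tot_ntrans X \<alpha>)"
    using SF[THEN SF_func_is_func] tot a.naturality
    by (auto simp: is_ntrans_def hom_def extensional_def a.Cmp_undefined)
  fix s
  assume "s \<in> SCls (Tot X)"
  then obtain j where j: "partial_inverse X s j"
    by (auto simp: F.X.SCls_Tot)
  note D = F.X.partial_inverseD[OF j]
  have "pullback (Tot Y) (Cmp \<alpha> (Cod X s)) (FM (Src \<alpha>) s) (FM (Tgt \<alpha>) s) (Cmp \<alpha> (Dom X s))"
  proof (rule F.Y.pullback_TotI[OF G.FM_partial_inverse[OF j] F.FM_partial_inverse[OF j]])
    show "Cmp \<alpha> (Cod X s) \<cdot>\<^bsub>Y\<^esub> FM (Src \<alpha>) s = FM (Tgt \<alpha>) s \<cdot>\<^bsub>Y\<^esub> Cmp \<alpha> (Dom X s)"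
      using a.naturality[of s] D by simp
    have "Rst Y (FM (Tgt \<alpha>) j \<cdot>\<^bsub>Y\<^esub> Cmp \<alpha> (Cod X s)) = Rst Y (Cmp \<alpha> (Dom X s) \<cdot>\<^bsub>Y\<^esub> FM (Src \<alpha>) j)"
      using a.naturality[of j] D by simp
    also have "\<dots> = Rst Y (FM (Src \<alpha>) j)"
      using D tot by (intro F.Y.Rst_total_Comp) auto
    also have "\<dots> = FM (Src \<alpha>) s \<cdot>\<^bsub>Y\<^esub> FM (Src \<alpha>) j"
      using F.Y.partial_inverseD(6)[OF F.FM_partial_inverse[OF j]] by simp
    finally show "FM (Src \<alpha>) s \<cdot>\<^bsub>Y\<^esub> FM (Src \<alpha>) j = Rst Y (FM (Tgt \<alpha>) j \<cdot>\<^bsub>Y\<^esub> Cmp \<alpha> (Cod X s))"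
      by simp
  qed (use D tot in auto)
  then show "pullback (Tot Y) (FM (Tgt (Tot_ntrans X \<alpha>)) s) (Cmp (Tot_ntrans X \<alpha>) (Dom (Tot X) s))
    (Cmp (Tot_ntrans X \<alpha>) (Cod (Tot X) s)) (FM (Src (Tot_ntrans X \<alpha>)) s)"
    using D category.pullback_sym[OF F.Y.category_Tot] by simp
qed

lemma two_functor_Total: "two_functor SplitRangeCat StableFact Total"
  unfolding StableFact_eq SplitRangeCat_eq Total_def functor_twocat_simps ntrans_cat_simps
proof (rule two_functor_ntrans[where FF = "\<lambda>X Y. {F. SR_func X Y F}" and NN = "\<lambda>X Y. {\<alpha>. SR_ntrans X Y \<alpha>}"
      and Lf = "\<lambda>X Y. Tot_func X" and Lt = "\<lambda>X Y. Tot_ntrans X"]; (unfold mem_Collect_eq)?)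
  fix X Y :: "('a, 'b) rangecat" and F
  assume *: "split_range_category X" "split_range_category Y" "SR_func X Y F"
  then interpret F: sr_functor X Y F by (intro sr_functorI)
  show "Tot_ntrans X (ntrans_id X Y F) = ntrans_id (Tot X) (Tot Y) (Tot_func X F)"
    by (simp add: Tot_ntrans_def ntrans_id_def F.X.Tot_simps F.Y.Tot_simps)
next
  fix X Y :: "('a, 'b) rangecat" and \<alpha> \<beta>
  assume *: "split_range_category X" "split_range_category Y" "SR_ntrans X Y \<alpha>" "SR_ntrans X Y \<beta>"
  interpret X: split_range_category X by fact
  interpret Y: split_range_category Y by fact
  show "Tot_ntrans X (ntrans_vcomp X Y \<beta> \<alpha>) = ntrans_vcomp (Tot X) (Tot Y) (Tot_ntrans X \<beta>) (Tot_ntrans X \<alpha>)"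
    using * by (auto simp: Tot_ntrans_def ntrans_vcomp_def X.Tot_simps Y.Tot_simps SR_ntrans_def fun_eq_iff)
next
  fix X :: "('a, 'b) rangecat"
  assume *: "split_range_category X"
  interpret X: split_range_category X by fact
  show "Tot_func X (func_id X) = func_id (Tot X)"
    by (auto simp: Tot_func_def func_id_def X.Tot_simps X.total_Arr fun_eq_iff)
next
  fix X Y Z :: "('a, 'b) rangecat" and F G
  assume *: "split_range_category X" "split_range_category Y" "split_range_category Z" "SR_func X Y F" "SR_func Y Z G"
  then interpret F: sr_functor X Y F by (intro sr_functorI)
  show "Tot_func X (func_comp X G F) = func_comp (Tot X) (Tot_func Y G) (Tot_func X F)"
    by (auto simp: Tot_func_def func_comp_def compose_def F.X.Tot_simps F.X.total_Arr fun_eq_iff)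
next
  fix X Y Z :: "('a, 'b) rangecat" and \<alpha> \<beta>
  assume *: "split_range_category X" "split_range_category Y" "split_range_category Z"
    "SR_ntrans X Y \<alpha>" "SR_ntrans Y Z \<beta>"
  interpret Z: split_range_category Z by fact
  have SR: "SR_func X Y (Src \<alpha>)" "SR_func X Y (Tgt \<alpha>)" "SR_func Y Z (Src \<beta>)" "SR_func Y Z (Tgt \<beta>)"
    using * by (auto simp: SR_ntrans_def)
  interpret F: sr_functor X Y "Src \<alpha>" using * SR by (intro sr_functorI)
  interpret F': sr_functor X Y "Tgt \<alpha>" using * SR by (intro sr_functorI)
  interpret G: sr_functor Y Z "Src \<beta>" using * SR by (intro sr_functorI)
  have tot: "\<And>a. a \<in> Ob X \<Longrightarrow> total Y (Cmp \<alpha> a)" "\<And>a. a \<in> Ob Y \<Longrightarrow> total Z (Cmp \<beta> a)"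
    using * by (auto simp: SR_ntrans_def)
  have comp: "Tot_func X (func_comp X G F) = func_comp (Tot X) (Tot_func Y G) (Tot_func X F)"
    if "SR_func X Y F" for F :: "('a, 'b, 'a, 'b) func" and G :: "('a, 'b, 'a, 'b) func"
  proof -
    interpret F: sr_functor X Y F using * that by (intro sr_functorI)
    show ?thesis
      by (auto simp: Tot_func_def func_comp_def compose_def F.X.Tot_simps F.X.total_Arr fun_eq_iff)
  qed
  show "Tot_ntrans X (ntrans_hcomp X Z \<beta> \<alpha>) = ntrans_hcomp (Tot X) (Tot Z) (Tot_ntrans Y \<beta>) (Tot_ntrans X \<alpha>)"
    using tot by (auto simp: Tot_ntrans_def ntrans_hcomp_def comp SR F.X.Tot_simps Z.Tot_simps fun_eq_iff)
qed (auto intro: two_category_SplitRangeCat[unfolded SplitRangeCat_eq] two_category_StableFact[unfolded StableFact_eq]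
    SF_func_Tot_func SF_ntrans_Tot_ntrans split_range_category.stable_fact_Tot)

section \<open>Spans modulo the generated congruence\<close>

context stable_fact
begin

lemma SCls_pullback: "pullback C f s' s f' \<Longrightarrow> s \<in> SCls C \<Longrightarrow> s' \<in> SCls C"
  by (rule S_pullback)

lemma SCls_Comp [simp]: "\<lbrakk>g \<in> SCls C; f \<in> SCls C; Dom C g = Cod C f\<rbrakk> \<Longrightarrow> g \<cdot> f \<in> SCls C"
  by (rule S_Comp) (auto simp: seq_def)

lemma PCls_Comp [simp]: "\<lbrakk>g \<in> PCls C; f \<in> PCls C; Dom C g = Cod C f\<rbrakk> \<Longrightarrow> g \<cdot> f \<in> PCls C"
  by (rule P_Comp) (auto simp: seq_def)

lemma Idn_SCls [simp]: "a \<in> Ob C \<Longrightarrow> Idn C a \<in> SCls C"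
  by (simp add: S_iso)

text \<open>Both \<open>s'\<close> and \<open>t'\<close> are pullbacks of S-morphisms and
  \<open>t' \<cdot> w = s'\<close>, so cancellation applies.\<close>

lemma conjugate_SCls:
  assumes "conjugate C c d v w"
  shows "w \<in> SCls C"
proof -
  obtain f s g t s' f' t' g' where
    *: "pullback C f s' s f'" "pullback C g t' t g'" "s \<in> SCls C" "t \<in> SCls C"
      "w \<in> hom C (Dom C s') (Dom C t')" "t' \<cdot> w = s'"
    using assms by (cases c; cases d) (auto simp: conjugate_def cospan_mor_def cospans_def)
  then show ?thesis
    using SCls_pullback[OF *(1)] SCls_pullback[OF *(2)] S_cancel[of t' w] by (auto simp: hom_def)
qed

lemma S_star_SCls: "S_star C \<subseteq> SCls C"
  using conjugate_SCls SCls_pullback by (fastforce simp: S_star_def)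

text \<open>The induction principle for \<open>S_circ\<close>. It is applied to the preimage of the
  corresponding class under a functor and, when S is monic, to the isomorphisms.\<close>

lemma S_circ_least:
  assumes "S_star C \<subseteq> U" "U \<subseteq> SCls C"
    and "\<And>u f u' f'. u \<in> U \<Longrightarrow> pullback C f u' u f' \<Longrightarrow> u' \<in> U"
    and "\<And>p q x y. \<lbrakk>p \<in> PCls C; q \<in> PCls C; x \<in> SCls C; y \<in> U; commutes C x q p y\<rbrakk> \<Longrightarrow> x \<in> U"
  shows "S_circ C \<subseteq> U"
  unfolding S_circ_def
  by (rule Inter_lower) (use assms in \<open>unfold pullback_stable_def mem_Collect_eq, blast\<close>)

lemma S_circ_SCls: "x \<in> S_circ C \<Longrightarrow> x \<in> SCls C"
  using S_circ_least[of "SCls C"] S_star_SCls SCls_pullback by blast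

lemma S_star_S_circ: "S_star C \<subseteq> S_circ C"
  unfolding S_circ_def by blast

lemma S_circ_pullback: "pullback C f u' u f' \<Longrightarrow> u \<in> S_circ C \<Longrightarrow> u' \<in> S_circ C"
  unfolding S_circ_def pullback_stable_def by blast

lemma S_circ_PCls:
  "\<lbrakk>p \<in> PCls C; q \<in> PCls C; x \<in> SCls C; y \<in> S_circ C; commutes C x q p y\<rbrakk> \<Longrightarrow> x \<in> S_circ C"
  unfolding S_circ_def by blast

text \<open>\<open>S_star\<close> asks for pullbacks of conjugates; the conjugate itself is its
  pullback along an identity.\<close>

lemma conjugate_S_circ:
  assumes v: "v \<in> SCls C" "Dom C v = Cod C f" and s: "s \<in> SCls C"
    and pb: "pullback C f s' s f'" "pullback C (v \<cdot> f) t' (v \<cdot> s) g'"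
    and w: "w \<in> Arr C" "Dom C w = Dom C s'" "Cod C w = Dom C t'" "t' \<cdot> w = s'" "g' \<cdot> w = f'"
  shows "w \<in> S_circ C"
proof -
  note D = pullbackD[OF pb(1)]
  have "conjugate C (f, s) (v \<cdot> f, v \<cdot> s) v w"
    using assms D by (auto simp: conjugate_def cospan_mor_def cospans_def hom_def)
  moreover have "pullback C (Idn C (Cod C w)) w w (Idn C (Dom C w))"
    using pullback_sym[OF pullback_trivial[OF w(1)]] .
  ultimately have "w \<in> S_star C"
    using v unfolding S_star_def by blast
  then show ?thesis
    using S_star_S_circ by blast
qed

text \<open>An isomorphism is a conjugate of an identity: the cospan of two identities has both
  \<open>(x, x)\<close> and the pair of identities as pullbacks, and \<open>x\<close> compares the
  two choices.\<close>

lemma iso_S_circ: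
  assumes "iso C x"
  shows "x \<in> S_circ C"
proof -
  have x: "x \<in> Arr C"
    using assms by (simp add: iso_def)
  define i where "i = Idn C (Cod C x)"
  have i: "i \<in> Arr C" "Dom C i = Cod C x" "Cod C i = Cod C x" "i \<cdot> i = i" "i \<cdot> x = x" "i \<in> SCls C"
    using x by (auto simp: i_def)
  have 1: "pullback C i i i i"
    using pullback_trivial[OF i(1)] i by (simp add: i_def[symmetric])
  then have 2: "pullback C i x i x"
    using pullback_iso_Comp[OF 1 assms] i by simp
  show ?thesis
    by (rule conjugate_S_circ[of i i i x x i i x]) (use 1 2 i x in auto)
qed

lemma in_spans: "(s, f) \<in> spans C \<longleftrightarrow> s \<in> SCls C \<and> f \<in> Arr C \<and> Dom C s = Dom C f"
  by (simp add: spans_def)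

lemma zgen_spans: "zgen C \<subseteq> spans C \<times> spans C"
  by (auto simp: zgen_def span_mor_def)

lemma equiv_zrel: "equiv (spans C) (zrel C)"
proof -
  \<comment> \<open>The full relation belongs to the intersected family, which keeps the
    intersection inside the set of pairs of spans.\<close>
  have "equiv (spans C) (spans C \<times> spans C)"
    by (auto simp: equiv_def refl_on_def sym_def trans_def)
  then have "zrel C \<subseteq> spans C \<times> spans C"
    using zgen_spans unfolding zrel_def by blast
  moreover have "refl_on (spans C) (zrel C)"
    by (rule refl_onI) (auto simp: zrel_def equiv_def dest: refl_onD)
  moreover have "sym (zrel C)"
    by (rule symI) (auto simp: zrel_def equiv_def dest: symD)
  moreover have "trans (zrel C)"
  proof (rule transI)
    fix a b c
    assume "(a, b) \<in> zrel C" "(b, c) \<in> zrel C"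
    then have "(a, c) \<in> E" if E: "equiv (spans C) E" "zgen C \<subseteq> E" for E
    proof -
      have "(a, b) \<in> E" "(b, c) \<in> E" "trans E"
        using \<open>(a, b) \<in> zrel C\<close> \<open>(b, c) \<in> zrel C\<close> E unfolding zrel_def equiv_def by blast+
      then show ?thesis
        by (blast intro: transD)
    qed
    then show "(a, c) \<in> zrel C"
      by (simp add: zrel_def)
  qed
  ultimately show ?thesis
    by (simp add: equiv_def)
qed

lemma zgen_zrel: "zgen C \<subseteq> zrel C"
  unfolding zrel_def by blast

text \<open>The kernel of \<open>G\<close> on spans is an equivalence relation. Invariance under
  \<open>S_circ\<close>, which contains the isomorphisms, puts all generators into it, so it
  contains \<open>zrel\<close> by minimality.\<close>

lemma zrel_lift:
  assumes G: "\<And>t g x. \<lbrakk>(t, g) \<in> spans C; x \<in> S_circ C; Dom C t = Cod C x\<rbrakk> \<Longrightarrow> G (t \<cdot> x) (g \<cdot> x) = G t g"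
    and "((s, f), (t, g)) \<in> zrel C"
  shows "G s f = G t g"
proof -
  define E where "E = {((s, f), (t, g)). (s, f) \<in> spans C \<and> (t, g) \<in> spans C \<and> G s f = G t g}"
  have "equiv (spans C) E"
    by (auto simp: E_def equiv_def refl_on_def sym_def trans_def)
  moreover have "zgen C \<subseteq> E"
  proof
    fix z assume "z \<in> zgen C"
    then obtain s f t g x where "z = ((s, f), (t, g))" and x: "span_mor C (s, f) (t, g) x" "iso C x \<or> x \<in> S_circ C"
      by (cases z) (auto simp: zgen_def)
    moreover have "G (t \<cdot> x) (g \<cdot> x) = G t g"
      using x iso_S_circ by (intro G) (auto simp: span_mor_def hom_def)
    ultimately show "z \<in> E"
      by (auto simp: E_def span_mor_def)
  qed
  ultimately have "zrel C \<subseteq> E"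
    unfolding zrel_def by blast
  then show ?thesis
    using assms(2) by (auto simp: E_def)
qed

end

section \<open>Coded classes of spans\<close>

locale coded_stable_fact = stable_fact C for C :: "('o, 'm) factcat" (structure) +
  fixes code :: "('m \<times> 'm) set \<Rightarrow> 'm"
  assumes code: "quotient_coding code"
begin

abbreviation cls :: "'m \<Rightarrow> 'm \<Rightarrow> 'm" where
  "cls s f \<equiv> zcls code C s f"

abbreviation RPC :: "('o, 'm) rangecat" where
  "RPC \<equiv> RP code C"

text \<open>Equivalence classes are equal or disjoint, so the coding, which separates only disjoint
  nonempty sets, is injective on them.\<close>

lemma cls_eq_iff:
  assumes "(s, f) \<in> spans C" "(t, g) \<in> spans C"
  shows "cls s f = cls t g \<longleftrightarrow> ((s, f), (t, g)) \<in> zrel C"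
proof
  assume "((s, f), (t, g)) \<in> zrel C"
  then show "cls s f = cls t g"
    using equiv_class_eq[OF equiv_zrel] by (simp add: zcls_def)
next
  assume eq: "cls s f = cls t g"
  have "(s, f) \<in> zrel C `` {(s, f)}" "(t, g) \<in> zrel C `` {(t, g)}"
    using assms equiv_class_self[OF equiv_zrel] by blast+
  moreover from this have "zrel C `` {(s, f)} \<inter> zrel C `` {(t, g)} \<noteq> {}"
    using eq code unfolding quotient_coding_def zcls_def by (metis empty_iff)
  ultimately show "((s, f), (t, g)) \<in> zrel C"
    using equiv_zrel by (meson equiv_def disjoint_iff Image_singleton_iff symE transE)
qed

lemma cls_eqI:
  assumes "(t, g) \<in> spans C" "x \<in> S_circ C" "Dom C t = Cod C x"
  shows "cls (t \<cdot> x) (g \<cdot> x) = cls t g"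
proof -
  have x: "x \<in> SCls C"
    using assms(2) by (rule S_circ_SCls)
  have "span_mor C (t \<cdot> x, g \<cdot> x) (t, g) x"
    using assms x by (auto simp: span_mor_def in_spans hom_def)
  then have "((t \<cdot> x, g \<cdot> x), (t, g)) \<in> zgen C" "(t \<cdot> x, g \<cdot> x) \<in> spans C"
    using assms by (auto simp: zgen_def span_mor_def)
  then show ?thesis
    using zgen_zrel assms(1) by (subst cls_eq_iff) auto
qed

lemma cls_lift:
  assumes G: "\<And>t g x. \<lbrakk>(t, g) \<in> spans C; x \<in> S_circ C; Dom C t = Cod C x\<rbrakk> \<Longrightarrow> G (t \<cdot> x) (g \<cdot> x) = G t g"
    and "(s, f) \<in> spans C" "(t, g) \<in> spans C" "cls s f = cls t g"
  shows "G s f = G t g"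
  using zrel_lift[of G, OF G] assms cls_eq_iff by blast

lemma cls_Cod:
  assumes "(s, f) \<in> spans C" "(t, g) \<in> spans C" "cls s f = cls t g"
  shows "Cod C s = Cod C t" "Cod C f = Cod C g"
proof -
  have *: "x \<in> Arr C" if "x \<in> S_circ C" for x
    using S_circ_SCls[OF that] by simp
  show "Cod C s = Cod C t" "Cod C f = Cod C g"
    by (rule cls_lift[OF _ assms, where G = "\<lambda>s f. Cod C s"] cls_lift[OF _ assms, where G = "\<lambda>s f. Cod C f"];
        use * in \<open>auto simp: in_spans\<close>)+
qed

lemma Ob_RP [simp]: "Ob RPC = Ob C"
  by (simp add: RP_def)

lemma Arr_RP [simp]: "(s, f) \<in> spans C \<Longrightarrow> cls s f \<in> Arr RPC"
  by (auto simp: RP_def RP_Arr_def)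

lemma Arr_RPE:
  assumes "k \<in> Arr RPC"
  obtains s f where "s \<in> SCls C" "f \<in> Arr C" "Dom C s = Dom C f" "(s, f) \<in> spans C" "k = cls s f"
  using assms by (auto simp: RP_def RP_Arr_def in_spans)

lemma RP_Arr_cls: "(s, f) \<in> spans C \<Longrightarrow> cls s f \<in> RP_Arr code C"
  by (auto simp: RP_Arr_def)

lemma Dom_RP [simp]: "(s, f) \<in> spans C \<Longrightarrow> Dom RPC (cls s f) = Cod C s"
  unfolding RP_def by (auto simp: RP_Arr_cls intro!: the_equality dest: cls_Cod)

lemma Cod_RP [simp]: "(s, f) \<in> spans C \<Longrightarrow> Cod RPC (cls s f) = Cod C f"
  unfolding RP_def by (auto simp: RP_Arr_cls intro!: the_equality dest: cls_Cod)

lemma Idn_RP [simp]: "a \<in> Ob C \<Longrightarrow> Idn RPC a = cls (Idn C a) (Idn C a)"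
  by (simp add: RP_def)

section \<open>Composition of span classes\<close>

lemma cls_pullback_indep:
  assumes sp: "(s, f) \<in> spans C" "(t, g) \<in> spans C"
    and pb: "pullback C f t' t f'" "pullback C f t'' t f''"
  shows "cls (s \<cdot> t'') (g \<cdot> f'') = cls (s \<cdot> t') (g \<cdot> f')"
proof -
  note D = pullbackD[OF pb(1)]
  have s: "s \<in> SCls C" "t \<in> SCls C" "g \<in> Arr C" "Dom C s = Dom C f" "Dom C t = Dom C g"
    using sp by (auto simp: in_spans)
  have t': "t' \<in> SCls C"
    using SCls_pullback[OF pb(1)] s by simp
  obtain u where u: "iso C u" "u \<in> Arr C" "Dom C u = Dom C t''" "Cod C u = Dom C t'" "t' \<cdot> u = t''" "f' \<cdot> u = f''"
    using pullback_compare[OF pb] .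
  have "cls ((s \<cdot> t') \<cdot> u) ((g \<cdot> f') \<cdot> u) = cls (s \<cdot> t') (g \<cdot> f')"
    by (rule cls_eqI) (use D s t' u iso_S_circ in \<open>auto simp: in_spans\<close>)
  then show ?thesis
    using D s t' u by simp
qed

text \<open>Composition as a function of representatives, in which only the choice of the pullback
  has been eliminated. The value \<open>undefined\<close> on non-composable spans makes it a
  function of arbitrary spans, so that \<open>cls_lift\<close> applies in each argument
  separately.\<close>

definition span_comp :: "'m \<Rightarrow> 'm \<Rightarrow> 'm \<Rightarrow> 'm \<Rightarrow> 'm" where
  "span_comp t g s f = (if Cod C f = Cod C t
     then THE n. \<exists>t' f'. pullback C f t' t f' \<and> n = cls (s \<cdot> t') (g \<cdot> f') else undefined)"

lemma span_comp_eq: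
  assumes sp: "(s, f) \<in> spans C" "(t, g) \<in> spans C" and pb: "pullback C f t' t f'"
  shows "span_comp t g s f = cls (s \<cdot> t') (g \<cdot> f')"
proof -
  have "Cod C f = Cod C t"
    using pullbackD[OF pb] by simp
  moreover have "(THE n. \<exists>t' f'. pullback C f t' t f' \<and> n = cls (s \<cdot> t') (g \<cdot> f')) = cls (s \<cdot> t') (g \<cdot> f')"
    using pb cls_pullback_indep[OF sp pb] by (intro the_equality) blast+
  ultimately show ?thesis
    by (simp add: span_comp_def)
qed

text \<open>The pullback \<open>x'\<close> of \<open>x\<close> along \<open>t'\<close> lies in
  \<open>S_circ\<close> by pullback stability. Pasting shows that the composite formed with
  \<open>s \<cdot> x\<close> and \<open>f \<cdot> x\<close> is the original one precomposed with
  \<open>x'\<close>.\<close>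

lemma span_comp_cong_right:
  assumes sp: "(t, g) \<in> spans C" "(s, f) \<in> spans C" and x: "x \<in> S_circ C" "Dom C s = Cod C x"
  shows "span_comp t g (s \<cdot> x) (f \<cdot> x) = span_comp t g s f"
proof (cases "Cod C f = Cod C t")
  case True
  have s: "s \<in> SCls C" "t \<in> SCls C" "f \<in> Arr C" "g \<in> Arr C" "Dom C s = Dom C f" "Dom C t = Dom C g" "x \<in> SCls C"
    using sp x by (auto simp: in_spans S_circ_SCls)
  obtain t' f' where pb: "pullback C f t' t f'"
    using S_pullbacks[of t f] s True by blast
  note D = pullbackD[OF pb]
  have t': "t' \<in> SCls C"
    using SCls_pullback[OF pb] s by simp
  obtain x' t'' where pb': "pullback C t' x' x t''"
    using S_pullbacks[of x t'] s D t' x by auto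
  note D' = pullbackD[OF pb']
  have x': "x' \<in> S_circ C"
    using S_circ_pullback[OF pb'] x by simp
  have pb'': "pullback C (f \<cdot> x) t'' t (f' \<cdot> x')"
    by (rule pullback_paste[OF pb pullback_sym[OF pb']])
  have "(s \<cdot> x, f \<cdot> x) \<in> spans C"
    using s x by (auto simp: in_spans)
  then have "span_comp t g (s \<cdot> x) (f \<cdot> x) = cls ((s \<cdot> x) \<cdot> t'') (g \<cdot> (f' \<cdot> x'))"
    using span_comp_eq sp(1) pb'' by blast
  also have "(s \<cdot> x) \<cdot> t'' = (s \<cdot> t') \<cdot> x'"
    using s x D D' by simp
  also have "g \<cdot> (f' \<cdot> x') = (g \<cdot> f') \<cdot> x'"
    using s x D D' by simp
  also have "cls ((s \<cdot> t') \<cdot> x') ((g \<cdot> f') \<cdot> x') = cls (s \<cdot> t') (g \<cdot> f')"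
    by (rule cls_eqI) (use s x x' t' D D' in \<open>auto simp: in_spans\<close>)
  also have "\<dots> = span_comp t g s f"
    using span_comp_eq[OF sp(2,1) pb] by simp
  finally show ?thesis .
next
  case False
  then show ?thesis
    using S_circ_SCls[OF x(1)] sp x(2) by (auto simp: span_comp_def in_spans)
qed

text \<open>As before, but \<open>y\<close> is pulled back along the other projection
  \<open>f'\<close>, and the squares are pasted in the other direction.\<close>

lemma span_comp_cong_left:
  assumes sp: "(t, g) \<in> spans C" "(s, f) \<in> spans C" and y: "y \<in> S_circ C" "Dom C t = Cod C y"
  shows "span_comp (t \<cdot> y) (g \<cdot> y) s f = span_comp t g s f"
proof (cases "Cod C f = Cod C t")
  case True
  have s: "s \<in> SCls C" "t \<in> SCls C" "f \<in> Arr C" "g \<in> Arr C" "Dom C s = Dom C f" "Dom C t = Dom C g" "y \<in> SCls C"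
    using sp y by (auto simp: in_spans S_circ_SCls)
  obtain t' f' where pb: "pullback C f t' t f'"
    using S_pullbacks[of t f] s True by blast
  note D = pullbackD[OF pb]
  have t': "t' \<in> SCls C"
    using SCls_pullback[OF pb] s by simp
  obtain y' f'' where pb': "pullback C f' y' y f''"
    using S_pullbacks[of y f'] s D y by auto
  note D' = pullbackD[OF pb']
  have y': "y' \<in> S_circ C"
    using S_circ_pullback[OF pb'] y by simp
  have pb'': "pullback C f (t' \<cdot> y') (t \<cdot> y) f''"
    by (rule pullback_paste_vert[OF pb pb'])
  have "(t \<cdot> y, g \<cdot> y) \<in> spans C"
    using s y by (auto simp: in_spans)
  then have "span_comp (t \<cdot> y) (g \<cdot> y) s f = cls (s \<cdot> (t' \<cdot> y')) ((g \<cdot> y) \<cdot> f'')"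
    using span_comp_eq sp(2) pb'' by blast
  also have "(g \<cdot> y) \<cdot> f'' = (g \<cdot> f') \<cdot> y'"
    using s y D D' by simp
  also have "s \<cdot> (t' \<cdot> y') = (s \<cdot> t') \<cdot> y'"
    using s y D D' by simp
  also have "cls ((s \<cdot> t') \<cdot> y') ((g \<cdot> f') \<cdot> y') = cls (s \<cdot> t') (g \<cdot> f')"
    by (rule cls_eqI) (use s y y' t' D D' in \<open>auto simp: in_spans\<close>)
  also have "\<dots> = span_comp t g s f"
    using span_comp_eq[OF sp(2,1) pb] by simp
  finally show ?thesis .
next
  case False
  then show ?thesis
    using S_circ_SCls[OF y(1)] sp y(2) by (auto simp: span_comp_def in_spans)
qed

lemma span_comp_cls:
  assumes "(t, g) \<in> spans C" "(s, f) \<in> spans C" "(t', g') \<in> spans C" "(s', f') \<in> spans C"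
    "cls t g = cls t' g'" "cls s f = cls s' f'"
  shows "span_comp t g s f = span_comp t' g' s' f'"
proof -
  have "span_comp t g s f = span_comp t g s' f'"
    by (rule cls_lift[OF _ assms(2,4,6), where G = "span_comp t g"]) (use assms span_comp_cong_right in auto)
  also have "\<dots> = span_comp t' g' s' f'"
    by (rule cls_lift[OF _ assms(1,3,5), where G = "\<lambda>t g. span_comp t g s' f'"])
      (use assms span_comp_cong_left in auto)
  finally show ?thesis .
qed

lemma Comp_RP:
  assumes sp: "(s, f) \<in> spans C" "(t, g) \<in> spans C" and pb: "pullback C f t' t f'"
  shows "Comp RPC (cls t g) (cls s f) = cls (s \<cdot> t') (g \<cdot> f')"
proof -
  have "Cod C f = Cod C t"
    using pullbackD[OF pb] by simp
  then have "\<exists>s' f' t' g'. (s', f') \<in> spans C \<and> (t', g') \<in> spans C \<and>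
            cls s f = cls s' f' \<and> cls t g = cls t' g' \<and> Cod C f' = Cod C t'"
    using sp by blast
  moreover have "(THE n. \<exists>s' f' t' g' t'' f''. (s', f') \<in> spans C \<and> (t', g') \<in> spans C \<and>
            cls s f = cls s' f' \<and> cls t g = cls t' g' \<and> pullback C f' t'' t' f'' \<and>
            n = cls (s' \<cdot> t'') (g' \<cdot> f'')) = cls (s \<cdot> t') (g \<cdot> f')"
  proof (rule the_equality)
    show "\<exists>s' f'a t'a g' t'' f''. (s', f'a) \<in> spans C \<and> (t'a, g') \<in> spans C \<and>
            cls s f = cls s' f'a \<and> cls t g = cls t'a g' \<and> pullback C f'a t'' t'a f'' \<and>
            cls (s \<cdot> t') (g \<cdot> f') = cls (s' \<cdot> t'') (g' \<cdot> f'')"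
      using sp pb by blast
    fix n
    assume "\<exists>s' f' t' g' t'' f''. (s', f') \<in> spans C \<and> (t', g') \<in> spans C \<and>
            cls s f = cls s' f' \<and> cls t g = cls t' g' \<and> pullback C f' t'' t' f'' \<and>
            n = cls (s' \<cdot> t'') (g' \<cdot> f'')"
    then obtain s1 f1 t1 g1 t1' f1' where *: "(s1, f1) \<in> spans C" "(t1, g1) \<in> spans C"
      "cls s f = cls s1 f1" "cls t g = cls t1 g1" "pullback C f1 t1' t1 f1'" "n = cls (s1 \<cdot> t1') (g1 \<cdot> f1')"
      by blast
    then show "n = cls (s \<cdot> t') (g \<cdot> f')"
      using span_comp_cls[OF sp(2,1) *(2,1,4,3)] span_comp_eq[OF sp pb] span_comp_eq[OF *(1,2,5)] by simp
  qed
  ultimately show ?thesis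
    by (simp add: RP_def)
qed

lemma Comp_RPE:
  assumes sp: "(s, f) \<in> spans C" "(t, g) \<in> spans C" and "Cod C f = Cod C t"
  obtains t' f' where "pullback C f t' t f'" "t' \<in> SCls C" "Comp RPC (cls t g) (cls s f) = cls (s \<cdot> t') (g \<cdot> f')"
    "(s \<cdot> t', g \<cdot> f') \<in> spans C"
proof -
  obtain t' f' where pb: "pullback C f t' t f'"
    using S_pullbacks[of t f] assms by (auto simp: in_spans)
  have "t' \<in> SCls C"
    using SCls_pullback[OF pb] sp by (auto simp: in_spans)
  moreover from this have "(s \<cdot> t', g \<cdot> f') \<in> spans C"
    using sp pullbackD[OF pb] by (auto simp: in_spans)
  ultimately show ?thesis
    using that[OF pb] Comp_RP[OF sp pb] by blast
qed

text \<open>Composing after a graph \<open>[1, g]\<close>, or before a reversed S-morphism as in the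
  next lemma, needs only the trivial pullback along an identity. Many later computations are
  arranged to use these two cases.\<close>

lemma Comp_RP_graph:
  assumes "(s, f) \<in> spans C" "g \<in> Arr C" "Cod C f = b" "Dom C g = b"
  shows "Comp RPC (cls (Idn C b) g) (cls s f) = cls s (g \<cdot> f)"
proof -
  have *: "s \<in> SCls C" "f \<in> Arr C" "Dom C s = Dom C f" "b \<in> Ob C"
    using assms by (auto simp: in_spans)
  have "pullback C f (Idn C (Dom C f)) (Idn C b) f"
    using pullback_trivial[of f] assms * by simp
  then show ?thesis
    using assms(1) by (subst Comp_RP) (use assms * in \<open>auto simp: in_spans\<close>)
qed

lemma Comp_RP_cograph:
  assumes "(t, g) \<in> spans C" "s \<in> SCls C" "Dom C s = b" "Cod C t = b"
  shows "Comp RPC (cls t g) (cls s (Idn C b)) = cls (s \<cdot> t) g"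
proof -
  have *: "t \<in> SCls C" "g \<in> Arr C" "Dom C t = Dom C g" "b \<in> Ob C"
    using assms by (auto simp: in_spans)
  have "pullback C (Idn C b) t t (Idn C (Dom C t))"
    using pullback_sym[OF pullback_trivial[of t]] assms * by simp
  then show ?thesis
    using assms(1) by (subst Comp_RP) (use assms * in \<open>auto simp: in_spans\<close>)
qed

text \<open>
  The comparison between the two pullbacks below is the conjugate of \<open>v\<close>, so it lies in \<^term>\<open>S_circ C\<close>.
  All restriction and range identities that do not hold for spans on the nose are instances.
\<close>

lemma Comp_RP_cancel:
  assumes v: "v \<in> SCls C" "Dom C v = Cod C f" "Dom C v = Cod C s"
    and sp: "(a, f) \<in> spans C" "(s, b) \<in> spans C"
  shows "Comp RPC (cls (v \<cdot> s) b) (cls a (v \<cdot> f)) = Comp RPC (cls s b) (cls a f)"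
proof -
  have *: "a \<in> SCls C" "f \<in> Arr C" "Dom C a = Dom C f" "s \<in> SCls C" "b \<in> Arr C" "Dom C s = Dom C b"
    using sp by (auto simp: in_spans)
  have sp': "(a, v \<cdot> f) \<in> spans C" "(v \<cdot> s, b) \<in> spans C"
    using v * by (auto simp: in_spans)
  obtain s' f' where 1: "pullback C f s' s f'" "s' \<in> SCls C" "Comp RPC (cls s b) (cls a f) = cls (a \<cdot> s') (b \<cdot> f')"
    using Comp_RPE[OF sp] v by metis
  obtain t' g' where 2: "pullback C (v \<cdot> f) t' (v \<cdot> s) g'" "t' \<in> SCls C"
    "Comp RPC (cls (v \<cdot> s) b) (cls a (v \<cdot> f)) = cls (a \<cdot> t') (b \<cdot> g')"
    "(a \<cdot> t', b \<cdot> g') \<in> spans C"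
    using Comp_RPE[OF sp'] v * by (metis Cod_Comp S_in_Arr)
  note D = pullbackD[OF 1(1)] pullbackD[OF 2(1)]
  have "(v \<cdot> f) \<cdot> s' = (v \<cdot> s) \<cdot> f'"
    using D v * by simp
  then obtain w where w: "w \<in> Arr C" "Dom C w = Dom C s'" "Cod C w = Dom C t'" "t' \<cdot> w = s'" "g' \<cdot> w = f'"
    using pullback_ex[OF 2(1), of s' f'] D v * by auto
  have "w \<in> S_circ C"
    using conjugate_S_circ[OF v(1,2) *(4) 1(1) 2(1) w] .
  then have "cls ((a \<cdot> t') \<cdot> w) ((b \<cdot> g') \<cdot> w) = cls (a \<cdot> t') (b \<cdot> g')"
    using 2 w D v * by (intro cls_eqI) auto
  moreover have "(a \<cdot> t') \<cdot> w = a \<cdot> s'" "(b \<cdot> g') \<cdot> w = b \<cdot> f'"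
    using w D v * by simp_all
  ultimately show ?thesis
    using 1 2 by simp
qed

lemma category_RP: "category RPC"
proof
  show "Dom RPC \<in> Arr RPC \<rightarrow>\<^sub>E Ob RPC"
  proof (rule PiE_I)
    fix k assume "k \<in> Arr RPC"
    then show "Dom RPC k \<in> Ob RPC" by (elim Arr_RPE) auto
  qed (simp add: RP_def)
  show "Cod RPC \<in> Arr RPC \<rightarrow>\<^sub>E Ob RPC"
  proof (rule PiE_I)
    fix k assume "k \<in> Arr RPC"
    then show "Cod RPC k \<in> Ob RPC" by (elim Arr_RPE) auto
  qed (simp add: RP_def)
  show "Idn RPC \<in> extensional (Ob RPC)"
    by (simp add: RP_def)
  show "Idn RPC a \<in> hom RPC a a" if "a \<in> Ob RPC" for a
  proof -
    have "(Idn C a, Idn C a) \<in> spans C"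
      using that by (simp add: in_spans)
    then show ?thesis
      using that by (simp add: hom_def)
  qed
  show "Comp RPC l k = undefined" if "\<not> seq RPC l k" for l k
  proof -
    have "\<not> (\<exists>s f t g. (s, f) \<in> spans C \<and> (t, g) \<in> spans C \<and> k = cls s f \<and> l = cls t g \<and> Cod C f = Cod C t)"
      using that by (auto simp: seq_def)
    then show ?thesis
      unfolding RP_def by (simp only: rangecat.simps cat.simps if_False)
  qed
  show "Comp RPC l k \<in> hom RPC (Dom RPC k) (Cod RPC l)" if lk: "seq RPC l k" for l k
  proof -
    obtain s f t g where *: "(s, f) \<in> spans C" "(t, g) \<in> spans C" "k = cls s f" "l = cls t g"
      using lk by (auto simp: seq_def elim!: Arr_RPE)
    then have "Cod C f = Cod C t"
      using lk by (simp add: seq_def)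
    then obtain t' f' where **: "pullback C f t' t f'" "t' \<in> SCls C" "Comp RPC (cls t g) (cls s f) = cls (s \<cdot> t') (g \<cdot> f')"
      "(s \<cdot> t', g \<cdot> f') \<in> spans C"
      using Comp_RPE[OF *(1,2)] by metis
    then show ?thesis
      using * pullbackD[OF **(1)] by (auto simp: hom_def in_spans)
  qed
  show "Comp RPC k (Idn RPC (Dom RPC k)) = k" if k: "k \<in> Arr RPC" for k
  proof -
    obtain s f where *: "s \<in> SCls C" "f \<in> Arr C" "Dom C s = Dom C f" "(s, f) \<in> spans C" "k = cls s f"
      using k Arr_RPE by blast
    show ?thesis
      using Comp_RP_cograph[OF *(4), of "Idn C (Cod C s)" "Cod C s"] * by simp
  qed
  show "Comp RPC (Idn RPC (Cod RPC k)) k = k" if k: "k \<in> Arr RPC" for k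
  proof -
    obtain s f where *: "s \<in> SCls C" "f \<in> Arr C" "Dom C s = Dom C f" "(s, f) \<in> spans C" "k = cls s f"
      using k Arr_RPE by blast
    show ?thesis
      using Comp_RP_graph[OF *(4), of "Idn C (Cod C f)" "Cod C f"] * by simp
  qed
  show "Comp RPC (Comp RPC m l) k = Comp RPC m (Comp RPC l k)" if ml: "seq RPC m l" and lk: "seq RPC l k" for m l k
  proof -
    obtain s f where k: "s \<in> SCls C" "f \<in> Arr C" "Dom C s = Dom C f" "(s, f) \<in> spans C" "k = cls s f"
      using lk Arr_RPE by (auto simp: seq_def)
    obtain t g where l: "t \<in> SCls C" "g \<in> Arr C" "Dom C t = Dom C g" "(t, g) \<in> spans C" "l = cls t g"
      using lk Arr_RPE by (auto simp: seq_def)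
    obtain r h where m: "r \<in> SCls C" "h \<in> Arr C" "Dom C r = Dom C h" "(r, h) \<in> spans C" "m = cls r h"
      using ml Arr_RPE by (auto simp: seq_def)
    have c: "Cod C f = Cod C t" "Cod C g = Cod C r"
      using ml lk k l m by (auto simp: seq_def)
    obtain t' f' where 1: "pullback C f t' t f'" "t' \<in> SCls C" "Comp RPC (cls t g) (cls s f) = cls (s \<cdot> t') (g \<cdot> f')"
      "(s \<cdot> t', g \<cdot> f') \<in> spans C"
      using Comp_RPE[OF k(4) l(4) c(1)] .
    obtain r' g' where 2: "pullback C g r' r g'" "r' \<in> SCls C" "Comp RPC (cls r h) (cls t g) = cls (t \<cdot> r') (h \<cdot> g')"
      "(t \<cdot> r', h \<cdot> g') \<in> spans C"
      using Comp_RPE[OF l(4) m(4) c(2)] .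
    note D = pullbackD[OF 1(1)] pullbackD[OF 2(1)]
    \<comment> \<open>One more pullback serves both bracketings: pasted onto the first square it
      gives the pullback of \<open>f\<close> and \<open>t \<cdot> r'\<close>, pasted onto the second
      that of \<open>g \<cdot> f'\<close> and \<open>r\<close>. The two composites then have the
      same legs up to associativity in \<open>C\<close>.\<close>
    obtain r'' f'' where 3: "pullback C f' r'' r' f''"
      using S_pullbacks[of r' f'] D 2(2) l by auto
    note D' = pullbackD[OF 3]
    have "Comp RPC (Comp RPC m l) k = cls (s \<cdot> (t' \<cdot> r'')) ((h \<cdot> g') \<cdot> f'')"
      using Comp_RP[OF k(4) 2(4) pullback_paste_vert[OF 1(1) 3]] k l m 2 by simp
    moreover have "Comp RPC m (Comp RPC l k) = cls ((s \<cdot> t') \<cdot> r'') (h \<cdot> (g' \<cdot> f''))"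
      using Comp_RP[OF 1(4) m(4) pullback_paste[OF 2(1) 3]] k l m 1 by simp
    ultimately show ?thesis
      using k l m D D' by simp
  qed
qed

section \<open>Restriction and range of span classes\<close>

lemma Rst_RP [simp]:
  assumes "(s, f) \<in> spans C"
  shows "Rst RPC (cls s f) = cls s s"
proof -
  have "cls s s = cls t t" if "(t, g) \<in> spans C" "cls s f = cls t g" for t g
    by (rule cls_lift[OF _ assms that, where G = "\<lambda>s f. cls s s"]) (auto intro!: cls_eqI simp: in_spans)
  then have "(THE n. \<exists>t g. (t, g) \<in> spans C \<and> cls s f = cls t g \<and> n = cls t t) = cls s s"
    using assms by (intro the_equality) (blast, metis)
  then show ?thesis
    unfolding RP_def using assms by (simp add: RP_Arr_cls)
qed

lemma cls_range_unique:
  assumes "m \<in> SCls C" "p \<in> PCls C" "Dom C m = Cod C p" "n \<in> SCls C" "q \<in> PCls C" "Dom C n = Cod C q" "m \<cdot> p = n \<cdot> q"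
  shows "cls m m = cls n n"
proof -
  obtain u where u: "iso C u" "Cod C u = Dom C n" "n \<cdot> u = m"
    using factorization_unique[OF assms] by metis
  then show ?thesis
    using cls_eqI[of n n u] assms iso_S_circ by (simp add: in_spans)
qed

definition span_range :: "'m \<Rightarrow> 'm" where
  "span_range f = (THE n. \<exists>m p. m \<in> SCls C \<and> p \<in> PCls C \<and> Dom C m = Cod C p \<and> f = m \<cdot> p \<and> n = cls m m)"

lemma span_range_eq:
  assumes "m \<in> SCls C" "p \<in> PCls C" "Dom C m = Cod C p"
  shows "span_range (m \<cdot> p) = cls m m"
  unfolding span_range_def
proof (rule the_equality)
  show "\<exists>m' p'. m' \<in> SCls C \<and> p' \<in> PCls C \<and> Dom C m' = Cod C p' \<and> m \<cdot> p = m' \<cdot> p' \<and> cls m m = cls m' m'"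
    using assms by blast
  fix n
  assume "\<exists>m' p'. m' \<in> SCls C \<and> p' \<in> PCls C \<and> Dom C m' = Cod C p' \<and> m \<cdot> p = m' \<cdot> p' \<and> n = cls m' m'"
  then show "n = cls m m"
    using cls_range_unique assms by metis
qed

text \<open>The purpose of the last closure condition on \<open>S_circ\<close>: in
  \<open>p \<cdot> x = n \<cdot> q\<close> it passes membership from \<open>x\<close> to
  \<open>n\<close>. The S-part of \<open>g \<cdot> x\<close> is then \<open>m \<cdot> n\<close>, and
  the classes of \<open>(m \<cdot> n, m \<cdot> n)\<close> and \<open>(m, m)\<close> agree.\<close>

lemma span_range_cong:
  assumes sp: "(t, g) \<in> spans C" and x: "x \<in> S_circ C" "Dom C t = Cod C x"
  shows "span_range (g \<cdot> x) = span_range g"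
proof -
  have *: "t \<in> SCls C" "g \<in> Arr C" "Dom C t = Dom C g" "x \<in> SCls C"
    using sp x by (auto simp: in_spans S_circ_SCls)
  obtain m p where mp: "m \<in> SCls C" "p \<in> PCls C" "Dom C m = Cod C p" "g = m \<cdot> p"
    using factorization[OF *(2)] by (auto simp: seq_def)
  have px: "p \<cdot> x \<in> Arr C" "Dom C p = Cod C x"
    using mp * x by auto
  obtain n q where nq: "n \<in> SCls C" "q \<in> PCls C" "Dom C n = Cod C q" "p \<cdot> x = n \<cdot> q"
    using factorization[OF px(1)] by (auto simp: seq_def)
  have n: "n \<in> S_circ C"
    using nq mp px x * by (intro S_circ_PCls[of p q n x]) (auto simp: commutes_def seq_def)
  have nm: "Dom C m = Cod C n"
    using Cod_Comp[of p x] Cod_Comp[of n q] nq mp px * by simp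
  have "g \<cdot> x = (m \<cdot> n) \<cdot> q"
    using mp nq(1-3) px * nm nq(4) by simp
  then have "span_range (g \<cdot> x) = cls (m \<cdot> n) (m \<cdot> n)"
    using span_range_eq[of "m \<cdot> n" q] mp nq nm by simp
  also have "\<dots> = cls m m"
    using mp n nm by (intro cls_eqI) (auto simp: in_spans)
  also have "\<dots> = span_range g"
    using span_range_eq mp by simp
  finally show ?thesis .
qed

lemma Rng_RP:
  assumes sp: "(s, m \<cdot> p) \<in> spans C" and mp: "m \<in> SCls C" "p \<in> PCls C" "Dom C m = Cod C p"
  shows "Rng RPC (cls s (m \<cdot> p)) = cls m m"
proof -
  have *: "span_range (m \<cdot> p) = span_range g" if "(t, g) \<in> spans C" "cls s (m \<cdot> p) = cls t g" for t g
    by (rule cls_lift[OF _ sp that, where G = "\<lambda>s f. span_range f"]) (rule span_range_cong)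
  have "(THE n. \<exists>s' f m' p'. (s', f) \<in> spans C \<and> cls s (m \<cdot> p) = cls s' f \<and>
            m' \<in> SCls C \<and> p' \<in> PCls C \<and> seq C m' p' \<and> f = m' \<cdot> p' \<and> n = cls m' m') = cls m m"
  proof (rule the_equality)
    show "\<exists>s' f m' p'. (s', f) \<in> spans C \<and> cls s (m \<cdot> p) = cls s' f \<and>
            m' \<in> SCls C \<and> p' \<in> PCls C \<and> seq C m' p' \<and> f = m' \<cdot> p' \<and> cls m m = cls m' m'"
      using assms unfolding seq_def by (metis P_in_Arr S_in_Arr)
    fix n
    assume "\<exists>s' f m' p'. (s', f) \<in> spans C \<and> cls s (m \<cdot> p) = cls s' f \<and>
            m' \<in> SCls C \<and> p' \<in> PCls C \<and> seq C m' p' \<and> f = m' \<cdot> p' \<and> n = cls m' m'"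
    then obtain s' m' p' where "(s', m' \<cdot> p') \<in> spans C" "cls s (m \<cdot> p) = cls s' (m' \<cdot> p')"
      "m' \<in> SCls C" "p' \<in> PCls C" "Dom C m' = Cod C p'" "n = cls m' m'"
      by (auto simp: seq_def)
    then show "n = cls m m"
      using *[of s' "m' \<cdot> p'"] span_range_eq mp by simp
  qed
  then show ?thesis
    unfolding RP_def using sp by (simp add: RP_Arr_cls)
qed

lemma Arr_RP_factorE:
  assumes "k \<in> Arr RPC"
  obtains s m p where "s \<in> SCls C" "m \<in> SCls C" "p \<in> PCls C" "Dom C m = Cod C p" "Dom C s = Dom C p"
    "(s, m \<cdot> p) \<in> spans C" "k = cls s (m \<cdot> p)"
proof -
  obtain s f where *: "s \<in> SCls C" "f \<in> Arr C" "Dom C s = Dom C f" "(s, f) \<in> spans C" "k = cls s f"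
    using assms Arr_RPE by blast
  obtain m p where "m \<in> SCls C" "p \<in> PCls C" "Dom C m = Cod C p" "f = m \<cdot> p"
    using factorization[OF *(2)] by (auto simp: seq_def)
  then show ?thesis
    using that[of s m p] * by simp
qed

section \<open>Axioms of a split range category for span classes\<close>

lemma restriction_category_RP: "restriction_category RPC"
proof -
  interpret R: category RPC by (rule category_RP)
  have sp: "(s, s) \<in> spans C" if "s \<in> SCls C" for s
    using that by (simp add: in_spans)
  show ?thesis
  proof
    show "Rst RPC \<in> extensional (Arr RPC)"
      by (simp add: RP_def)
    show "Rst RPC k \<in> hom RPC (Dom RPC k) (Dom RPC k)" if "k \<in> Arr RPC" for k
      using that by (elim Arr_RPE) (simp add: hom_def sp)
    show "Comp RPC k (Rst RPC k) = k" if "k \<in> Arr RPC" for k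
      using that
    proof (elim Arr_RPE)
      fix s f
      assume *: "s \<in> SCls C" "f \<in> Arr C" "Dom C s = Dom C f" "(s, f) \<in> spans C" "k = cls s f"
      \<comment> \<open>Writing \<open>s\<close> as \<open>s \<cdot> i\<close> on both sides makes
        the composite of \<open>k\<close> and its restriction an instance of
        \<open>Comp_RP_cancel\<close> with \<open>v = s\<close>. The identity is hidden behind a
        local definition so that the factor stays visible.\<close>
      define i where "i = Idn C (Dom C s)"
      have "Comp RPC (cls (s \<cdot> i) f) (cls s (s \<cdot> i)) = Comp RPC (cls i f) (cls s i)"
        using * by (intro Comp_RP_cancel) (auto simp: i_def in_spans)
      also have "\<dots> = cls s (f \<cdot> i)"
        unfolding i_def using * by (intro Comp_RP_graph) (auto simp: in_spans)
      finally show "Comp RPC k (Rst RPC k) = k"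
        using * by (simp add: i_def)
    qed
    show "Comp RPC (Rst RPC k) (Rst RPC l) = Comp RPC (Rst RPC l) (Rst RPC k)"
      if kl: "k \<in> Arr RPC" "l \<in> Arr RPC" "Dom RPC k = Dom RPC l" for k l
    proof -
      obtain s f where k: "s \<in> SCls C" "(s, f) \<in> spans C" "k = cls s f"
        using kl Arr_RPE by metis
      obtain t g where l: "t \<in> SCls C" "(t, g) \<in> spans C" "l = cls t g"
        using kl Arr_RPE by metis
      have "Cod C s = Cod C t"
        using kl k l by simp
      then obtain t' s' where pb: "pullback C s t' t s'"
        using S_pullbacks k l by (metis S_in_Arr)
      then show ?thesis
        using Comp_RP[OF sp sp pb] Comp_RP[OF sp sp pullback_sym[OF pb]] k l pullbackD[OF pb] by simp
    qed
    show "Rst RPC (Comp RPC l (Rst RPC k)) = Comp RPC (Rst RPC l) (Rst RPC k)"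
      if kl: "k \<in> Arr RPC" "l \<in> Arr RPC" "Dom RPC k = Dom RPC l" for k l
    proof -
      obtain s f where k: "s \<in> SCls C" "(s, f) \<in> spans C" "k = cls s f"
        using kl Arr_RPE by metis
      obtain t g where l: "t \<in> SCls C" "(t, g) \<in> spans C" "l = cls t g"
        using kl Arr_RPE by metis
      have "Cod C s = Cod C t"
        using kl k l by simp
      then obtain t' s' where pb: "pullback C s t' t s'" and c: "Comp RPC (cls t g) (cls s s) = cls (s \<cdot> t') (g \<cdot> s')"
        "(s \<cdot> t', g \<cdot> s') \<in> spans C"
        using Comp_RPE[OF sp[OF k(1)] l(2)] by metis
      then show ?thesis
        using Comp_RP[OF sp sp pb] k l pullbackD[OF pb] by simp
    qed
    show "Comp RPC (Rst RPC l) k = Comp RPC k (Rst RPC (Comp RPC l k))" if lk: "seq RPC l k" for l k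
    proof -
      obtain s f where k: "s \<in> SCls C" "f \<in> Arr C" "Dom C s = Dom C f" "(s, f) \<in> spans C" "k = cls s f"
        using lk Arr_RPE by (auto simp: seq_def)
      obtain t g where l: "t \<in> SCls C" "(t, g) \<in> spans C" "l = cls t g"
        using lk Arr_RPE unfolding seq_def by metis
      have "Cod C f = Cod C t"
        using lk k l by (simp add: seq_def)
      then obtain t' f' where pb: "pullback C f t' t f'" and c: "Comp RPC (cls t g) (cls s f) = cls (s \<cdot> t') (g \<cdot> f')"
        "(s \<cdot> t', g \<cdot> f') \<in> spans C" "t' \<in> SCls C"
        using Comp_RPE[OF k(4) l(2)] by metis
      note D = pullbackD[OF pb]
      define i where "i = Idn C (Dom C s)"
      \<comment> \<open>R4 from its right-hand side: the restriction of the composite is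
        \<open>[s \<cdot> t', s \<cdot> t']\<close>, and cancelling \<open>s\<close> against the
        first leg of \<open>k\<close> leaves a composite with a graph. The left-hand side reaches
        the same class through \<open>f \<cdot> t' = t \<cdot> f'\<close>.\<close>
      have "Comp RPC (cls (s \<cdot> i) f) (cls (s \<cdot> t') (s \<cdot> t')) = Comp RPC (cls i f) (cls (s \<cdot> t') t')"
        using k c D by (intro Comp_RP_cancel) (auto simp: i_def in_spans)
      also have "\<dots> = cls (s \<cdot> t') (f \<cdot> t')"
        unfolding i_def using k c D by (intro Comp_RP_graph) (auto simp: in_spans)
      also have "\<dots> = Comp RPC (cls t t) (cls s f)"
        using Comp_RP[OF k(4) sp[OF l(1)] pb] D by simp
      finally show ?thesis
        using k l c by (simp add: i_def)
    qed
  qed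
qed

lemma split_range_category_RP: "split_range_category RPC"
proof -
  interpret R: restriction_category RPC by (rule restriction_category_RP)
  have sp: "(s, s) \<in> spans C" "(Idn C (Dom C s), s) \<in> spans C" "(s, Idn C (Dom C s)) \<in> spans C"
    if "s \<in> SCls C" for s
    using that by (simp_all add: in_spans)
  have Rng_self: "Rng RPC (cls m m) = cls m m" if "m \<in> SCls C" for m
    using Rng_RP[of m m "Idn C (Dom C m)"] sp[OF that] that by (simp add: P_iso)
  show ?thesis
  proof
    fix e assume e: "e \<in> Arr RPC" "Rst RPC e = e"
    then obtain s f where s: "s \<in> SCls C" "(s, f) \<in> spans C" "e = cls s f"
      using Arr_RPE by metis
    then have "e = cls s s"
      using e by simp
    define i where "i = Idn C (Dom C s)"
    have i: "i \<in> SCls C" "Dom C i = Dom C s" "Cod C i = Dom C s" "s \<cdot> i = s"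
      using s by (simp_all add: i_def)
    have "Comp RPC (cls i s) (cls s i) = cls s (s \<cdot> i)"
      unfolding i_def using s by (intro Comp_RP_graph) (auto simp: in_spans)
    \<comment> \<open>The splitting of \<open>[s, s]\<close> is \<open>m = [1, s]\<close> and
      \<open>r = [s, 1]\<close>. On spans, \<open>r \<cdot> m\<close> would be the kernel pair of
      \<open>s\<close>; cancelling \<open>v = s\<close> reduces it to the identity.\<close>
    moreover have "Comp RPC (cls (s \<cdot> i) i) (cls i (s \<cdot> i)) = Comp RPC (cls i i) (cls i i)"
      using i s by (intro Comp_RP_cancel) (auto simp: in_spans)
    moreover have "Comp RPC (cls i i) (cls i i) = cls i (i \<cdot> i)"
      unfolding i_def using s by (intro Comp_RP_graph) (auto simp: in_spans)
    moreover have "i \<cdot> i = i" "i \<in> Arr C" "Idn RPC (Dom C s) = cls i i"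
      using s by (simp_all add: i_def)
    ultimately show "\<exists>m r. seq RPC m r \<and> e = Comp RPC m r \<and> seq RPC r m \<and> Comp RPC r m = Idn RPC (Dom RPC m)"
      using sp[OF s(1)] i \<open>e = cls s s\<close>
      by (rule_tac x = "cls i s" in exI, rule_tac x = "cls s i" in exI) (simp add: seq_def i_def[symmetric])
  next
    show "Rng RPC \<in> extensional (Arr RPC)"
      by (simp add: RP_def)
  next
    fix k assume "k \<in> Arr RPC"
    then obtain s m p where k: "s \<in> SCls C" "m \<in> SCls C" "p \<in> PCls C" "Dom C m = Cod C p" "Dom C s = Dom C p"
      "(s, m \<cdot> p) \<in> spans C" "k = cls s (m \<cdot> p)"
      using Arr_RP_factorE by metis
    have Rng: "Rng RPC k = cls m m"
      using Rng_RP k by simp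
    show "Rng RPC k \<in> hom RPC (Cod RPC k) (Cod RPC k)"
      using Rng k sp by (simp add: hom_def)
    show "Rst RPC (Rng RPC k) = Rng RPC k"
      using Rng k sp by simp
    define i where "i = Idn C (Dom C m)"
    have i: "i \<in> SCls C" "Dom C i = Dom C m" "Cod C i = Dom C m" "m \<cdot> i = m"
      using k by (simp_all add: i_def)
    \<comment> \<open>RR2 by the same device, with \<open>v = m\<close> the S-part of the second
      leg.\<close>
    have "Comp RPC (cls (m \<cdot> i) m) (cls s (m \<cdot> p)) = Comp RPC (cls i m) (cls s p)"
      using k i by (intro Comp_RP_cancel) (auto simp: in_spans)
    also have "\<dots> = cls s (m \<cdot> p)"
      unfolding i_def using k by (intro Comp_RP_graph) (auto simp: in_spans)
    finally show "Comp RPC (Rng RPC k) k = k"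
      using Rng k i by simp
  next
    fix l k assume lk: "seq RPC l k"
    then obtain s m p where k: "s \<in> SCls C" "m \<in> SCls C" "p \<in> PCls C" "Dom C m = Cod C p" "Dom C s = Dom C p"
      "(s, m \<cdot> p) \<in> spans C" "k = cls s (m \<cdot> p)"
      using Arr_RP_factorE unfolding seq_def by metis
    obtain t g where l: "t \<in> SCls C" "g \<in> Arr C" "Dom C t = Dom C g" "(t, g) \<in> spans C" "l = cls t g"
      using lk Arr_RPE by (auto simp: seq_def)
    have cod: "Cod C m = Cod C t"
      using lk k l by (simp add: seq_def)
    have Rng: "Rng RPC k = cls m m"
      using Rng_RP k by simp
    obtain t'' m' where pb: "pullback C m t'' t m'" and t'': "t'' \<in> SCls C"
      and c: "Comp RPC (cls t g) (cls m m) = cls (m \<cdot> t'') (g \<cdot> m')" "(m \<cdot> t'', g \<cdot> m') \<in> spans C"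
      using Comp_RPE[OF sp(1)[OF k(2)] l(4) cod] .
    note D = pullbackD[OF pb]
    \<comment> \<open>The pullback of \<open>t\<close> along \<open>m \<cdot> p\<close> is taken in
      two stages, first along \<open>m\<close> and then along \<open>p\<close>. Stability puts
      \<open>p'\<close> in P, so \<open>(m \<cdot> t'') \<cdot> p'\<close> is a factorization and
      the range in RR3 can be read off.\<close>
    obtain t' p' where pb': "pullback C p t' t'' p'"
      using S_pullbacks[of t'' p] t'' k D by auto
    note D' = pullbackD[OF pb']
    have p': "p' \<in> PCls C"
      using P_stable[OF t'' k(3) pb'] .
    have t': "t' \<in> SCls C"
      using SCls_pullback[OF pb' t''] .
    have pb'': "pullback C (m \<cdot> p) t' t (m' \<cdot> p')"
      by (rule pullback_paste[OF pb pb'])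
    have "Rng RPC (Comp RPC (cls t t) (cls s (m \<cdot> p))) = Rng RPC (cls (s \<cdot> t') (t \<cdot> (m' \<cdot> p')))"
      using Comp_RP[OF k(6) sp(1)[OF l(1)] pb''] by simp
    also have "t \<cdot> (m' \<cdot> p') = (m \<cdot> t'') \<cdot> p'"
      using Comp_extend[OF D(9)[symmetric], of p'] D D' k l by simp
    also have "Rng RPC (cls (s \<cdot> t') ((m \<cdot> t'') \<cdot> p')) = cls (m \<cdot> t'') (m \<cdot> t'')"
      using k t' t'' p' D(1-8) D'(1-8) by (intro Rng_RP) (auto simp: in_spans)
    finally have "Rng RPC (Comp RPC (Rst RPC l) k) = cls (m \<cdot> t'') (m \<cdot> t'')"
      using k l by simp
    moreover have "Comp RPC (cls t t) (cls m m) = cls (m \<cdot> t'') (t \<cdot> m')"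
      by (rule Comp_RP[OF sp(1)[OF k(2)] sp(1)[OF l(1)] pb])
    ultimately show "Rng RPC (Comp RPC (Rst RPC l) k) = Comp RPC (Rst RPC l) (Rng RPC k)"
      using l Rng D by simp
    have gm: "g \<cdot> m' \<in> Arr C"
      using l D by simp
    \<comment> \<open>For RR4 it suffices to factor \<open>g \<cdot> m'\<close>: since
      \<open>q \<cdot> p'\<close> is again in P, both composites have the range given by
      \<open>n\<close>.\<close>
    obtain n q where nq: "n \<in> SCls C" "q \<in> PCls C" "Dom C n = Cod C q" "g \<cdot> m' = n \<cdot> q"
      using factorization[OF gm] by (auto simp: seq_def)
    have q: "Dom C q = Cod C p'" "Dom C q = Dom C t''"
      using Dom_Comp[of g m'] Dom_Comp[of n q] nq l D D' by simp_all
    have "Rng RPC (Comp RPC l (Rng RPC k)) = cls n n"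
      using Rng_RP[of "m \<cdot> t''" n q] nq c l Rng by simp
    moreover have "Comp RPC l k = cls (s \<cdot> t') (g \<cdot> (m' \<cdot> p'))"
      using Comp_RP[OF k(6) l(4) pb''] k l by simp
    moreover have "g \<cdot> (m' \<cdot> p') = n \<cdot> (q \<cdot> p')"
      using Comp_extend[OF nq(4), of p'] nq q D D' l by simp
    moreover have "Rng RPC (cls (s \<cdot> t') (n \<cdot> (q \<cdot> p'))) = cls n n"
      using nq q k t' p' D' by (intro Rng_RP) (auto simp: in_spans)
    ultimately show "Rng RPC (Comp RPC l (Rng RPC k)) = Rng RPC (Comp RPC l k)"
      by simp
  qed
qed

end

section \<open>The 2-functor of spans\<close>

context sf_functor
begin

text \<open>For the generators: both pullbacks defining a conjugate of \<open>v\<close> are along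
  S-morphisms, so \<open>F\<close> preserves them, and the image of the conjugate is a conjugate of
  \<open>FM F v\<close>.\<close>

lemma FM_S_circ: "x \<in> S_circ C \<Longrightarrow> FM F x \<in> S_circ D"
proof -
  \<comment> \<open>The intersection with \<open>SCls C\<close> bounds the class from above as
    minimality requires, and it also makes \<open>FM_pullback\<close> available for its
    members.\<close>
  let ?U = "{x \<in> SCls C. FM F x \<in> S_circ D}"
  have "S_circ C \<subseteq> ?U"
  proof (rule C.S_circ_least)
    show "S_star C \<subseteq> ?U"
    proof
      fix x assume x: "x \<in> S_star C"
      then obtain f s g t v w h k where v: "v \<in> SCls C" and w: "conjugate C (f, s) (g, t) v w" and pb: "pullback C h x w k"
        by (auto simp: S_star_def)
      have wS: "w \<in> SCls C"
        using C.conjugate_SCls[OF w] .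
      obtain s' f' t' g' where st: "(f, s) \<in> cospans C" "v \<cdot>\<^bsub>C\<^esub> f = g" "v \<cdot>\<^bsub>C\<^esub> s = t" "v \<in> hom C (Cod C s) (Cod C t)"
        "pullback C f s' s f'" "pullback C g t' t g'" "w \<in> hom C (Dom C s') (Dom C t')"
        "t' \<cdot>\<^bsub>C\<^esub> w = s'" "g' \<cdot>\<^bsub>C\<^esub> w = f'" "t \<in> SCls C"
        using w by (auto simp: conjugate_def cospan_mor_def cospans_def)
      have s: "f \<in> Arr C" "s \<in> SCls C" "Cod C f = Cod C s" "w \<in> Arr C" "Dom C w = Dom C s'" "Cod C w = Dom C t'"
        "Dom C v = Cod C s"
        using st by (auto simp: cospans_def hom_def)
      note D = C.pullbackD[OF st(5)] C.pullbackD[OF st(6)]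
      have vf: "FM F v \<cdot>\<^bsub>D\<^esub> FM F f = FM F g" "FM F v \<cdot>\<^bsub>D\<^esub> FM F s = FM F t"
        by (rule FM_eq1; use st(2,3) s v in simp)+
      have "FM F w \<in> S_circ D"
      proof (rule D.conjugate_S_circ[of "FM F v" "FM F f" "FM F s"])
        show "pullback D (FM F f) (FM F s') (FM F s) (FM F f')"
          using FM_pullback st(5) s by blast
        show "pullback D (FM F v \<cdot>\<^bsub>D\<^esub> FM F f) (FM F t') (FM F v \<cdot>\<^bsub>D\<^esub> FM F s) (FM F g')"
          unfolding vf using FM_pullback st(6,10) by blast
        show "FM F t' \<cdot>\<^bsub>D\<^esub> FM F w = FM F s'" "FM F g' \<cdot>\<^bsub>D\<^esub> FM F w = FM F f'"
          by (rule FM_eq1; use st(8,9) s D in simp)+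
      qed (use v s D in auto)
      then have "FM F x \<in> S_circ D"
        using D.S_circ_pullback FM_pullback[OF wS pb] by blast
      then show "x \<in> ?U"
        using x C.S_star_SCls by blast
    qed
    show "u' \<in> ?U" if "u \<in> ?U" "pullback C f u' u f'" for u f u' f'
      using that FM_pullback[OF _ that(2)] D.S_circ_pullback C.SCls_pullback by blast
    show "x \<in> ?U" if "p \<in> PCls C" "q \<in> PCls C" "x \<in> SCls C" "y \<in> ?U" "commutes C x q p y" for p q x y
    proof -
      have "commutes D (FM F x) (FM F q) (FM F p) (FM F y)"
        using that(5) FM_eq[of x q p y] by (auto simp: commutes_def seq_def)
      then have "FM F x \<in> S_circ D"
        using that by (intro D.S_circ_PCls[of "FM F p" "FM F q" "FM F x" "FM F y"]) auto
      then show ?thesis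
        using that by blast
    qed
  qed blast
  then show "x \<in> S_circ C \<Longrightarrow> FM F x \<in> S_circ D"
    by blast
qed

end

locale coded_sf_functor = sf_functor C D F + CC: coded_stable_fact C code + DD: coded_stable_fact D code
  for C :: "('o, 'm) factcat" and D :: "('p, 'm) factcat" and F code
begin

lemma FM_spans [simp]: "(s, f) \<in> spans C \<Longrightarrow> (FM F s, FM F f) \<in> spans D"
  by (auto simp: C.in_spans D.in_spans)

lemma FO_RP_func [simp]: "FO (RP_func code C D F) = FO F"
  by (simp add: RP_func_def)

lemma FM_RP_func [simp]:
  assumes "(s, f) \<in> spans C"
  shows "FM (RP_func code C D F) (zcls code C s f) = zcls code D (FM F s) (FM F f)"
proof -
  have "zcls code D (FM F s) (FM F f) = zcls code D (FM F t) (FM F g)"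
    if "(t, g) \<in> spans C" "zcls code C s f = zcls code C t g" for t g
  proof (rule CC.cls_lift[OF _ assms that, where G = "\<lambda>s f. zcls code D (FM F s) (FM F f)"])
    fix t g x assume *: "(t, g) \<in> spans C" "x \<in> S_circ C" "Dom C t = Cod C x"
    then have "zcls code D (FM F t \<cdot>\<^bsub>D\<^esub> FM F x) (FM F g \<cdot>\<^bsub>D\<^esub> FM F x) = zcls code D (FM F t) (FM F g)"
      using C.S_circ_SCls[OF *(2)] by (intro DD.cls_eqI FM_spans FM_S_circ) (auto simp: C.in_spans)
    then show "zcls code D (FM F (t \<cdot>\<^bsub>C\<^esub> x)) (FM F (g \<cdot>\<^bsub>C\<^esub> x)) = zcls code D (FM F t) (FM F g)"
      using * C.S_circ_SCls[OF *(2)] by (auto simp: C.in_spans)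
  qed
  then have "(THE n. \<exists>t g. (t, g) \<in> spans C \<and> zcls code C s f = zcls code C t g \<and>
      n = zcls code D (FM F t) (FM F g)) = zcls code D (FM F s) (FM F f)"
    using assms by (intro the_equality) (blast, metis)
  then show ?thesis
    using assms by (simp add: RP_func_def CC.RP_Arr_cls)
qed

lemma is_func_RP: "is_func (RP code C) (RP code D) (RP_func code C D F)"
  unfolding is_func_def
proof (intro conjI ballI allI impI)
  show "FO (RP_func code C D F) \<in> Ob (RP code C) \<rightarrow>\<^sub>E Ob (RP code D)"
    by (auto simp: FO_undefined)
  show "FM (RP_func code C D F) \<in> Arr (RP code C) \<rightarrow>\<^sub>E Arr (RP code D)"
  proof (rule PiE_I)
    fix k assume "k \<in> Arr (RP code C)"
    then show "FM (RP_func code C D F) k \<in> Arr (RP code D)" by (elim CC.Arr_RPE) simp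
  qed (simp add: RP_func_def RP_def)
  fix k assume "k \<in> Arr (RP code C)"
  then obtain s f where k: "s \<in> SCls C" "f \<in> Arr C" "(s, f) \<in> spans C" "k = zcls code C s f"
    using CC.Arr_RPE by metis
  then show "Dom (RP code D) (FM (RP_func code C D F) k) = FO (RP_func code C D F) (Dom (RP code C) k)"
    "Cod (RP code D) (FM (RP_func code C D F) k) = FO (RP_func code C D F) (Cod (RP code C) k)"
    by simp_all
next
  fix a assume "a \<in> Ob (RP code C)"
  then show "FM (RP_func code C D F) (Idn (RP code C) a) = Idn (RP code D) (FO (RP_func code C D F) a)"
    by (simp add: C.in_spans)
next
  fix l k assume lk: "seq (RP code C) l k"
  obtain s f where k: "s \<in> SCls C" "f \<in> Arr C" "Dom C s = Dom C f" "(s, f) \<in> spans C" "k = zcls code C s f"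
    using lk CC.Arr_RPE unfolding seq_def by metis
  obtain t g where l: "t \<in> SCls C" "g \<in> Arr C" "Dom C t = Dom C g" "(t, g) \<in> spans C" "l = zcls code C t g"
    using lk CC.Arr_RPE unfolding seq_def by metis
  have "Cod C f = Cod C t"
    using lk k l by (simp add: seq_def)
  then obtain t' f' where pb: "pullback C f t' t f'"
    and c: "Comp (RP code C) (zcls code C t g) (zcls code C s f) = zcls code C (s \<cdot>\<^bsub>C\<^esub> t') (g \<cdot>\<^bsub>C\<^esub> f')"
    "(s \<cdot>\<^bsub>C\<^esub> t', g \<cdot>\<^bsub>C\<^esub> f') \<in> spans C"
    using CC.Comp_RPE[OF k(4) l(4)] by metis
  have "Comp (RP code D) (zcls code D (FM F t) (FM F g)) (zcls code D (FM F s) (FM F f))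
    = zcls code D (FM F s \<cdot>\<^bsub>D\<^esub> FM F t') (FM F g \<cdot>\<^bsub>D\<^esub> FM F f')"
    by (rule DD.Comp_RP[OF FM_spans[OF k(4)] FM_spans[OF l(4)] FM_pullback[OF l(1) pb]])
  then show "FM (RP_func code C D F) (Comp (RP code C) l k)
    = Comp (RP code D) (FM (RP_func code C D F) l) (FM (RP_func code C D F) k)"
    using k l c C.pullbackD[OF pb] by simp
qed

lemma SR_func_RP: "SR_func (RP code C) (RP code D) (RP_func code C D F)"
  unfolding SR_func_def
proof (intro conjI ballI is_func_RP)
  fix k assume "k \<in> Arr (RP code C)"
  then obtain s m p where k: "s \<in> SCls C" "m \<in> SCls C" "p \<in> PCls C" "Dom C m = Cod C p" "Dom C s = Dom C p"
    "(s, m \<cdot>\<^bsub>C\<^esub> p) \<in> spans C" "k = zcls code C s (m \<cdot>\<^bsub>C\<^esub> p)"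
    using CC.Arr_RP_factorE by metis
  have sp: "(s, s) \<in> spans C" "(m, m) \<in> spans C"
    using k by (simp_all add: C.in_spans)
  show "FM (RP_func code C D F) (Rst (RP code C) k) = Rst (RP code D) (FM (RP_func code C D F) k)"
    using k(6,7) sp CC.Rst_RP[OF k(6)] DD.Rst_RP[OF FM_spans[OF k(6)]] by (simp del: FM_Comp)
  have "Rng (RP code D) (zcls code D (FM F s) (FM F m \<cdot>\<^bsub>D\<^esub> FM F p)) = zcls code D (FM F m) (FM F m)"
    using FM_spans[OF k(6)] k by (intro DD.Rng_RP) auto
  then show "FM (RP_func code C D F) (Rng (RP code C) k) = Rng (RP code D) (FM (RP_func code C D F) k)"
    using k sp CC.Rng_RP[OF k(6)] by simp
qed

end

section \<open>2-cells and 2-functoriality of the span construction\<close>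

lemma coded_stable_factI: "quotient_coding code \<Longrightarrow> stable_fact C \<Longrightarrow> coded_stable_fact C code"
  by (simp add: coded_stable_fact_def coded_stable_fact_axioms_def)

lemma coded_sf_functorI:
  assumes "quotient_coding code" "stable_fact C" "stable_fact D" "SF_func C D F"
  shows "coded_sf_functor C D F code"
  unfolding coded_sf_functor_def
  using sf_functorI[OF assms(2-4)] coded_stable_factI[OF assms(1,2)] coded_stable_factI[OF assms(1,3)] by simp

lemma RP_ntrans_simps [simp]:
  "Src (RP_ntrans code C D \<alpha>) = RP_func code C D (Src \<alpha>)"
  "Tgt (RP_ntrans code C D \<alpha>) = RP_func code C D (Tgt \<alpha>)"
  "Cmp (RP_ntrans code C D \<alpha>) = (\<lambda>a\<in>Ob C. zcls code D (Idn D (FO (Src \<alpha>) a)) (Cmp \<alpha> a))"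
  by (simp_all add: RP_ntrans_def)

text \<open>Naturality at \<open>[s, f]\<close> is where the pullback condition on 2-cells is used:
  the composite of \<open>[1, \<alpha>]\<close> with the image of \<open>[s, f]\<close> under the
  target functor is formed from the pullback that the naturality square at \<open>s\<close>
  provides. The second legs then agree by naturality at \<open>f\<close>.\<close>

lemma SR_ntrans_RP:
  assumes "quotient_coding code" "stable_fact C" "stable_fact D" and \<alpha>: "SF_ntrans C D \<alpha>"
  shows "SR_ntrans (RP code C) (RP code D) (RP_ntrans code C D \<alpha>)"
proof -
  have SF: "SF_func C D (Src \<alpha>)" "SF_func C D (Tgt \<alpha>)"
    using \<alpha> by (auto simp: SF_ntrans_def)
  interpret F: coded_sf_functor C D "Src \<alpha>" code using assms SF by (intro coded_sf_functorI)
  interpret G: coded_sf_functor C D "Tgt \<alpha>" code using assms SF by (intro coded_sf_functorI)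
  interpret a: nat_trans C D \<alpha>
    using \<alpha> F.C.category_axioms F.D.category_axioms by (intro nat_transI) (auto simp: SF_ntrans_def)
  have sp: "(Idn D (FO (Src \<alpha>) a), Cmp \<alpha> a) \<in> spans D" "(Idn D (FO (Src \<alpha>) a), Idn D (FO (Src \<alpha>) a)) \<in> spans D"
    if "a \<in> Ob C" for a
    using that by (simp_all add: F.D.in_spans)
  have "is_ntrans (RP code C) (RP code D) (RP_ntrans code C D \<alpha>)"
    unfolding is_ntrans_def RP_ntrans_simps
  proof (intro conjI ballI F.is_func_RP G.is_func_RP)
    fix k assume "k \<in> Arr (RP code C)"
    then obtain s f where k: "s \<in> SCls C" "f \<in> Arr C" "Dom C s = Dom C f" "(s, f) \<in> spans C" "k = zcls code C s f"
      using F.CC.Arr_RPE by metis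
    have "pullback D (FM (Tgt \<alpha>) s) (Cmp \<alpha> (Dom C s)) (Cmp \<alpha> (Cod C s)) (FM (Src \<alpha>) s)"
      using \<alpha> k(1) unfolding SF_ntrans_def by blast
    then have pb: "pullback D (Cmp \<alpha> (Cod C s)) (FM (Src \<alpha>) s) (FM (Tgt \<alpha>) s) (Cmp \<alpha> (Dom C s))"
      by (rule F.D.pullback_sym)
    have "Comp (RP code D) (zcls code D (FM (Tgt \<alpha>) s) (FM (Tgt \<alpha>) f))
        (zcls code D (Idn D (FO (Src \<alpha>) (Cod C s))) (Cmp \<alpha> (Cod C s)))
      = zcls code D (Idn D (FO (Src \<alpha>) (Cod C s)) \<cdot>\<^bsub>D\<^esub> FM (Src \<alpha>) s) (FM (Tgt \<alpha>) f \<cdot>\<^bsub>D\<^esub> Cmp \<alpha> (Dom C s))"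
      by (rule F.DD.Comp_RP[OF sp(1) G.FM_spans pb]) (use k in auto)
    also have "\<dots> = zcls code D (FM (Src \<alpha>) s) (Cmp \<alpha> (Cod C f) \<cdot>\<^bsub>D\<^esub> FM (Src \<alpha>) f)"
      using k a.naturality[of f] by simp
    also have "\<dots> = Comp (RP code D) (zcls code D (Idn D (FO (Src \<alpha>) (Cod C f))) (Cmp \<alpha> (Cod C f)))
        (zcls code D (FM (Src \<alpha>) s) (FM (Src \<alpha>) f))"
      using F.DD.Comp_RP_graph[OF F.FM_spans[OF k(4)], of "Cmp \<alpha> (Cod C f)"] k by simp
    finally show "Comp (RP code D) (FM (RP_func code C D (Tgt \<alpha>)) k)
         ((\<lambda>a\<in>Ob C. zcls code D (Idn D (FO (Src \<alpha>) a)) (Cmp \<alpha> a)) (Dom (RP code C) k)) =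
         Comp (RP code D) ((\<lambda>a\<in>Ob C. zcls code D (Idn D (FO (Src \<alpha>) a)) (Cmp \<alpha> a)) (Cod (RP code C) k))
          (FM (RP_func code C D (Src \<alpha>)) k)"
      using k by simp
  qed (auto simp: hom_def sp)
  moreover have "total (RP code D) (Cmp (RP_ntrans code C D \<alpha>) a)" if "a \<in> Ob (RP code C)" for a
    using that sp[of a] by (simp add: total_def)
  ultimately show ?thesis
    using F.SR_func_RP G.SR_func_RP by (auto simp: SR_ntrans_def)
qed

lemma RP_func_id:
  assumes "quotient_coding code" "stable_fact C"
  shows "RP_func code C C (func_id C) = func_id (RP code C)"
proof -
  interpret C: coded_stable_fact C code
    using assms by (intro coded_stable_factI)
  have "SF_func C C (func_id C)"
    using two_category.Id1_cell[OF two_category_StableFact, of C] assms(2) by (simp add: StableFact_eq)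
  then interpret I: coded_sf_functor C C "func_id C" code
    using assms by (intro coded_sf_functorI)
  show ?thesis
  proof (rule func_eqI[OF I.is_func_RP is_func_id[OF C.category_RP]])
    fix k assume k: "k \<in> Arr (RP code C)"
    then obtain s f where "s \<in> SCls C" "f \<in> Arr C" "(s, f) \<in> spans C" "k = zcls code C s f"
      using C.Arr_RPE by metis
    then show "FM (RP_func code C C (func_id C)) k = FM (func_id (RP code C)) k"
      using k by simp
  qed simp
qed

lemma RP_func_comp:
  assumes "quotient_coding code" "stable_fact A" "stable_fact B" "stable_fact C" "SF_func A B F" "SF_func B C G"
  shows "RP_func code A C (func_comp A G F) = func_comp (RP code A) (RP_func code B C G) (RP_func code A B F)"
proof -
  interpret F: coded_sf_functor A B F code using assms by (intro coded_sf_functorI)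
  interpret G: coded_sf_functor B C G code using assms by (intro coded_sf_functorI)
  interpret GF: coded_sf_functor A C "func_comp A G F" code
    by (rule coded_sf_functorI[OF assms(1,2,4) SF_func_comp[OF assms(2-)]])
  show ?thesis
  proof (rule func_eqI[OF GF.is_func_RP
        is_func_comp[OF F.CC.category_RP F.DD.category_RP G.DD.category_RP F.is_func_RP G.is_func_RP]])
    fix k assume k: "k \<in> Arr (RP code A)"
    then obtain s f where "s \<in> SCls A" "f \<in> Arr A" "(s, f) \<in> spans A" "k = zcls code A s f"
      using F.CC.Arr_RPE by metis
    then show "FM (RP_func code A C (func_comp A G F)) k
      = FM (func_comp (RP code A) (RP_func code B C G) (RP_func code A B F)) k"
      using k by simp
  qed simp
qed

lemma two_functor_RaPar:
  fixes code :: "('m \<times> 'm) set \<Rightarrow> 'm"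
  assumes code: "quotient_coding code"
  shows "two_functor
    (StableFact :: (('o, 'm) factcat, ('o, 'm, 'o, 'm) func, ('o, 'm, 'o, 'm) ntrans) twocat) SplitRangeCat (RaPar code)"
  unfolding StableFact_eq SplitRangeCat_eq RaPar_def functor_twocat_simps ntrans_cat_simps
proof (rule two_functor_ntrans[where FF = "\<lambda>C D. {F. SF_func C D F}" and NN = "\<lambda>C D. {\<alpha>. SF_ntrans C D \<alpha>}"
      and Lf = "RP_func code" and Lt = "RP_ntrans code"]; (unfold mem_Collect_eq)?)
  fix A :: "('o, 'm) factcat"
  assume "stable_fact A"
  then show "split_range_category (RP code A)" "RP_func code A A (func_id A) = func_id (RP code A)"
    using coded_stable_fact.split_range_category_RP coded_stable_factI RP_func_id code by blast+
next
  fix A B :: "('o, 'm) factcat" and F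
  assume *: "stable_fact A" "stable_fact B" "SF_func A B F"
  then interpret F: coded_sf_functor A B F code using code by (intro coded_sf_functorI)
  show "SR_func (RP code A) (RP code B) (RP_func code A B F)"
    by (rule F.SR_func_RP)
  show "RP_ntrans code A B (ntrans_id A B F) = ntrans_id (RP code A) (RP code B) (RP_func code A B F)"
    by (rule ntrans_eqI[of _ _ A]) auto
next
  fix A B :: "('o, 'm) factcat" and \<alpha> \<beta>
  assume *: "stable_fact A" "stable_fact B" "SF_ntrans A B \<alpha>" "SF_ntrans A B \<beta>" "Src \<beta> = Tgt \<alpha>"
  interpret A: coded_stable_fact A code using code * by (intro coded_stable_factI)
  interpret B: coded_stable_fact B code using code * by (intro coded_stable_factI)
  interpret a: nat_trans A B \<alpha>
    using * A.category_axioms B.category_axioms by (intro nat_transI) (auto simp: SF_ntrans_def)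
  interpret b: nat_trans A B \<beta>
    using * A.category_axioms B.category_axioms by (intro nat_transI) (auto simp: SF_ntrans_def)
  show "RP_ntrans code A B (ntrans_vcomp A B \<beta> \<alpha>)
    = ntrans_vcomp (RP code A) (RP code B) (RP_ntrans code A B \<beta>) (RP_ntrans code A B \<alpha>)"
  proof (rule ntrans_eqI[of _ _ A])
    fix a assume a: "a \<in> Ob A"
    have "(Idn B (FO (Src \<alpha>) a), Cmp \<alpha> a) \<in> spans B"
      using a by (simp add: B.in_spans)
    from B.Comp_RP_graph[OF this, of "Cmp \<beta> a"]
    show "Cmp (RP_ntrans code A B (ntrans_vcomp A B \<beta> \<alpha>)) a
      = Cmp (ntrans_vcomp (RP code A) (RP code B) (RP_ntrans code A B \<beta>) (RP_ntrans code A B \<alpha>)) a"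
      using a *(5) by simp
  qed auto
next
  fix A B C :: "('o, 'm) factcat" and F G
  assume *: "stable_fact A" "stable_fact B" "stable_fact C" "SF_func A B F" "SF_func B C G"
  then show "RP_func code A C (func_comp A G F) = func_comp (RP code A) (RP_func code B C G) (RP_func code A B F)"
    using RP_func_comp code by blast
next
  fix A B C :: "('o, 'm) factcat" and \<alpha> \<beta>
  assume *: "stable_fact A" "stable_fact B" "stable_fact C" "SF_ntrans A B \<alpha>" "SF_ntrans B C \<beta>"
  then have SF: "SF_func A B (Src \<alpha>)" "SF_func A B (Tgt \<alpha>)" "SF_func B C (Src \<beta>)" "SF_func B C (Tgt \<beta>)"
    by (auto simp: SF_ntrans_def)
  interpret F: coded_sf_functor A B "Src \<alpha>" code using code * SF by (intro coded_sf_functorI)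
  interpret F': coded_sf_functor A B "Tgt \<alpha>" code using code * SF by (intro coded_sf_functorI)
  interpret G: coded_sf_functor B C "Src \<beta>" code using code * SF by (intro coded_sf_functorI)
  interpret a: nat_trans A B \<alpha>
    using * F.C.category_axioms F.D.category_axioms by (intro nat_transI) (auto simp: SF_ntrans_def)
  interpret b: nat_trans B C \<beta>
    using * G.D.category_axioms F.D.category_axioms by (intro nat_transI) (auto simp: SF_ntrans_def)
  show "RP_ntrans code A C (ntrans_hcomp A C \<beta> \<alpha>)
    = ntrans_hcomp (RP code A) (RP code C) (RP_ntrans code B C \<beta>) (RP_ntrans code A B \<alpha>)"
  proof (rule ntrans_eqI[of _ _ A])
    fix a assume a: "a \<in> Ob A"
    have sp: "(Idn B (FO (Src \<alpha>) a), Cmp \<alpha> a) \<in> spans B"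
      using a by (simp add: F.D.in_spans)
    have "(Idn C (FO (Src \<beta>) (FO (Src \<alpha>) a)), FM (Src \<beta>) (Cmp \<alpha> a)) \<in> spans C"
      using a by (simp add: G.D.in_spans)
    from G.DD.Comp_RP_graph[OF this, of "Cmp \<beta> (FO (Tgt \<alpha>) a)"]
    show "Cmp (RP_ntrans code A C (ntrans_hcomp A C \<beta> \<alpha>)) a
      = Cmp (ntrans_hcomp (RP code A) (RP code C) (RP_ntrans code B C \<beta>) (RP_ntrans code A B \<alpha>)) a"
      using a sp by simp
  qed (use RP_func_comp[OF code *(1-3) SF(1,3)] RP_func_comp[OF code *(1-3) SF(2,4)] in auto)
qed (auto intro: two_category_SplitRangeCat[unfolded SplitRangeCat_eq] two_category_StableFact[unfolded StableFact_eq]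
    SR_ntrans_RP code)

section \<open>Unit\<close>

definition unit :: "(('m \<times> 'm) set \<Rightarrow> 'm) \<Rightarrow> ('o, 'm) factcat \<Rightarrow> ('o, 'm, 'o, 'm) func" where
  "unit code C = \<lparr>FO = (\<lambda>a\<in>Ob C. a), FM = (\<lambda>f\<in>Arr C. zcls code C (Idn C (Dom C f)) f)\<rparr>"

lemma unit_simps [simp]:
  "a \<in> Ob C \<Longrightarrow> FO (unit code C) a = a"
  "f \<in> Arr C \<Longrightarrow> FM (unit code C) f = zcls code C (Idn C (Dom C f)) f"
  by (simp_all add: unit_def)

context coded_stable_fact
begin

sublocale RP: split_range_category RPC
  by (rule split_range_category_RP)

lemma graph_span [simp]: "f \<in> Arr C \<Longrightarrow> Dom C f = a \<Longrightarrow> (Idn C a, f) \<in> spans C"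
  and cograph_span [simp]: "s \<in> SCls C \<Longrightarrow> Dom C s = a \<Longrightarrow> (s, Idn C a) \<in> spans C"
  by (auto simp: in_spans)

lemma total_graph [simp]: "f \<in> Arr C \<Longrightarrow> Dom C f = a \<Longrightarrow> total RPC (cls (Idn C a) f)"
  by (auto simp: total_def)

lemma Comp_graph_cograph:
  assumes "(s, f) \<in> spans C" "Dom C s = a"
  shows "Comp RPC (cls (Idn C a) f) (cls s (Idn C a)) = cls s f"
proof -
  have f: "s \<in> SCls C" "f \<in> Arr C" "Dom C f = a"
    using assms by (simp_all add: in_spans)
  then have a: "a \<in> Ob C"
    using Dom_Ob by blast
  show ?thesis
    using Comp_RP_graph[OF cograph_span[OF f(1) assms(2)] f(2) Cod_Idn[OF a] f(3)] f by simp
qed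

text \<open>Cancelling \<open>v = s\<close> turns \<open>[s, 1] \<cdot> [1, s]\<close> into a
  composite of identities; the other composite is \<open>[s, s]\<close>, the restriction of
  \<open>[s, 1]\<close>.\<close>

lemma graph_partial_inverse:
  assumes "s \<in> SCls C" "Dom C s = a"
  shows "partial_inverse RPC (cls (Idn C a) s) (cls s (Idn C a))"
proof -
  define i where "i = Idn C a"
  have i: "i \<in> SCls C" "Dom C i = a" "Cod C i = a" "s \<cdot> i = s" "i \<cdot> i = i" "i \<in> Arr C" "a \<in> Ob C"
    "Idn RPC a = cls i i"
    using assms by (auto simp: i_def)
  have "Comp RPC (cls (s \<cdot> i) i) (cls i (s \<cdot> i)) = Comp RPC (cls i i) (cls i i)"
    using i assms by (intro Comp_RP_cancel) (auto simp: in_spans)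
  also have "\<dots> = cls i (i \<cdot> i)"
    unfolding i_def using i by (intro Comp_RP_graph) auto
  finally show ?thesis
    using assms Comp_graph_cograph[of s s a] i
    by (simp add: partial_inverse_def i_def[symmetric] in_spans)
qed

lemma SF_func_unit: "SF_func C (Tot RPC) (unit code C)"
  unfolding SF_func_def
proof (intro conjI ballI allI impI)
  note [simp] = RP.Tot_simps
  show "is_func C (Tot RPC) (unit code C)"
    unfolding is_func_def
  proof (intro conjI ballI allI impI)
    show "FO (unit code C) \<in> Ob C \<rightarrow>\<^sub>E Ob (Tot RPC)" "FM (unit code C) \<in> Arr C \<rightarrow>\<^sub>E Arr (Tot RPC)"
      by (auto simp: unit_def)
    show "FM (unit code C) (g \<cdot> f) = Comp (Tot RPC) (FM (unit code C) g) (FM (unit code C) f)" if "seq C g f" for g f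
      using Comp_RP_graph[of "Idn C (Dom C f)" f g "Cod C f"] that by (simp add: seq_def)
  qed (auto simp: seq_def)
  show "FM (unit code C) ` PCls C \<subseteq> PCls (Tot RPC)"
  proof (intro image_subsetI)
    fix p assume p: "p \<in> PCls C"
    have "Rng RPC (cls (Idn C (Dom C p)) (Idn C (Cod C p) \<cdot> p)) = cls (Idn C (Cod C p)) (Idn C (Cod C p))"
      using p by (intro Rng_RP) auto
    then show "FM (unit code C) p \<in> PCls (Tot RPC)"
      using p by (simp add: RP.PCls_Tot)
  qed
  show "FM (unit code C) ` SCls C \<subseteq> SCls (Tot RPC)"
  proof (intro image_subsetI)
    fix s assume s: "s \<in> SCls C"
    then show "FM (unit code C) s \<in> SCls (Tot RPC)"
      using graph_partial_inverse[OF s refl] unfolding RP.SCls_Tot by auto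
  qed
  fix s f s' f'
  assume s: "s \<in> SCls C" and pb: "pullback C f s' s f'"
  note D = pullbackD[OF pb]
  have s': "s' \<in> SCls C"
    using SCls_pullback[OF pb s] .
  define a where "a = Dom C f"
  have "pullback (Tot RPC) (cls (Idn C a) f) (cls (Idn C (Dom C s')) s') (cls (Idn C (Dom C s)) s) (cls (Idn C (Dom C s')) f')"
  proof (rule RP.pullback_TotI[OF graph_partial_inverse[OF s refl] graph_partial_inverse[OF s' refl]])
    show "Comp RPC (cls (Idn C a) f) (cls (Idn C (Dom C s')) s') = Comp RPC (cls (Idn C (Dom C s)) s) (cls (Idn C (Dom C s')) f')"
      using Comp_RP_graph[of "Idn C (Dom C s')" s' f a] Comp_RP_graph[of "Idn C (Dom C s')" f' s "Dom C s"] D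
      by (simp add: a_def)
    have sp: "(s', f') \<in> spans C" "(s', s') \<in> spans C"
      using D s' by (auto simp: in_spans)
    \<comment> \<open>The given pullback is exactly the one that forms this composite. Hence its
      restriction is \<open>[s', s']\<close>, the idempotent split by the graph of
      \<open>s'\<close>, as the pullback criterion in \<open>Tot RPC\<close> demands.\<close>
    have "Comp RPC (cls s (Idn C (Dom C s))) (cls (Idn C a) f) = cls s' f'"
      using Comp_RP[OF _ _ pb, of "Idn C a" "Idn C (Dom C s)"] D s by (simp add: a_def)
    then show "Comp RPC (cls (Idn C (Dom C s')) s') (cls s' (Idn C (Dom C s')))
      = Rst RPC (Comp RPC (cls s (Idn C (Dom C s))) (cls (Idn C a) f))"
      using Comp_graph_cograph[OF sp(2)] sp by simp
  qed (use D s s' in \<open>auto simp: a_def\<close>)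
  then show "pullback (Tot RPC) (FM (unit code C) f) (FM (unit code C) s') (FM (unit code C) s) (FM (unit code C) f')"
    using D by (simp add: a_def)
qed

end

lemma unit_natural:
  assumes "quotient_coding code" "stable_fact C" "stable_fact D" "SF_func C D F"
  shows "func_comp C (unit code D) F = func_comp C (Tot_func (RP code C) (RP_func code C D F)) (unit code C)"
proof -
  interpret F: coded_sf_functor C D F code using assms by (intro coded_sf_functorI)
  show ?thesis
    by (auto simp: func_comp_def compose_def fun_eq_iff)
qed

lemma unit_natural2:
  assumes "quotient_coding code" "stable_fact C" "stable_fact D" "SF_ntrans C D \<alpha>"
  shows "ntrans_hcomp C (Tot (RP code D)) (ntrans_id D (Tot (RP code D)) (unit code D)) \<alpha>
    = ntrans_hcomp C (Tot (RP code D)) (Tot_ntrans (RP code C) (RP_ntrans code C D \<alpha>))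
        (ntrans_id C (Tot (RP code C)) (unit code C))"
proof -
  have SF: "SF_func C D (Src \<alpha>)" "SF_func C D (Tgt \<alpha>)"
    using assms by (auto simp: SF_ntrans_def)
  interpret F: coded_sf_functor C D "Src \<alpha>" code using assms SF by (intro coded_sf_functorI)
  interpret G: coded_sf_functor C D "Tgt \<alpha>" code using assms SF by (intro coded_sf_functorI)
  interpret a: nat_trans C D \<alpha>
    using assms F.C.category_axioms F.D.category_axioms by (intro nat_transI) (auto simp: SF_ntrans_def)
  show ?thesis
  proof (rule ntrans_eqI[of _ _ C])
    fix a assume a: "a \<in> Ob C"
    have "Cmp \<alpha> a \<in> Arr D" "Dom D (Cmp \<alpha> a) = FO (Src \<alpha>) a" "Cod D (Cmp \<alpha> a) = FO (Tgt \<alpha>) a"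
      using a by auto
    then show "Cmp (ntrans_hcomp C (Tot (RP code D)) (ntrans_id D (Tot (RP code D)) (unit code D)) \<alpha>) a
      = Cmp (ntrans_hcomp C (Tot (RP code D)) (Tot_ntrans (RP code C) (RP_ntrans code C D \<alpha>))
        (ntrans_id C (Tot (RP code C)) (unit code C))) a"
      using a F.DD.Comp_RP_graph[of "Idn D (FO (Src \<alpha>) a)" "Cmp \<alpha> a" "Idn D (FO (Tgt \<alpha>) a)"]
        F.DD.Comp_RP_graph[of "Idn D (FO (Src \<alpha>) a)" "Idn D (FO (Src \<alpha>) a)" "Cmp \<alpha> a"]
      by (simp add: F.DD.RP.Tot_simps F.CC.RP.Tot_simps)
  qed (use unit_natural assms SF in auto)
qed

section \<open>Counit\<close>

text \<open>If \<open>v\<close> is monic, the two cospans related by \<open>v\<close> have the same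
  pullbacks, so its conjugate is the comparison between two of them. Pullback stability of the
  isomorphisms settles the rest of \<open>S_star\<close>.\<close>

lemma (in stable_fact) S_circ_iso:
  assumes monic: "\<And>v x y. \<lbrakk>v \<in> SCls C; x \<in> Arr C; y \<in> Arr C; Cod C x = Dom C v; Cod C y = Dom C v; v \<cdot> x = v \<cdot> y\<rbrakk>
    \<Longrightarrow> x = y"
    and x: "x \<in> S_circ C"
  shows "iso C x"
proof -
  have "S_circ C \<subseteq> {x. iso C x}"
  proof (rule S_circ_least)
    show "S_star C \<subseteq> {x. iso C x}"
    proof
      fix x assume "x \<in> S_star C"
      then obtain f s g t v w h k where v: "v \<in> SCls C" and w: "conjugate C (f, s) (g, t) v w" and pb: "pullback C h x w k"
        by (auto simp: S_star_def)
      obtain s' f' t' g' where st: "f \<in> Arr C" "Dom C v = Cod C f" "v \<cdot> f = g" "v \<cdot> s = t"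
        "pullback C f s' s f'" "pullback C g t' t g'" "w \<in> Arr C" "Cod C w = Dom C t'" "t' \<cdot> w = s'" "g' \<cdot> w = f'"
        using w by (auto simp: conjugate_def cospan_mor_def cospans_def hom_def)
      have "pullback C g s' t f'"
        using pullback_monic_Comp[OF st(5), of v] monic[OF v] v st by simp
      then obtain u where u: "iso C u" "u \<in> Arr C" "Cod C u = Dom C t'" "t' \<cdot> u = s'" "g' \<cdot> u = f'"
        using pullback_compare[OF st(6)] by metis
      then have "w = u"
        using pullback_uniq[OF st(6), of w u] st by simp
      then show "x \<in> {x. iso C x}"
        using iso_pullback[OF pb] u by simp
    qed
    show "u' \<in> {x. iso C x}" if "u \<in> {x. iso C x}" "pullback C f u' u f'" for u f u' f'
      using iso_pullback[OF that(2)] that by simp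
    show "x \<in> {x. iso C x}" if "p \<in> PCls C" "q \<in> PCls C" "x \<in> SCls C" "y \<in> {x. iso C x}" "commutes C x q p y" for p q x y
    proof -
      have *: "Dom C x = Cod C q" "Dom C p = Cod C y" "x \<cdot> q = p \<cdot> y" "y \<in> PCls C"
        using that P_iso by (auto simp: commutes_def seq_def)
      \<comment> \<open>Both \<open>q\<close> and \<open>x \<cdot> q = p \<cdot> y\<close> lie in P,
        so cancellation applies; a member of both classes is invertible.\<close>
      then have "x \<in> PCls C"
        using P_cancel[of q x] that by simp
      then show ?thesis
        using P_S_iso that by simp
    qed
  qed (auto intro: S_iso)
  then show ?thesis
    using x by blast
qed

definition pinv :: "('o, 'm) rangecat \<Rightarrow> 'm \<Rightarrow> 'm" where
  "pinv X s = (THE j. partial_inverse X s j)"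

definition counit :: "(('m \<times> 'm) set \<Rightarrow> 'm) \<Rightarrow> ('o, 'm) rangecat \<Rightarrow> ('o, 'm, 'o, 'm) func" where
  "counit code X = \<lparr>FO = (\<lambda>a\<in>Ob X. a), FM = (\<lambda>k\<in>Arr (RP code (Tot X)). THE n. \<exists>s f. (s, f) \<in> spans (Tot X) \<and>
     k = zcls code (Tot X) s f \<and> n = f \<cdot>\<^bsub>X\<^esub> pinv X s)\<rparr>"

locale coded_range_category = split_range_category X for X :: "('o, 'm) rangecat" (structure) +
  fixes code :: "('m \<times> 'm) set \<Rightarrow> 'm"
  assumes code: "quotient_coding code"
begin

sublocale T: coded_stable_fact "Tot X" code
  using code stable_fact_Tot by (rule coded_stable_factI)

lemma pinv_eq: "partial_inverse X s j \<Longrightarrow> pinv X s = j"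
  unfolding pinv_def using partial_inverse_unique by blast

lemma span_TotE:
  assumes "(s, f) \<in> spans (Tot X)"
  obtains j where "partial_inverse X s j" "total X f" "Dom X s = Dom X f" "s \<in> SCls (Tot X)"
proof -
  obtain j where "partial_inverse X s j"
    using assms by (auto simp: T.in_spans SCls_Tot)
  then show ?thesis
    using that[of j] assms partial_inverseD(7)[of s j] by (auto simp: T.in_spans)
qed

lemma span_TotI: "partial_inverse X s j \<Longrightarrow> total X f \<Longrightarrow> Dom X s = Dom X f \<Longrightarrow> (s, f) \<in> spans (Tot X)"
  using partial_inverseD(7)[of s j] by (auto simp: T.in_spans SCls_Tot)

lemma S_circ_Tot_iso: "x \<in> S_circ (Tot X) \<Longrightarrow> iso (Tot X) x"
proof (rule T.S_circ_iso)
  fix v x y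
  assume *: "v \<in> SCls (Tot X)" "x \<in> Arr (Tot X)" "y \<in> Arr (Tot X)" "Cod (Tot X) x = Dom (Tot X) v"
    "Cod (Tot X) y = Dom (Tot X) v" "Comp (Tot X) v x = Comp (Tot X) v y"
  then obtain j where j: "partial_inverse X v j"
    by (auto simp: SCls_Tot)
  note D = partial_inverseD[OF j]
  have xy: "x \<in> Arr X" "y \<in> Arr X" "Cod X x = Dom X v" "Cod X y = Dom X v" and eq: "v \<cdot> x = v \<cdot> y"
    using * D by (auto simp: total_Arr)
  have "j \<cdot> (v \<cdot> x) = x" "j \<cdot> (v \<cdot> y) = y"
    using Comp_cancel_L[OF D(5)] D xy by auto
  then show "x = y"
    using eq by metis
qed

lemma FO_counit [simp]: "a \<in> Ob X \<Longrightarrow> FO (counit code X) a = a"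
  by (simp add: counit_def)

text \<open>A change of representative is precomposition with some \<open>x\<close> in
  \<open>S_circ\<close>, here invertible with inverse \<open>y\<close>. It turns
  \<open>g \<cdot> k\<close> into \<open>(g \<cdot> x) \<cdot> (y \<cdot> k)\<close>, which is the
  same morphism.\<close>

lemma FM_counit:
  assumes sp: "(s, f) \<in> spans (Tot X)" and j: "partial_inverse X s j"
  shows "FM (counit code X) (T.cls s f) = f \<cdot> j"
proof -
  have "f \<cdot> pinv X s = g \<cdot> pinv X t" if "(t, g) \<in> spans (Tot X)" "T.cls s f = T.cls t g" for t g
  proof (rule T.cls_lift[OF _ sp that, where G = "\<lambda>s f. f \<cdot> pinv X s"])
    fix t g x
    assume *: "(t, g) \<in> spans (Tot X)" "x \<in> S_circ (Tot X)" "Dom (Tot X) t = Cod (Tot X) x"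
    obtain k where k: "partial_inverse X t k" "total X g" "Dom X t = Dom X g"
      using span_TotE[OF *(1)] .
    obtain y where y: "partial_inverse X x y" "Rng X x = Idn X (Cod X x)"
      using iso_TotD[OF S_circ_Tot_iso[OF *(2)]] .
    note D = partial_inverseD[OF k(1)] partial_inverseD[OF y(1)] total_Arr[OF k(2)]
    have x: "Dom X t = Cod X x"
      using * D by simp
    have xy: "x \<cdot> y = Idn X (Cod X x)"
      using Rng_partial_inverse(1)[OF y(1)] y(2) by simp
    have tx: "pinv X (t \<cdot> x) = y \<cdot> k"
      using partial_inverse_Comp[OF k(1) y(1) x] by (rule pinv_eq)
    have "(g \<cdot> x) \<cdot> (y \<cdot> k) = g \<cdot> (x \<cdot> (y \<cdot> k))"
      using D x k by simp
    also have "x \<cdot> (y \<cdot> k) = k"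
      by (rule Comp_cancel_L[OF xy]) (use D x k in auto)
    finally show "Comp (Tot X) g x \<cdot> pinv X (Comp (Tot X) t x) = g \<cdot> pinv X t"
      using D k tx pinv_eq[OF k(1)] by simp
  qed
  then have "(THE n. \<exists>t g. (t, g) \<in> spans (Tot X) \<and> T.cls s f = T.cls t g \<and> n = g \<cdot> pinv X t) = f \<cdot> pinv X s"
    using sp by (intro the_equality) (blast, metis)
  then show ?thesis
    using sp pinv_eq[OF j] by (simp add: counit_def)
qed

lemma partial_inverse_Idn: "a \<in> Ob X \<Longrightarrow> partial_inverse X (Idn X a) (Idn X a)"
  by (simp add: partial_inverse_def)

lemma FM_counit_graph: "total X f \<Longrightarrow> Dom X f = a \<Longrightarrow> FM (counit code X) (T.cls (Idn X a) f) = f"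
  using FM_counit[of "Idn X a" f "Idn X a"] span_TotI[of "Idn X a" "Idn X a" f] partial_inverse_Idn[of a] total_Arr[of f]
  by auto

lemma SR_func_counit: "SR_func (RP code (Tot X)) X (counit code X)"
proof -
  have func: "is_func (RP code (Tot X)) X (counit code X)"
    unfolding is_func_def
  proof (intro conjI ballI allI impI)
    show "FO (counit code X) \<in> Ob (RP code (Tot X)) \<rightarrow>\<^sub>E Ob X"
      by (auto simp: counit_def)
    have *: "FM (counit code X) k \<in> Arr X \<and> Dom X (FM (counit code X) k) = Dom (RP code (Tot X)) k \<and>
      Cod X (FM (counit code X) k) = Cod (RP code (Tot X)) k" if K: "k \<in> Arr (RP code (Tot X))" for k
    proof -
      obtain s f where k: "(s, f) \<in> spans (Tot X)" "k = T.cls s f"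
        using T.Arr_RPE[OF K] by metis
      obtain j where j: "partial_inverse X s j" "total X f" "Dom X s = Dom X f"
        using span_TotE[OF k(1)] .
      show ?thesis
        using k FM_counit[OF k(1) j(1)] partial_inverseD[OF j(1)] j(2,3) total_Arr[OF j(2)] by simp
    qed
    then show "FM (counit code X) \<in> Arr (RP code (Tot X)) \<rightarrow>\<^sub>E Arr X"
      by (intro PiE_I) (auto simp: counit_def)
    fix k assume k: "k \<in> Arr (RP code (Tot X))"
    then have "Dom (RP code (Tot X)) k \<in> Ob X" "Cod (RP code (Tot X)) k \<in> Ob X"
      using T.RP.Dom_Ob[OF k] T.RP.Cod_Ob[OF k] by simp_all
    then show "Dom X (FM (counit code X) k) = FO (counit code X) (Dom (RP code (Tot X)) k)"
      "Cod X (FM (counit code X) k) = FO (counit code X) (Cod (RP code (Tot X)) k)"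
      using *[OF k] by simp_all
  next
    fix a assume "a \<in> Ob (RP code (Tot X))"
    then show "FM (counit code X) (Idn (RP code (Tot X)) a) = Idn X (FO (counit code X) a)"
      by (simp add: FM_counit_graph)
  next
    fix l k assume lk: "seq (RP code (Tot X)) l k"
    obtain s f where k: "(s, f) \<in> spans (Tot X)" "k = T.cls s f"
      using lk T.Arr_RPE unfolding seq_def by metis
    obtain t g where l: "(t, g) \<in> spans (Tot X)" "l = T.cls t g"
      using lk T.Arr_RPE unfolding seq_def by metis
    obtain j where j: "partial_inverse X s j" "total X f" "Dom X s = Dom X f"
      using span_TotE[OF k(1)] .
    obtain i where i: "partial_inverse X t i" "total X g" "Dom X t = Dom X g"
      using span_TotE[OF l(1)] .
    note D = partial_inverseD[OF j(1)] partial_inverseD[OF i(1)] total_Arr[OF j(2)] total_Arr[OF i(2)]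
    have "Cod (Tot X) f = Cod (Tot X) t"
      using lk k l by (simp add: seq_def)
    then obtain t' f' where pb: "pullback (Tot X) f t' t f'"
      and c: "Comp (RP code (Tot X)) (T.cls t g) (T.cls s f) = T.cls (Comp (Tot X) s t') (Comp (Tot X) g f')"
      "(Comp (Tot X) s t', Comp (Tot X) g f') \<in> spans (Tot X)"
      using T.Comp_RPE[OF k(1) l(1)] by metis
    obtain k' where k': "partial_inverse X t' k'" "t' \<cdot> k' = Rst X (i \<cdot> f)" "total X f" "total X f'"
      "Cod X f = Cod X t" "Cod X t' = Dom X f" "Dom X f' = Dom X t'" "Cod X f' = Dom X t" "f \<cdot> t' = t \<cdot> f'"
      using pullback_TotD[OF pb i(1)] .
    note E = partial_inverseD[OF k'(1)] total_Arr[OF k'(4)]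
    \<comment> \<open>A Beck-Chevalley equation, from which preservation of composition follows.
      Cancelling \<open>t\<close> against \<open>i\<close> reduces \<open>f' \<cdot> k'\<close> to
      \<open>i \<cdot> (f \<cdot> (t' \<cdot> k'))\<close>, and \<open>t' \<cdot> k'\<close> is the
      restriction of \<open>i \<cdot> f\<close>.\<close>
    have "f' \<cdot> k' = i \<cdot> (t \<cdot> (f' \<cdot> k'))"
      by (rule Comp_cancel_L[OF D(12), symmetric]) (use D E k' in auto)
    also have "t \<cdot> (f' \<cdot> k') = f \<cdot> (t' \<cdot> k')"
      by (rule Comp_extend[OF k'(9)[symmetric]]) (use D E k' in auto)
    also have "i \<cdot> (f \<cdot> (t' \<cdot> k')) = (i \<cdot> f) \<cdot> Rst X (i \<cdot> f)"
      unfolding k'(2) using D k' by simp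
    also have "\<dots> = i \<cdot> f"
      using D k' by (intro R1) auto
    finally have eq: "f' \<cdot> k' = i \<cdot> f" .
    have "partial_inverse X (s \<cdot> t') (k' \<cdot> j)"
      using partial_inverse_Comp[OF j(1) k'(1)] k' j by simp
    then have "FM (counit code X) (Comp (RP code (Tot X)) l k) = (g \<cdot> f') \<cdot> (k' \<cdot> j)"
      using FM_counit c k l D E k' i by simp
    also have "\<dots> = g \<cdot> (f' \<cdot> (k' \<cdot> j))"
      using D E k' i j by simp
    also have "f' \<cdot> (k' \<cdot> j) = i \<cdot> (f \<cdot> j)"
      by (rule Comp_extend[OF eq]) (use D E k' i j in auto)
    also have "g \<cdot> (i \<cdot> (f \<cdot> j)) = (g \<cdot> i) \<cdot> (f \<cdot> j)"
      using D E k' i j by simp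
    finally show "FM (counit code X) (Comp (RP code (Tot X)) l k) = FM (counit code X) l \<cdot> FM (counit code X) k"
      using FM_counit[OF k(1) j(1)] FM_counit[OF l(1) i(1)] k l by simp
  qed
  moreover have "FM (counit code X) (Rst (RP code (Tot X)) k) = Rst X (FM (counit code X) k) \<and>
    FM (counit code X) (Rng (RP code (Tot X)) k) = Rng X (FM (counit code X) k)" if K: "k \<in> Arr (RP code (Tot X))" for k
  proof -
    obtain s m p where k: "m \<in> SCls (Tot X)" "p \<in> PCls (Tot X)" "Dom (Tot X) m = Cod (Tot X) p"
      "(s, Comp (Tot X) m p) \<in> spans (Tot X)" "k = T.cls s (Comp (Tot X) m p)"
      using T.Arr_RP_factorE[OF K] by metis
    obtain j where j: "partial_inverse X s j" "total X (Comp (Tot X) m p)" "Dom X s = Dom X (Comp (Tot X) m p)"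
      using span_TotE[OF k(4)] .
    obtain r where r: "partial_inverse X m r"
      using k(1) by (auto simp: SCls_Tot)
    note D = partial_inverseD[OF j(1)] partial_inverseD[OF r]
    have p: "total X p" "Rng X p = Idn X (Cod X p)" "p \<in> Arr X"
      using k(2) by (auto simp: PCls_Tot total_Arr)
    have mp: "Dom X m = Cod X p" "Comp (Tot X) m p = m \<cdot> p" "Dom X s = Dom X p"
      using k(3) p D j by simp_all
    have val: "FM (counit code X) k = (m \<cdot> p) \<cdot> j"
      using FM_counit[OF k(4) j(1)] k(5) mp by simp
    have "(s, s) \<in> spans (Tot X)" "(m, m) \<in> spans (Tot X)"
      using span_TotI[OF j(1)] span_TotI[OF r] D by auto
    then have vals: "FM (counit code X) (T.cls s s) = Rst X j" "FM (counit code X) (T.cls m m) = Rng X m"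
      using FM_counit j(1) r D Rng_partial_inverse(1)[OF r] by simp_all
    have "Rst X ((m \<cdot> p) \<cdot> j) = Rst X j"
      using p D mp by (intro Rst_total_Comp) auto
    \<comment> \<open>The retraction \<open>j\<close> and the P-part \<open>p\<close> both have full
      range, so only \<open>m\<close> contributes.\<close>
    moreover have "Rng X ((m \<cdot> p) \<cdot> j) = Rng X m"
      using Rng_Comp_full[of "m \<cdot> p" j] Rng_Comp_full[of m p] Rng_partial_inverse(2)[OF j(1)] p D mp by simp
    ultimately show ?thesis
      using val vals T.Rst_RP[OF k(4)] T.Rng_RP[OF k(4,1,2,3)] k(5) by simp
  qed
  ultimately show ?thesis
    by (simp add: SR_func_def)
qed

lemma triangle_Total: "func_comp (Tot X) (Tot_func (RP code (Tot X)) (counit code X)) (unit code (Tot X)) = func_id (Tot X)"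
proof -
  have "total T.RPC (T.cls (Idn X (Dom X f)) f)" if "total X f" for f
    using T.total_graph[of f "Dom X f"] that by simp
  then show ?thesis
    by (auto simp: func_comp_def compose_def func_id_def fun_eq_iff FM_counit_graph)
qed

end

lemma coded_range_categoryI: "quotient_coding code \<Longrightarrow> split_range_category X \<Longrightarrow> coded_range_category X code"
  by (simp add: coded_range_category_def coded_range_category_axioms_def)

lemma triangle_RaPar:
  assumes "quotient_coding code" "stable_fact C"
  shows "func_comp (RP code C) (counit code (RP code C)) (RP_func code C (Tot (RP code C)) (unit code C))
    = func_id (RP code C)"
proof -
  interpret C: coded_stable_fact C code using assms by (intro coded_stable_factI)
  interpret R: coded_range_category "RP code C" code
    using assms C.split_range_category_RP by (intro coded_range_categoryI)
  interpret U: coded_sf_functor C "Tot (RP code C)" "unit code C" code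
    using assms C.SF_func_unit C.RP.stable_fact_Tot by (intro coded_sf_functorI)
  show ?thesis
  proof (rule func_eqI[OF is_func_comp[OF C.RP.category_axioms R.T.category_RP C.RP.category_axioms U.is_func_RP
          SR_func_is_func[OF R.SR_func_counit]] is_func_id[OF C.RP.category_axioms]])
    fix k assume k: "k \<in> Arr (RP code C)"
    then obtain s f where *: "s \<in> SCls C" "f \<in> Arr C" "Dom C s = Dom C f" "(s, f) \<in> spans C" "k = zcls code C s f"
      using C.Arr_RPE by metis
    \<comment> \<open>The first leg of the image span is the graph of \<open>s\<close>, whose
      partial inverse is the class \<open>[s, 1]\<close>; the counit therefore returns the graph of
      \<open>f\<close> after \<open>[s, 1]\<close>.\<close>
    have "FM (counit code (RP code C)) (zcls code (Tot (RP code C)) (C.cls (Idn C (Dom C s)) s) (C.cls (Idn C (Dom C f)) f))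
      = Comp (RP code C) (C.cls (Idn C (Dom C f)) f) (C.cls s (Idn C (Dom C s)))"
      using U.FM_spans[OF *(4)] * by (intro R.FM_counit C.graph_partial_inverse) auto
    also have "\<dots> = k"
      using C.Comp_graph_cograph[OF *(4)] * by simp
    finally show "FM (func_comp (RP code C) (counit code (RP code C)) (RP_func code C (Tot (RP code C)) (unit code C))) k
      = FM (func_id (RP code C)) k"
      using k * by simp
  qed simp
qed

text \<open>\<open>F\<close> sends the partial inverse of \<open>s\<close> to that of its image, so
  it commutes with the formula \<open>f \<cdot> j\<close>.\<close>

lemma counit_natural:
  assumes "quotient_coding code" "split_range_category X" "split_range_category Y" "SR_func X Y F"
  shows "func_comp (RP code (Tot X)) (counit code Y) (RP_func code (Tot X) (Tot Y) (Tot_func X F))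
    = func_comp (RP code (Tot X)) F (counit code X)"
proof -
  interpret X: coded_range_category X code using assms by (intro coded_range_categoryI)
  interpret Y: coded_range_category Y code using assms by (intro coded_range_categoryI)
  interpret F: sr_functor X Y F using assms by (intro sr_functorI)
  interpret TF: coded_sf_functor "Tot X" "Tot Y" "Tot_func X F" code
    using assms SF_func_Tot_func X.stable_fact_Tot Y.stable_fact_Tot by (intro coded_sf_functorI) auto
  show ?thesis
  proof (rule func_eqI[OF is_func_comp[OF X.T.category_RP Y.T.category_RP Y.category_axioms TF.is_func_RP
          SR_func_is_func[OF Y.SR_func_counit]]
        is_func_comp[OF X.T.category_RP X.category_axioms Y.category_axioms SR_func_is_func[OF X.SR_func_counit] F.is_func]])
    fix k assume k: "k \<in> Arr (RP code (Tot X))"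
    then obtain s f where *: "(s, f) \<in> spans (Tot X)" "k = X.T.cls s f"
      using X.T.Arr_RPE by metis
    obtain j where j: "partial_inverse X s j" "total X f" "Dom X s = Dom X f"
      using X.span_TotE[OF *(1)] .
    note D = X.partial_inverseD[OF j(1)] X.total_Arr[OF j(2)]
    have "FM (counit code Y) (Y.T.cls (FM F s) (FM F f)) = FM F f \<cdot>\<^bsub>Y\<^esub> FM F j"
      using TF.FM_spans[OF *(1)] D j by (intro Y.FM_counit F.FM_partial_inverse) auto
    then show "FM (func_comp (RP code (Tot X)) (counit code Y) (RP_func code (Tot X) (Tot Y) (Tot_func X F))) k
      = FM (func_comp (RP code (Tot X)) F (counit code X)) k"
      using k * TF.FM_RP_func[OF *(1)] X.FM_counit[OF *(1) j(1)] D j by simp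
  qed simp
qed

text \<open>Components of the transported 2-cell are graphs of total morphisms, and the counit sends
  such a graph back to the morphism.\<close>

lemma counit_natural2:
  assumes "quotient_coding code" "split_range_category X" "split_range_category Y" "SR_ntrans X Y \<alpha>"
  shows "ntrans_hcomp (RP code (Tot X)) Y (ntrans_id (RP code (Tot Y)) Y (counit code Y))
      (RP_ntrans code (Tot X) (Tot Y) (Tot_ntrans X \<alpha>))
    = ntrans_hcomp (RP code (Tot X)) Y \<alpha> (ntrans_id (RP code (Tot X)) X (counit code X))"
proof -
  have SR: "SR_func X Y (Src \<alpha>)" "SR_func X Y (Tgt \<alpha>)"
    using assms by (auto simp: SR_ntrans_def)
  interpret X: coded_range_category X code using assms by (intro coded_range_categoryI)
  interpret Y: coded_range_category Y code using assms by (intro coded_range_categoryI)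
  interpret TG: coded_sf_functor "Tot X" "Tot Y" "Tot_func X (Tgt \<alpha>)" code
    using assms SR SF_func_Tot_func X.stable_fact_Tot Y.stable_fact_Tot by (intro coded_sf_functorI) auto
  interpret F: sr_functor X Y "Src \<alpha>" using assms SR by (intro sr_functorI)
  interpret a: nat_trans X Y \<alpha>
    using assms X.category_axioms Y.category_axioms by (intro nat_transI) (auto simp: SR_ntrans_def)
  show ?thesis
  proof (rule ntrans_eqI[of _ _ "RP code (Tot X)"])
    fix a assume a: "a \<in> Ob (RP code (Tot X))"
    then have "total Y (Cmp \<alpha> a)" "Dom Y (Cmp \<alpha> a) = FO (Src \<alpha>) a"
      using assms by (auto simp: SR_ntrans_def)
    then show "Cmp (ntrans_hcomp (RP code (Tot X)) Y (ntrans_id (RP code (Tot Y)) Y (counit code Y))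
        (RP_ntrans code (Tot X) (Tot Y) (Tot_ntrans X \<alpha>))) a
      = Cmp (ntrans_hcomp (RP code (Tot X)) Y \<alpha> (ntrans_id (RP code (Tot X)) X (counit code X))) a"
      using a by (simp add: Y.FM_counit_graph)
  qed (use counit_natural assms SR in auto)
qed

section \<open>The 2-adjunction\<close>

theorem theorem8:
  fixes code :: "('m \<times> 'm) set \<Rightarrow> 'm"
  assumes "quotient_coding code"
  shows "left_2adjoint
    (StableFact :: (('o, 'm) factcat, ('o, 'm, 'o, 'm) func, ('o, 'm, 'o, 'm) ntrans) twocat)
    (SplitRangeCat :: (('o, 'm) rangecat, ('o, 'm, 'o, 'm) func, ('o, 'm, 'o, 'm) ntrans) twocat)
    (RaPar code) Total"
proof -
  note code = assms
  have Tot: "stable_fact (Tot X)" if "split_range_category X" for X :: "('o, 'm) rangecat"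
    using that by (rule split_range_category.stable_fact_Tot)
  have RP: "split_range_category (RP code C)" if "stable_fact C" for C :: "('o, 'm) factcat"
    using coded_stable_fact.split_range_category_RP[OF coded_stable_factI[OF code that]] .
  have unit: "SF_func C (Tot (RP code C)) (unit code C)" if "stable_fact C" for C :: "('o, 'm) factcat"
    using coded_stable_fact.SF_func_unit[OF coded_stable_factI[OF code that]] .
  have counit: "SR_func (RP code (Tot X)) X (counit code X)" if "split_range_category X" for X :: "('o, 'm) rangecat"
    using coded_range_category.SR_func_counit[OF coded_range_categoryI[OF code that]] .
  have RPf: "SR_func (RP code C) (RP code D) (RP_func code C D F)" if "stable_fact C" "stable_fact D" "SF_func C D F"
    for C D :: "('o, 'm) factcat" and F
    using coded_sf_functor.SR_func_RP[OF coded_sf_functorI[OF code that]] .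
  have RPn: "SR_ntrans (RP code C) (RP code D) (RP_ntrans code C D \<alpha>)" if "stable_fact C" "stable_fact D" "SF_ntrans C D \<alpha>"
    for C D :: "('o, 'm) factcat" and \<alpha>
    using SR_ntrans_RP[OF code that] .
  note [simp] = StableFact_eq SplitRangeCat_eq
  \<comment> \<open>The hom-components of both 2-functors are restricted to their cells, so they can
    be evaluated only at arguments known to be cells; the membership facts above provide this for
    the unit, the counit and their images.\<close>
  have L: "F1 (RaPar code) C D F = RP_func code C D F"
    if "SF_func C D F" for C D :: "('o, 'm) factcat" and F
    using that by (simp_all add: RaPar_def)
  have L2: "F2 (RaPar code) C D \<alpha> = RP_ntrans code C D \<alpha>"
    if "SF_ntrans C D \<alpha>" for C D :: "('o, 'm) factcat" and \<alpha>
    using that by (simp add: RaPar_def)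
  have L0: "F0 (RaPar code) C = RP code C" for C :: "('o, 'm) factcat"
    by (simp add: RaPar_def)
  have R: "F1 Total X Y F = Tot_func X F"
    if "SR_func X Y F" for X Y :: "('o, 'm) rangecat" and F
    using that by (simp add: Total_def)
  have R2: "F2 Total X Y \<alpha> = Tot_ntrans X \<alpha>"
    if "SR_ntrans X Y \<alpha>" for X Y :: "('o, 'm) rangecat" and \<alpha>
    using that by (simp add: Total_def)
  have R0: "F0 Total X = Tot X" for X :: "('o, 'm) rangecat"
    by (simp add: Total_def)
  note LR = L L2 L0 R R2 R0
  have "two_natural StableFact StableFact (twofunc_id StableFact) (twofunc_comp StableFact Total (RaPar code))
    (unit code :: ('o, 'm) factcat \<Rightarrow> _)"
    unfolding two_natural_def
  proof (intro conjI ballI)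
    fix C :: "('o, 'm) factcat"
    assume "C \<in> Ob2 StableFact"
    then show "unit code C \<in> Cell1 StableFact (F0 (twofunc_id StableFact) C) (F0 (twofunc_comp StableFact Total (RaPar code)) C)"
      using unit by (simp add: twofunc_id_def twofunc_comp_def LR)
  next
    fix C D :: "('o, 'm) factcat" and F
    assume "C \<in> Ob2 StableFact" "D \<in> Ob2 StableFact" "F \<in> Cell1 StableFact C D"
    then show "Comp1 StableFact (F0 (twofunc_id StableFact) C) (F0 (twofunc_id StableFact) D)
        (F0 (twofunc_comp StableFact Total (RaPar code)) D) (unit code D) (F1 (twofunc_id StableFact) C D F)
      = Comp1 StableFact (F0 (twofunc_id StableFact) C) (F0 (twofunc_comp StableFact Total (RaPar code)) C)
        (F0 (twofunc_comp StableFact Total (RaPar code)) D) (F1 (twofunc_comp StableFact Total (RaPar code)) C D F) (unit code C)"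
      using RPf by (simp add: twofunc_id_def twofunc_comp_def LR unit_natural[OF code])
  next
    fix C D :: "('o, 'm) factcat" and \<alpha>
    assume "C \<in> Ob2 StableFact" "D \<in> Ob2 StableFact" "\<alpha> \<in> Cell2 StableFact C D"
    then show "Comp2 StableFact (F0 (twofunc_id StableFact) C) (F0 (twofunc_id StableFact) D)
        (F0 (twofunc_comp StableFact Total (RaPar code)) D)
        (Id2 StableFact (F0 (twofunc_id StableFact) D) (F0 (twofunc_comp StableFact Total (RaPar code)) D) (unit code D))
        (F2 (twofunc_id StableFact) C D \<alpha>)
      = Comp2 StableFact (F0 (twofunc_id StableFact) C) (F0 (twofunc_comp StableFact Total (RaPar code)) C)
        (F0 (twofunc_comp StableFact Total (RaPar code)) D) (F2 (twofunc_comp StableFact Total (RaPar code)) C D \<alpha>)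
        (Id2 StableFact (F0 (twofunc_id StableFact) C) (F0 (twofunc_comp StableFact Total (RaPar code)) C) (unit code C))"
      using RPn unit by (simp add: twofunc_id_def twofunc_comp_def LR unit_natural2[OF code])
  qed
  moreover have "two_natural SplitRangeCat SplitRangeCat (twofunc_comp SplitRangeCat (RaPar code) Total)
    (twofunc_id SplitRangeCat) (counit code :: ('o, 'm) rangecat \<Rightarrow> _)"
    unfolding two_natural_def
  proof (intro conjI ballI)
    fix X :: "('o, 'm) rangecat"
    assume "X \<in> Ob2 SplitRangeCat"
    then show "counit code X \<in> Cell1 SplitRangeCat (F0 (twofunc_comp SplitRangeCat (RaPar code) Total) X)
      (F0 (twofunc_id SplitRangeCat) X)"
      using counit by (simp add: twofunc_id_def twofunc_comp_def LR)
  next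
    fix X Y :: "('o, 'm) rangecat" and F
    assume "X \<in> Ob2 SplitRangeCat" "Y \<in> Ob2 SplitRangeCat" "F \<in> Cell1 SplitRangeCat X Y"
    then show "Comp1 SplitRangeCat (F0 (twofunc_comp SplitRangeCat (RaPar code) Total) X)
        (F0 (twofunc_comp SplitRangeCat (RaPar code) Total) Y) (F0 (twofunc_id SplitRangeCat) Y)
        (counit code Y) (F1 (twofunc_comp SplitRangeCat (RaPar code) Total) X Y F)
      = Comp1 SplitRangeCat (F0 (twofunc_comp SplitRangeCat (RaPar code) Total) X) (F0 (twofunc_id SplitRangeCat) X)
        (F0 (twofunc_id SplitRangeCat) Y) (F1 (twofunc_id SplitRangeCat) X Y F) (counit code X)"
      using SF_func_Tot_func[of X Y F] by (simp add: twofunc_id_def twofunc_comp_def LR counit_natural[OF code])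
  next
    fix X Y :: "('o, 'm) rangecat" and \<alpha>
    assume "X \<in> Ob2 SplitRangeCat" "Y \<in> Ob2 SplitRangeCat" "\<alpha> \<in> Cell2 SplitRangeCat X Y"
    then show "Comp2 SplitRangeCat (F0 (twofunc_comp SplitRangeCat (RaPar code) Total) X)
        (F0 (twofunc_comp SplitRangeCat (RaPar code) Total) Y) (F0 (twofunc_id SplitRangeCat) Y)
        (Id2 SplitRangeCat (F0 (twofunc_comp SplitRangeCat (RaPar code) Total) Y) (F0 (twofunc_id SplitRangeCat) Y) (counit code Y))
        (F2 (twofunc_comp SplitRangeCat (RaPar code) Total) X Y \<alpha>)
      = Comp2 SplitRangeCat (F0 (twofunc_comp SplitRangeCat (RaPar code) Total) X) (F0 (twofunc_id SplitRangeCat) X)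
        (F0 (twofunc_id SplitRangeCat) Y) (F2 (twofunc_id SplitRangeCat) X Y \<alpha>)
        (Id2 SplitRangeCat (F0 (twofunc_comp SplitRangeCat (RaPar code) Total) X) (F0 (twofunc_id SplitRangeCat) X) (counit code X))"
      using SF_ntrans_Tot_ntrans[of X Y \<alpha>] counit by (simp add: twofunc_id_def twofunc_comp_def LR counit_natural2[OF code])
  qed
  moreover have "\<forall>C\<in>Ob2 StableFact. Comp1 SplitRangeCat (F0 (RaPar code) C) (F0 (RaPar code) (F0 Total (F0 (RaPar code) C)))
      (F0 (RaPar code) C) (counit code (F0 (RaPar code) C)) (F1 (RaPar code) C (F0 Total (F0 (RaPar code) C)) (unit code C))
    = Id1 SplitRangeCat (F0 (RaPar code) (C :: ('o, 'm) factcat))"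
    using unit by (simp add: LR triangle_RaPar[OF code])
  moreover have "\<forall>X\<in>Ob2 SplitRangeCat. Comp1 StableFact (F0 Total X) (F0 Total (F0 (RaPar code) (F0 Total X))) (F0 Total X)
      (F1 Total (F0 (RaPar code) (F0 Total X)) X (counit code X)) (unit code (F0 Total X))
    = Id1 StableFact (F0 Total (X :: ('o, 'm) rangecat))"
    using counit by (simp add: LR coded_range_category.triangle_Total[OF coded_range_categoryI[OF code]])
  ultimately show ?thesis
    unfolding left_2adjoint_def using two_functor_RaPar[OF code] two_functor_Total by blast
qed

end
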